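(* Let $n\ge 3$ be an integer and $r>0$. For every $m\in\{-1,0,1,2,\ldots\}$, the $m$-th moment $M_m(\mathcal{P}_{n,r})=\mathbb{E}[\varDelta_{n,r}^m]$ of the distance $\varDelta_{n,r}$ between two uniformly and independently distributed random points in the regular polygon $\mathcal{P}_{n,r}$ is given by $$M_m(\mathcal{P}_{n,r})=\frac{2L}{(m+2)\,A^2\,\ell_1}\sum_{k=0}^{K}\widetilde{J}_{m,k}(\ell_{k+1}),$$ where, for $\ell_k\le x\le \ell_{k+1}$, $$\widetilde{J}_{m,k}(x)=\begin{cases} \widetilde H^{(0)}_{m,k}(x) & \text{if } k=0 \text{ and } x<\lambda,\\ \widetilde H^{(1)}_{m,k}(x)-\widetilde H^{(1)}_{m,k}(\ell_k) & \text{if } (n \text{ is even and } 1\le k\le K-1) \text{ or } (n \text{ is odd and } 1\le k\le K \text{ and } x<\lambda),\\ \widetilde H^{(2)}_{m,k}(x)-\widetilde H^{(2)}_{m,k}(\ell_k) & \text{if } n \text{ is even and } k=K,\\ \widetilde H^{(3)}_{m,k}(x)-\widetilde H^{(3)}_{m,k}(\lambda)+\widetilde H^{(0)}_{m,k}(\lambda) & \text{if } n=3,\ k=0 \text{ and } x\ge\lambda,\\ \widetilde H^{(3)}_{m,k}(x)-\widetilde H^{(3)}_{m,k}(\lambda)+\widetilde H^{(1)}_{m,k}(\lambda)-\widetilde H^{(1)}_{m,k}(\ell_k) & \text{if } n \text{ is odd},\ n>3 \text{ and } x\ge\lambda, \end{cases}$$ with \begin{align*} \widetilde H^{(0)}_{m,k}(x)={}&\frac{\ell_1x^{m+3}}{m+3}-\frac{[1+\alpha(\tan\alpha-\cot\alpha)]\,x^{m+4}}{2(m+4)},\\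 \widetilde H^{(1)}_{m,k}(x)={}&p_k\,\widetilde\sigma_{m+3,h_k}(x)-[k\alpha\cot(2k\alpha)-(k+1)\alpha\cot(2(k+1)\alpha)]\frac{x^{m+4}}{m+4}-(h_kp_k+2rq_k\cos\alpha)\,\widetilde\tau_{m+1,h_k}(x),\\ \widetilde H^{(2)}_{m,k}(x)={}&\Big(\tfrac12-k\alpha\cot(2k\alpha)\Big)\frac{x^{m+4}}{m+4}+\cot(2k\alpha)\,\widetilde\sigma_{m+3,h_k}(x)-(h_k-2r\cos\alpha)\,h_k\,\frac{x^{m+2}}{m+2}\\ &-[h_k\cot(2k\alpha)+2r\cos\alpha\tan(k\alpha)]\,\widetilde\tau_{m+1,h_k}(x),\\ \widetilde H^{(3)}_{m,k}(x)={}&p_k\,\widetilde\sigma_{m+3,h_k}(x)+2\cot(2(k+1)\alpha)\,\widetilde\sigma_{m+3,\lambda}(x)-[(\pi-\alpha)\cot(2(k+1)\alpha)+s_k]\frac{x^{m+4}}{m+4}\\ &-(h_kp_k+2rq_k\cos\alpha)\,\widetilde\tau_{m+1,h_k}(x)\\ &-2\cos\alpha\,[2r\cos(\alpha/2)\sec((k+1)\alpha)-\lambda\csc(2(k+1)\alpha)]\,\widetilde\tau_{m+1,\lambda}(x). \end{align*}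
   Context: $\mathcal{P}_{n,r}$ is the (filled) regular polygon with $n$ sides whose circumscribed circle has radius $r$. $\varDelta_{n,r}$ is the Euclidean distance between two points chosen independently and uniformly (w.r.t. area) from $\mathcal{P}_{n,r}$. Notation: $\alpha=\pi/n$; $K=\lfloor n/2\rfloor-1$; $\ell_k=2r\sin(k\alpha)$; $\lambda=2r\cos^2(\alpha/2)=r+r\cos\alpha$; $L=2nr\sin\alpha$ (perimeter of $\mathcal{P}_{n,r}$); $A=\tfrac12nr^2\sin(2\alpha)$ (area of $\mathcal{P}_{n,r}$); $h_k=2r\sin(k\alpha)\sin((k+1)\alpha)$; $p_k=0$ if $n=3$ and $p_k=\cot(2k\alpha)-\cot(2(k+1)\alpha)$ if $n>3$; $q_k=\tan(k\alpha)-\tan((k+1)\alpha)$; $s_k=1/2$ if $n=3$ and $s_k=k\alpha p_k$ if $n>3$. (These quantities are only used for those $k$ for which the trigonometric functions involved are defined.) One has $\ell_K<\lambda<\ell_{K+1}$ if $n>3$ or $n=3$ (with $\ell_0=0$), and $\ell_{K+1}$ is the diameter of $\mathcal{P}_{n,r}$; so for odd $n$ the condition $x\ge\lambda$ forces $k=K$. For $a>0$ and $\mu=-1,0,1,2,\ldots$ put $$\widetilde\psi_{\mu,a}(x)=\begin{cases}-\frac1a\arcsin\frac ax & \mu=-1,\\ \ln\frac{x+\sqrt{x^2-a^2}}{a} & \mu=0,\\ \frac{x^{\mu-1}\sqrt{x^2-a^2}\,\gamma_{\mu,a}(x)}{\mu} & \mu=1,3,5,\ldots,\\ \frac{x^{\mu-1}\sqrt{x^2-a^2}\,\gamma_{\mu,a}(x)}{\mu}+\frac{(\mu-1)!!\,a^\mu}{\mu!!}\ln\frac{x+\sqrt{x^2-a^2}}{a}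 & \mu=2,4,6,\ldots,\end{cases}\qquad \gamma_{\mu,a}(x)=1+\sum_{\nu=1}^{\lfloor(\mu-1)/2\rfloor}\Big(\frac ax\Big)^{2\nu}\prod_{j=1}^{\nu}\frac{\mu+1-2j}{\mu-2j}.$$ For $\mu=0,1,2,\ldots$: $\widetilde\sigma_{\mu,a}(x)=\frac{1}{\mu+1}\left(x^{\mu+1}\arcsin\frac ax+a\,\widetilde\psi_{\mu,a}(x)\right)$ if $a>0$, and $\widetilde\sigma_{\mu,0}(x)=0$. For $\mu=-1,0,1,2,\ldots$: $\widetilde\tau_{\mu,a}(x)=\frac{1}{\mu+2}\left(x^{\mu+1}\sqrt{x^2-a^2}-a^2\,\widetilde\psi_{\mu,a}(x)\right)$ if $a>0$, and $\widetilde\tau_{\mu,0}(x)=\frac{x^{\mu+2}}{\mu+2}$. *)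

theory Defs
  imports "HOL-Probability.Probability"
begin

text \<open>The plane is modelled by the type \<^typ>\<open>complex\<close>, on which \<^term>\<open>lborel\<close> is the area measure.
  The polygon may have an arbitrary centre \<open>c\<close> and orientation \<open>\<theta>\<close>; \<open>r\<close> is its circumradius.\<close>

definition regular_polygon :: "complex \<Rightarrow> real \<Rightarrow> nat \<Rightarrow> real \<Rightarrow> complex set" where
  "regular_polygon c \<theta> n r =
     convex hull ((\<lambda>j. c + of_real r * cis (\<theta> + 2 * pi * real j / real n)) ` {..<n})"

definition alpha :: "nat \<Rightarrow> real" where
  "alpha n = pi / real n"

definition Kmax :: "nat \<Rightarrow> nat" where
  "Kmax n = n div 2 - 1"

definition ell :: "nat \<Rightarrow> real \<Rightarrow> nat \<Rightarrow> real" where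
  "ell n r k = 2 * r * sin (real k * alpha n)"

definition lam :: "nat \<Rightarrow> real \<Rightarrow> real" where
  "lam n r = 2 * r * (cos (alpha n / 2))\<^sup>2"

definition perim :: "nat \<Rightarrow> real \<Rightarrow> real" where
  "perim n r = 2 * real n * r * sin (alpha n)"

definition area :: "nat \<Rightarrow> real \<Rightarrow> real" where
  "area n r = 1 / 2 * real n * r\<^sup>2 * sin (2 * alpha n)"

definition hh :: "nat \<Rightarrow> real \<Rightarrow> nat \<Rightarrow> real" where
  "hh n r k = 2 * r * sin (real k * alpha n) * sin (real (k + 1) * alpha n)"

definition pp :: "nat \<Rightarrow> nat \<Rightarrow> real" where
  "pp n k = (if n = 3 then 0
     else cot (2 * real k * alpha n) - cot (2 * real (k + 1) * alpha n))"

definition qq :: "nat \<Rightarrow> nat \<Rightarrow> real" where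
  "qq n k = tan (real k * alpha n) - tan (real (k + 1) * alpha n)"

definition ss :: "nat \<Rightarrow> nat \<Rightarrow> real" where
  "ss n k = (if n = 3 then 1 / 2 else real k * alpha n * pp n k)"

text \<open>The index \<open>\<mu>\<close> is an integer, and only \<open>\<mu> \<ge> -1\<close> is meaningful.\<close>

fun dfact :: "nat \<Rightarrow> nat" where
  "dfact 0 = 1"
| "dfact (Suc 0) = 1"
| "dfact (Suc (Suc n)) = Suc (Suc n) * dfact n"

definition gam :: "int \<Rightarrow> real \<Rightarrow> real \<Rightarrow> real" where
  "gam \<mu> a x = 1 + (\<Sum>\<nu>=1..nat ((\<mu> - 1) div 2).
     (a / x) ^ (2 * \<nu>) * (\<Prod>j=1..\<nu>. (of_int \<mu> + 1 - 2 * real j) / (of_int \<mu> - 2 * real j)))"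

definition psi :: "int \<Rightarrow> real \<Rightarrow> real \<Rightarrow> real" where
  "psi \<mu> a x =
    (if \<mu> = -1 then - (1 / a) * arcsin (a / x)
     else if \<mu> = 0 then ln ((x + sqrt (x\<^sup>2 - a\<^sup>2)) / a)
     else if odd \<mu> then x powi (\<mu> - 1) * sqrt (x\<^sup>2 - a\<^sup>2) * gam \<mu> a x / of_int \<mu>
     else x powi (\<mu> - 1) * sqrt (x\<^sup>2 - a\<^sup>2) * gam \<mu> a x / of_int \<mu>
       + real (dfact (nat (\<mu> - 1))) * a powi \<mu> / real (dfact (nat \<mu>))
         * ln ((x + sqrt (x\<^sup>2 - a\<^sup>2)) / a))"

definition sigma_fn :: "int \<Rightarrow> real \<Rightarrow> real \<Rightarrow> real" where
  "sigma_fn \<mu> a x = (if a = 0 then 0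
     else 1 / of_int (\<mu> + 1) * (x powi (\<mu> + 1) * arcsin (a / x) + a * psi \<mu> a x))"

definition tau_fn :: "int \<Rightarrow> real \<Rightarrow> real \<Rightarrow> real" where
  "tau_fn \<mu> a x = (if a = 0 then x powi (\<mu> + 2) / of_int (\<mu> + 2)
     else 1 / of_int (\<mu> + 2) * (x powi (\<mu> + 1) * sqrt (x\<^sup>2 - a\<^sup>2) - a\<^sup>2 * psi \<mu> a x))"

definition H0 :: "nat \<Rightarrow> real \<Rightarrow> int \<Rightarrow> real \<Rightarrow> real" where
  "H0 n r m x =
     ell n r 1 * x powi (m + 3) / of_int (m + 3)
     - (1 + alpha n * (tan (alpha n) - cot (alpha n))) * x powi (m + 4) / (2 * of_int (m + 4))"

definition H1 :: "nat \<Rightarrow> real \<Rightarrow> int \<Rightarrow> nat \<Rightarrow> real \<Rightarrow> real" where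
  "H1 n r m k x =
     pp n k * sigma_fn (m + 3) (hh n r k) x
     - (real k * alpha n * cot (2 * real k * alpha n)
        - real (k + 1) * alpha n * cot (2 * real (k + 1) * alpha n))
       * (x powi (m + 4) / of_int (m + 4))
     - (hh n r k * pp n k + 2 * r * qq n k * cos (alpha n)) * tau_fn (m + 1) (hh n r k) x"

definition H2 :: "nat \<Rightarrow> real \<Rightarrow> int \<Rightarrow> nat \<Rightarrow> real \<Rightarrow> real" where
  "H2 n r m k x =
     (1 / 2 - real k * alpha n * cot (2 * real k * alpha n)) * (x powi (m + 4) / of_int (m + 4))
     + cot (2 * real k * alpha n) * sigma_fn (m + 3) (hh n r k) x
     - (hh n r k - 2 * r * cos (alpha n)) * hh n r k * (x powi (m + 2) / of_int (m + 2))
     - (hh n r k * cot (2 * real k * alpha n) + 2 * r * cos (alpha n) * tan (real k * alpha n))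
       * tau_fn (m + 1) (hh n r k) x"

definition H3 :: "nat \<Rightarrow> real \<Rightarrow> int \<Rightarrow> nat \<Rightarrow> real \<Rightarrow> real" where
  "H3 n r m k x =
     pp n k * sigma_fn (m + 3) (hh n r k) x
     + 2 * cot (2 * real (k + 1) * alpha n) * sigma_fn (m + 3) (lam n r) x
     - ((pi - alpha n) * cot (2 * real (k + 1) * alpha n) + ss n k)
       * (x powi (m + 4) / of_int (m + 4))
     - (hh n r k * pp n k + 2 * r * qq n k * cos (alpha n)) * tau_fn (m + 1) (hh n r k) x
     - 2 * cos (alpha n)
       * (2 * r * cos (alpha n / 2) * (1 / cos (real (k + 1) * alpha n))
          - lam n r * (1 / sin (2 * real (k + 1) * alpha n)))
       * tau_fn (m + 1) (lam n r) x"

text \<open>Only meant for \<open>k \<le> Kmax n\<close> and \<open>ell n r k \<le> x \<le> ell n r (k + 1)\<close>, where the listed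
  cases are exhaustive and mutually exclusive.\<close>

definition JJ :: "nat \<Rightarrow> real \<Rightarrow> int \<Rightarrow> nat \<Rightarrow> real \<Rightarrow> real" where
  "JJ n r m k x =
    (if k = 0 \<and> x < lam n r then H0 n r m x
     else if (even n \<and> 1 \<le> k \<and> k \<le> Kmax n - 1) \<or> (odd n \<and> 1 \<le> k \<and> k \<le> Kmax n \<and> x < lam n r)
     then H1 n r m k x - H1 n r m k (ell n r k)
     else if even n \<and> k = Kmax n
     then H2 n r m k x - H2 n r m k (ell n r k)
     else if n = 3 \<and> k = 0 \<and> lam n r \<le> x
     then H3 n r m k x - H3 n r m k (lam n r) + H0 n r m (lam n r)
     else if odd n \<and> n > 3 \<and> lam n r \<le> x
     then H3 n r m k x - H3 n r m k (lam n r) + H1 n r m k (lam n r) - H1 n r m k (ell n r k)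
     else undefined)"

end

theory Submission
  imports Defs
begin

text \<open>
  The integral of \<open>|x - y|^m\<close> over \<open>P \<times> P\<close> is reduced to one-dimensional integrals by using homogeneity
  twice. Decomposing a convex polygon \<open>P\<close> into the triangles spanned by a point and the edges,
  first from a point \<open>x\<close> of \<open>P\<close> and then from a point of an edge, turns it into a sum over pairs of
  edges of double integrals over the two edge parameters. With \<open>z\<close> the difference of the two edge
  points and \<open>a\<close>, \<open>b\<close> the edge vectors, the integrand is
  \<open>- cross z a * cross z b * |z|^m\<close>; up to a mixed derivative of \<open>|z|^(m+4)\<close>, whose integrals
  telescope around the polygon, it is a multiple of \<open>(a \<bullet> b) * |z|^(m+2)\<close>.

  For two edges on intersecting lines, \<open>|z|^(m+2)\<close> is homogeneous around the intersection point, so that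
  only the integrals \<open>I k\<close> of \<open>|v - y|^(m+2)\<close> over the \<open>k\<close>-th edge seen from a vertex \<open>v\<close> remain; these are
  differences of values of \<open>psi (m + 3)\<close>. Parallel edges are treated by hand. On the other side, the
  pieces \<open>JJ\<close> of the formula consist of a telescoping part \<open>T (k + 1) - T k\<close> and a multiple of \<open>I k\<close>.
\<close>

subsection \<open>Planar Lebesgue measure and cones\<close>

text \<open>For m = -1 the kernel is unbounded on the diagonal. The whole reduction to edges is
  therefore carried out with nonnegative Lebesgue integrals, where decomposition and exchange of
  integrals need no integrability; that the moment is integrable comes out at the end. The two uses
  of homogeneity give the radial factors 1 / (m + 2) and 1 / (m + 3). The second one is available
  because the weight left by the first, the area \<open>d j x\<close> of the triangle over side j,
  is itself homogeneous about every point of side j. From then on only q = m + 2 \<ge> 1 matters,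
  and the integrands on the parameter square are continuous even for adjacent sides, whose
  difference vanishes at a corner of the square. There the norm is not differentiable, so
  derivatives are only taken of products with a linear factor. In the final comparison a pair of
  sides at index distance k contributes both \<open>I k\<close> and \<open>I (k - 1)\<close>, while
  the k-th piece of the formula contributes \<open>I k\<close> alone. A trigonometric identity
  merges the two contributions to each \<open>I k\<close> into one weight \<open>w k\<close>; the
  parity of n only affects the loose end of this summation.\<close>

definition cross :: "complex \<Rightarrow> complex \<Rightarrow> real" where
  "cross a b = Re a * Im b - Im a * Re b"

text \<open>\<open>lborel\<close> is characterised by its values on boxes, and a box in the plane is
  a product of two intervals.\<close>

lemma lborel_complex_eq: "distr (lborel \<Otimes>\<^sub>M lborel) borel (\<lambda>(x, y). Complex x y) = lborel"
proof (rule lborel_eqI[symmetric])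
  have meas: "(\<lambda>(x, y). Complex x y) \<in> borel_measurable (borel \<Otimes>\<^sub>M borel)"
    unfolding borel_prod by (intro borel_measurable_continuous_onI) (auto simp: case_prod_beta Complex_eq intro!: continuous_intros)
  fix l u :: complex
  assume le: "\<And>b. b \<in> Basis \<Longrightarrow> l \<bullet> b \<le> u \<bullet> b"
  have le': "Re l \<le> Re u" "Im l \<le> Im u"
    using le[of 1] le[of \<i>] by (auto simp: Basis_complex_def)
  have vim: "(\<lambda>(x, y). Complex x y) -` box l u = box (Re l) (Re u) \<times> box (Im l) (Im u)"
    by (auto simp: in_box_complex_iff)
  have "emeasure (distr (lborel \<Otimes>\<^sub>M lborel) borel (\<lambda>(x, y). Complex x y)) (box l u)
      = emeasure (lborel \<Otimes>\<^sub>M lborel) (box (Re l) (Re u) \<times> box (Im l) (Im u))"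
    using meas by (subst emeasure_distr) (auto simp: vim space_pair_measure)
  also have "\<dots> = emeasure lborel (box (Re l) (Re u)) * emeasure lborel (box (Im l) (Im u))"
    by (rule lborel.emeasure_pair_measure_Times) auto
  also have "\<dots> = (\<Prod>b\<in>Basis. (u - l) \<bullet> b)"
    using le' by (simp add: Basis_complex_def ennreal_mult)
  finally show "emeasure (distr (lborel \<Otimes>\<^sub>M lborel) borel (\<lambda>(x, y). Complex x y)) (box l u) = (\<Prod>b\<in>Basis. (u - l) \<bullet> b)" .
qed simp

lemma borel_measurable_Complex[measurable (raw)]:
  assumes [measurable]: "f \<in> borel_measurable M" "g \<in> borel_measurable M"
  shows "(\<lambda>x. Complex (f x) (g x)) \<in> borel_measurable M"
  unfolding Complex_eq by measurable

lemma borel_measurable_cross[measurable (raw)]: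
  assumes [measurable]: "f \<in> borel_measurable M" "g \<in> borel_measurable M"
  shows "(\<lambda>x. cross (f x) (g x)) \<in> borel_measurable M"
  unfolding cross_def by measurable

lemma nn_integral_lborel_complex:
  assumes [measurable]: "f \<in> borel_measurable borel"
  shows "(\<integral>\<^sup>+z. f z \<partial>lborel) = (\<integral>\<^sup>+x. \<integral>\<^sup>+y. f (Complex x y) \<partial>lborel \<partial>lborel)"
proof -
  have [measurable]: "(\<lambda>(x, y). Complex x y) \<in> borel_measurable (lborel \<Otimes>\<^sub>M lborel)"
    by measurable
  have "(\<integral>\<^sup>+z. f z \<partial>lborel) = (\<integral>\<^sup>+z. f (case z of (x, y) \<Rightarrow> Complex x y) \<partial>(lborel \<Otimes>\<^sub>M lborel))"
    by (subst lborel_complex_eq[symmetric], subst nn_integral_distr) auto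
  also have "\<dots> = (\<integral>\<^sup>+x. \<integral>\<^sup>+y. f (Complex x y) \<partial>lborel \<partial>lborel)"
    by (subst lborel.nn_integral_fst[symmetric]) auto
  finally show ?thesis .
qed

lemma nn_integral_lborel_swap:
  fixes f :: "real \<Rightarrow> real \<Rightarrow> ennreal"
  assumes "case_prod f \<in> borel_measurable borel"
  shows "(\<integral>\<^sup>+x. \<integral>\<^sup>+y. f x y \<partial>lborel \<partial>lborel) = (\<integral>\<^sup>+y. \<integral>\<^sup>+x. f x y \<partial>lborel \<partial>lborel)"
  using assms by (intro lborel_pair.Fubini'[symmetric]) (simp add: lborel_prod)

lemma nn_integral_lborel_real_scale:
  assumes [measurable]: "f \<in> borel_measurable borel" and "c \<noteq> 0"
  shows "(\<integral>\<^sup>+x. f x \<partial>lborel) = ennreal \<bar>c\<bar> * (\<integral>\<^sup>+x. f (t + c * x) \<partial>lborel)"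
  using nn_integral_real_affine[OF assms] by simp

text \<open>Gaussian elimination with pivot \<open>Re a\<close>: substitute for the real part first,
  with factor \<open>Re a\<close>, then for the imaginary part along a vertical line, with factor
  \<open>d\<close>. Both are one-dimensional affine substitutions, and the factors multiply to
  \<open>cross a b\<close>.\<close>

lemma nn_integral_lborel_complex_affine_aux:
  fixes p a b :: complex
  assumes [measurable]: "f \<in> borel_measurable borel" and "cross a b \<noteq> 0" "Re a \<noteq> 0"
  shows "(\<integral>\<^sup>+z. f z \<partial>lborel)
    = ennreal \<bar>cross a b\<bar> * (\<integral>\<^sup>+x. \<integral>\<^sup>+y. f (p + of_real x * a + of_real y * b) \<partial>lborel \<partial>lborel)"
proof -
  define d where "d = cross a b / Re a"
  have d0: "d \<noteq> 0" using assms by (simp add: d_def)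
  define g where "g = (\<lambda>x y. f (p + of_real x * a + of_real y * b))"
  define g' where "g' = (\<lambda>X y. f (Complex X (Im p + Im a / Re a * (X - Re p) + d * y)))"
  have [measurable]: "case_prod g \<in> borel_measurable borel" "case_prod g' \<in> borel_measurable borel"
    unfolding g_def g'_def by (simp_all add: borel_prod[symmetric])
  have [measurable]: "\<And>y. (\<lambda>X. g' X y) \<in> borel_measurable borel"
    unfolding g'_def by measurable
  have "ennreal \<bar>cross a b\<bar> * (\<integral>\<^sup>+x. \<integral>\<^sup>+y. g x y \<partial>lborel \<partial>lborel)
    = ennreal \<bar>d\<bar> * (ennreal \<bar>Re a\<bar> * (\<integral>\<^sup>+y. \<integral>\<^sup>+x. g x y \<partial>lborel \<partial>lborel))"
    using assms(3) by (subst nn_integral_lborel_swap)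
      (auto simp: d_def mult.assoc[symmetric] ennreal_mult[symmetric] abs_divide)
  also have "ennreal \<bar>Re a\<bar> * (\<integral>\<^sup>+y. \<integral>\<^sup>+x. g x y \<partial>lborel \<partial>lborel)
      = (\<integral>\<^sup>+y. ennreal \<bar>Re a\<bar> * (\<integral>\<^sup>+x. g x y \<partial>lborel) \<partial>lborel)"
    unfolding g_def by (rule nn_integral_cmult[symmetric]) measurable
  also have "\<dots> = (\<integral>\<^sup>+y. \<integral>\<^sup>+X. g' X y \<partial>lborel \<partial>lborel)"
  proof (rule nn_integral_cong)
    fix y
    have *: "g' ((Re p + y * Re b) + Re a * x) y = g x y" for x
      unfolding g_def g'_def using assms(3)
      by (intro arg_cong[of _ _ f]) (auto simp: complex_eq_iff d_def cross_def field_simps)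
    show "ennreal \<bar>Re a\<bar> * (\<integral>\<^sup>+x. g x y \<partial>lborel) = (\<integral>\<^sup>+X. g' X y \<partial>lborel)"
      using nn_integral_lborel_real_scale[of "\<lambda>X. g' X y" "Re a" "Re p + y * Re b"] assms(3)
      by (simp add: *)
  qed
  also have "\<dots> = (\<integral>\<^sup>+X. \<integral>\<^sup>+y. g' X y \<partial>lborel \<partial>lborel)"
    by (rule nn_integral_lborel_swap[symmetric]) simp
  also have "ennreal \<bar>d\<bar> * \<dots> = (\<integral>\<^sup>+X. ennreal \<bar>d\<bar> * (\<integral>\<^sup>+y. g' X y \<partial>lborel) \<partial>lborel)"
    unfolding g'_def by (rule nn_integral_cmult[symmetric]) measurable
  also have "\<dots> = (\<integral>\<^sup>+X. \<integral>\<^sup>+y. f (Complex X y) \<partial>lborel \<partial>lborel)"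
    unfolding g'_def by (intro nn_integral_cong nn_integral_lborel_real_scale[symmetric] d0) measurable
  also have "\<dots> = (\<integral>\<^sup>+z. f z \<partial>lborel)"
    by (rule nn_integral_lborel_complex[symmetric]) simp
  finally show ?thesis by (simp add: g_def)
qed

lemma nn_integral_lborel_complex_affine:
  fixes p a b :: complex
  assumes [measurable]: "f \<in> borel_measurable borel" and "cross a b \<noteq> 0"
  shows "(\<integral>\<^sup>+z. f z \<partial>lborel)
    = ennreal \<bar>cross a b\<bar> * (\<integral>\<^sup>+x. \<integral>\<^sup>+y. f (p + of_real x * a + of_real y * b) \<partial>lborel \<partial>lborel)"
proof (cases "Re a = 0")
  case True
  then have *: "Re b \<noteq> 0" "cross b a \<noteq> 0" "\<bar>cross b a\<bar> = \<bar>cross a b\<bar>"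
    using assms(2) by (auto simp: cross_def abs_mult)
  have "(\<integral>\<^sup>+x. \<integral>\<^sup>+y. f (p + of_real x * a + of_real y * b) \<partial>lborel \<partial>lborel)
     = (\<integral>\<^sup>+x. \<integral>\<^sup>+y. f (p + of_real x * b + of_real y * a) \<partial>lborel \<partial>lborel)"
    by (subst nn_integral_lborel_swap) (simp_all add: borel_prod[symmetric] add_ac)
  then show ?thesis
    using nn_integral_lborel_complex_affine_aux[OF assms(1), of b a p] * by simp
next
  case False
  then show ?thesis using nn_integral_lborel_complex_affine_aux assms by blast
qed

text \<open>\<open>s\<close> is the scaling factor about \<open>p\<close> and \<open>u\<close> the
  position on the line through \<open>p + a\<close>; in these coordinates functions homogeneous
  about \<open>p\<close> separate.\<close>

definition cone_set :: "complex \<Rightarrow> complex \<Rightarrow> complex \<Rightarrow> real set \<Rightarrow> real set \<Rightarrow> complex set" where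
  "cone_set p a b S U = {p + of_real s * (a + of_real u * b) | s u. s \<in> S \<and> u \<in> U}"

lemma cone_set_iff:
  assumes "cross a b \<noteq> 0" "0 \<notin> S"
  shows "p + of_real s * a + of_real t * b \<in> cone_set p a b S U \<longleftrightarrow> s \<in> S \<and> t / s \<in> U"
proof
  assume "p + of_real s * a + of_real t * b \<in> cone_set p a b S U"
  then obtain s' u where *: "s' \<in> S" "u \<in> U"
    "p + of_real s * a + of_real t * b = p + of_real s' * (a + of_real u * b)"
    by (auto simp: cone_set_def)
  have eq: "of_real (s - s') * a = of_real (s' * u - t) * b"
    using *(3) by (simp add: algebra_simps)
  have "cross (of_real (s - s') * a) b = 0"
    unfolding eq by (simp add: cross_def)
  moreover have "cross a (of_real (s' * u - t) * b) = 0"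
    unfolding eq[symmetric] by (simp add: cross_def)
  ultimately have "(s - s') * cross a b = 0" "(s' * u - t) * cross a b = 0"
    by (simp_all add: cross_def algebra_simps)
  then have "s = s'" "t = s' * u" using assms by auto
  then show "s \<in> S \<and> t / s \<in> U" using * assms by auto
next
  assume "s \<in> S \<and> t / s \<in> U"
  moreover have "p + of_real s * a + of_real t * b = p + of_real s * (a + of_real (t / s) * b)"
    if "s \<noteq> 0" using that by (simp add: algebra_simps)
  ultimately show "p + of_real s * a + of_real t * b \<in> cone_set p a b S U"
    unfolding cone_set_def using assms(2) by (auto simp del: of_real_divide)
qed

text \<open>Cramer's rule recovers both coordinates; the explicit form makes the measurability of
  the cone visible.\<close>

lemma cone_set_eq:
  assumes "cross a b \<noteq> 0" "0 \<notin> S"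
  shows "cone_set p a b S U = {z. cross (z - p) b / cross a b \<in> S \<and>
     (cross a (z - p) / cross a b) / (cross (z - p) b / cross a b) \<in> U}"
proof -
  have "z = p + of_real (cross (z - p) b / cross a b) * a + of_real (cross a (z - p) / cross a b) * b" for z
    using assms(1) by (auto simp: complex_eq_iff divide_simps) (auto simp: cross_def algebra_simps)
  then have "z \<in> cone_set p a b S U \<longleftrightarrow> cross (z - p) b / cross a b \<in> S \<and>
     (cross a (z - p) / cross a b) / (cross (z - p) b / cross a b) \<in> U" for z
    using cone_set_iff[OF assms] by metis
  then show ?thesis by blast
qed

lemma cone_set_measurable:
  assumes "cross a b \<noteq> 0" "0 \<notin> S" and [measurable]: "S \<in> sets borel" "U \<in> sets borel"
  shows "cone_set p a b S U \<in> sets borel"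
  unfolding cone_set_eq[OF assms(1,2)] by measurable

text \<open>After the affine substitution, t = s * u is substituted for fixed s, which produces the
  Jacobian factor s.\<close>

lemma nn_integral_cone_set:
  assumes [measurable]: "f \<in> borel_measurable borel" and "cross a b > 0" "S \<subseteq> {0<..}"
    and [measurable]: "S \<in> sets borel" "U \<in> sets borel"
  shows "(\<integral>\<^sup>+z. f z * indicator (cone_set p a b S U) z \<partial>lborel)
    = ennreal (cross a b) * (\<integral>\<^sup>+s. \<integral>\<^sup>+u. ennreal s * f (p + of_real s * (a + of_real u * b)) *
        indicator S s * indicator U u \<partial>lborel \<partial>lborel)"
proof -
  have nz: "cross a b \<noteq> 0" "0 \<notin> S" using assms by auto
  note [measurable] = cone_set_measurable[OF nz assms(4,5)]
  have "(\<integral>\<^sup>+z. f z * indicator (cone_set p a b S U) z \<partial>lborel)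
    = ennreal (cross a b) * (\<integral>\<^sup>+s. \<integral>\<^sup>+t. f (p + of_real s * a + of_real t * b) *
       indicator (cone_set p a b S U) (p + of_real s * a + of_real t * b) \<partial>lborel \<partial>lborel)"
    using assms(2) by (subst nn_integral_lborel_complex_affine[OF _ nz(1)]) auto
  also have "(\<integral>\<^sup>+s. \<integral>\<^sup>+t. f (p + of_real s * a + of_real t * b) *
       indicator (cone_set p a b S U) (p + of_real s * a + of_real t * b) \<partial>lborel \<partial>lborel)
     = (\<integral>\<^sup>+s. \<integral>\<^sup>+u. ennreal s * f (p + of_real s * (a + of_real u * b)) *
        indicator S s * indicator U u \<partial>lborel \<partial>lborel)"
  proof (rule nn_integral_cong)
    fix s
    show "(\<integral>\<^sup>+t. f (p + of_real s * a + of_real t * b) *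
       indicator (cone_set p a b S U) (p + of_real s * a + of_real t * b) \<partial>lborel)
     = (\<integral>\<^sup>+u. ennreal s * f (p + of_real s * (a + of_real u * b)) *
        indicator S s * indicator U u \<partial>lborel)"
    proof (cases "s \<in> S")
      case True
      then have s: "s > 0" using assms(3) by auto
      have "(\<integral>\<^sup>+t. f (p + of_real s * a + of_real t * b) *
         indicator (cone_set p a b S U) (p + of_real s * a + of_real t * b) \<partial>lborel)
        = (\<integral>\<^sup>+t. f (p + of_real s * a + of_real t * b) * indicator U (t / s) \<partial>lborel)"
        using True by (intro nn_integral_cong) (auto simp: indicator_def cone_set_iff[OF nz])
      also have "\<dots> = ennreal s * (\<integral>\<^sup>+u. f (p + of_real s * a + of_real (s * u) * b) * indicator U u \<partial>lborel)"
        using s by (subst nn_integral_lborel_real_scale[of _ s 0]) auto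
      also have "\<dots> = (\<integral>\<^sup>+u. ennreal s * (f (p + of_real s * a + of_real (s * u) * b) * indicator U u) \<partial>lborel)"
        by (rule nn_integral_cmult[symmetric]) measurable
      finally show ?thesis using True by (simp add: algebra_simps)
    qed (auto simp: cone_set_iff[OF nz])
  qed
  finally show ?thesis .
qed

subsection \<open>Cone decomposition of a convex polygon\<close>

text \<open>Open cones are disjoint and half-closed cones cover; these equalities make both kinds
  have the same integral.\<close>

lemma AE_unit_interval: "AE u in lborel. indicator {0<..<1} u = (indicator {0..1::real} u :: ennreal)"
  "AE u in lborel. indicator {0<..<1} u = (indicator {0<..1::real} u :: ennreal)"
proof -
  have "AE u in lborel. u \<noteq> (0::real)" "AE u in lborel. u \<noteq> (1::real)"
    by (rule AE_lborel_singleton)+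
  then have "AE u in lborel. u \<noteq> (0::real) \<and> u \<noteq> 1" by eventually_elim auto
  then show "AE u in lborel. indicator {0<..<1} u = (indicator {0..1::real} u :: ennreal)"
     "AE u in lborel. indicator {0<..<1} u = (indicator {0<..1::real} u :: ennreal)"
    by (eventually_elim, auto simp: indicator_def)+
qed

text \<open>Convexity and counterclockwise order are encoded by the orientation of the triangles
  over each side. The periodic numbering lets \<open>Suc j\<close> wrap around without case
  distinctions.\<close>

locale cyclic_polygon =
  fixes v :: "nat \<Rightarrow> complex" and n :: nat
  assumes n3: "n \<ge> 3"
    and periodic: "\<And>j. v (j + n) = v j"
    and orient_nonneg: "\<And>i j. cross (v j - v i) (v (Suc j) - v i) \<ge> 0"
    and orient_pos: "\<And>i j. i mod n \<noteq> j mod n \<Longrightarrow> i mod n \<noteq> Suc j mod n \<Longrightarrow>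
      cross (v j - v i) (v (Suc j) - v i) > 0"
begin

definition P :: "complex set" where
  "P = convex hull (v ` {..<n})"

definition side :: "nat \<Rightarrow> complex" where
  "side j = v (Suc j) - v j"

definition edge :: "nat \<Rightarrow> real \<Rightarrow> complex" where
  "edge j u = v j + of_real u * side j"

text \<open>Twice the signed area of the triangle with apex \<open>x\<close> over the \<open>j\<close>-th side.\<close>

definition d :: "nat \<Rightarrow> complex \<Rightarrow> real" where
  "d j x = cross (v j - x) (side j)"

lemma d_vertex: "d j (v i) = cross (v j - v i) (v (Suc j) - v i)"
  by (simp add: d_def side_def cross_def algebra_simps)

lemma d_affine: "d j ((1 - t) *\<^sub>R x + t *\<^sub>R y) = (1 - t) * d j x + t * d j y"
  by (simp add: d_def cross_def algebra_simps)

lemma d_line: "d j (x + of_real t * (y - x)) = (1 - t) * d j x + t * d j y"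
  by (simp add: d_def cross_def algebra_simps)

lemma d_edge: "d j (edge i u) = (1 - u) * d j (v i) + u * d j (v (Suc i))"
  by (simp add: d_def edge_def side_def cross_def algebra_simps)

lemma v_mod: "v (j mod n) = v j"
proof -
  have "v (j + k * n) = v j" for j k
    by (induction k) (use periodic in \<open>simp_all add: algebra_simps, metis add.commute add.left_commute\<close>)
  from this[of "j mod n" "j div n"] show ?thesis by (simp add: mult.commute)
qed

lemma P_convex: "convex P" and P_compact: "compact P" and v_in_P: "v j \<in> P"
proof -
  show "convex P" "compact P"
    by (simp_all add: P_def finite_imp_compact_convex_hull)
  have "j mod n < n" using n3 by simp
  then have "v (j mod n) \<in> P"
    unfolding P_def by (intro hull_inc) auto
  then show "v j \<in> P" by (simp add: v_mod)
qed

lemma P_borel[measurable]: "P \<in> sets borel"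
  using P_compact by (intro borel_closed compact_imp_closed)

lemma d_nonneg:
  assumes "x \<in> P"
  shows "d j x \<ge> 0"
proof -
  have "convex {x. d j x \<ge> 0}"
    unfolding convex_alt using d_affine by auto
  moreover have "v ` {..<n} \<subseteq> {x. d j x \<ge> 0}"
    using orient_nonneg by (auto simp: d_vertex)
  ultimately have "P \<subseteq> {x. d j x \<ge> 0}"
    unfolding P_def by (rule hull_minimal[rotated])
  then show ?thesis using assms by auto
qed

lemma line_in_P:
  assumes "x \<in> P" "y \<in> P" "t \<in> {0..1}"
  shows "x + of_real t * (y - x) \<in> P"
proof -
  have "x + of_real t * (y - x) = (1 - t) *\<^sub>R x + t *\<^sub>R y"
    by (simp add: scaleR_conv_of_real algebra_simps)
  then show ?thesis using P_convex assms unfolding convex_alt by auto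
qed

lemma edge_in_P: "u \<in> {0..1} \<Longrightarrow> edge j u \<in> P"
  unfolding edge_def side_def by (intro line_in_P v_in_P)

lemma d_edge_same: "d j (edge j u) = 0"
  by (simp add: d_def edge_def cross_def algebra_simps)

text \<open>An edge other than the j-th has an endpoint off the line of the j-th edge: its start, or
  its end if it directly follows the j-th.\<close>

lemma d_edge_pos:
  assumes "i < n" "j < n" "i \<noteq> j" "u \<in> {0<..<1}"
  shows "d j (edge i u) > 0"
proof -
  have ge: "d j (v i) \<ge> 0" "d j (v (Suc i)) \<ge> 0"
    using orient_nonneg by (auto simp: d_vertex)
  have "d j (v i) > 0 \<or> d j (v (Suc i)) > 0"
  proof (cases "i = Suc j mod n")
    case True
    have "Suc i mod n = Suc (Suc j) mod n"
      using True by (simp add: mod_Suc_eq)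
    moreover have "Suc (Suc j) mod n \<noteq> j mod n" "Suc (Suc j) mod n \<noteq> Suc j mod n"
      using n3 assms(2) by (auto simp: mod_Suc)
    ultimately show ?thesis using orient_pos[of "Suc i" j] by (simp add: d_vertex)
  next
    case False
    then show ?thesis using orient_pos[of i j] assms by (simp add: d_vertex)
  qed
  then show ?thesis
    using assms(4) ge unfolding d_edge
    by (auto intro: add_pos_nonneg add_nonneg_pos)
qed

text \<open>\<open>j + n - 1\<close> numbers the side before the j-th and avoids truncated
  subtraction at j = 0.\<close>

lemma d_prev_pos: "d (j + n - 1) (v (Suc j)) > 0" and d_next_pos: "d (Suc j) (v j) > 0"
proof -
  have 1: "Suc (j + n - 1) = j + n" using n3 by simp
  have m: "j mod n < n" using n3 by simp
  have "Suc j mod n \<noteq> (j + n - 1) mod n"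
  proof
    assume "Suc j mod n = (j + n - 1) mod n"
    then have "Suc (Suc j) mod n = j mod n"
      using 1 by (metis mod_Suc_eq mod_add_self2)
    then show False using n3 m by (auto simp: mod_Suc split: if_splits)
  qed
  moreover have "Suc j mod n \<noteq> Suc (j + n - 1) mod n"
    unfolding 1 using n3 m by (auto simp: mod_Suc split: if_splits)
  ultimately show "d (j + n - 1) (v (Suc j)) > 0"
    unfolding d_vertex by (rule orient_pos)
  have "j mod n \<noteq> Suc j mod n" "j mod n \<noteq> Suc (Suc j) mod n"
    using n3 m by (auto simp: mod_Suc split: if_splits)
  then show "d (Suc j) (v j) > 0"
    unfolding d_vertex by (rule orient_pos)
qed

lemma side_nonzero: "side j \<noteq> 0"
  using d_next_pos[of j] unfolding d_vertex side_def by (auto simp: cross_def)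

lemma sum_shift: 
  fixes f :: "complex \<Rightarrow> 'b::ab_group_add"
  shows "(\<Sum>j<n. f (v (Suc j))) = (\<Sum>j<n. f (v j))"
proof -
  have "(\<Sum>j<n. f (v (Suc j))) + f (v 0) = (\<Sum>j<n. f (v j)) + f (v n)"
    using sum.lessThan_Suc_shift[of "\<lambda>j. f (v j)" n] sum.lessThan_Suc[of "\<lambda>j. f (v j)" n]
    by (simp add: add.commute)
  then show ?thesis using periodic[of 0] by simp
qed

lemma sum_side: "(\<Sum>j<n. side j) = 0"
  using sum_shift[of "\<lambda>x. x"] by (simp add: side_def sum_subtractf)

text \<open>Moving the point changes the sum by a cross product with the sum of all sides, which is
  0. The common value is twice the area.\<close>

lemma sum_d_const: "(\<Sum>j<n. d j x) = (\<Sum>j<n. d j y)"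
proof -
  have "(\<Sum>j<n. d j x) - (\<Sum>j<n. d j y) = (\<Sum>j<n. cross (y - x) (side j))"
    by (simp add: d_def cross_def algebra_simps flip: sum_subtractf)
  also have "\<dots> = cross (y - x) (\<Sum>j<n. side j)"
    by (simp add: cross_def sum_subtractf sum_distrib_left)
  finally show ?thesis by (simp add: sum_side cross_def)
qed

text \<open>Projection onto the side yields \<open>u\<close>; the half-planes of the next and of the
  previous side bound it by 1 and by 0.\<close>

lemma on_edge:
  assumes "\<And>i. d i q \<ge> 0" "d j q = 0"
  shows "\<exists>u\<in>{0..1}. q = edge j u"
proof -
  have s: "(norm (side j))\<^sup>2 \<noteq> 0" using side_nonzero by simp
  define u where "u = (Re (q - v j) * Re (side j) + Im (q - v j) * Im (side j)) / (norm (side j))\<^sup>2"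
  have uS: "u * (norm (side j))\<^sup>2 = Re (q - v j) * Re (side j) + Im (q - v j) * Im (side j)"
    using s by (simp add: u_def)
  have q: "q = edge j u"
  proof -
    have c: "Re (q - v j) * Im (side j) = Im (q - v j) * Re (side j)"
      using assms(2) by (simp add: d_def cross_def algebra_simps)
    have "Re (q - v j) * (norm (side j))\<^sup>2
        = (Re (q - v j) * Re (side j)) * Re (side j) + (Re (q - v j) * Im (side j)) * Im (side j)"
      unfolding cmod_power2 by (simp add: power2_eq_square algebra_simps)
    also have "\<dots> = u * (norm (side j))\<^sup>2 * Re (side j)"
      unfolding c uS by (simp only: algebra_simps)
    finally have 1: "Re (q - v j) = u * Re (side j)" using s by (simp add: mult_ac)
    have "Im (q - v j) * (norm (side j))\<^sup>2
        = (Im (q - v j) * Re (side j)) * Re (side j) + (Im (q - v j) * Im (side j)) * Im (side j)"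
      unfolding cmod_power2 by (simp add: power2_eq_square algebra_simps)
    also have "\<dots> = u * (norm (side j))\<^sup>2 * Im (side j)"
      unfolding c[symmetric] uS by (simp only: algebra_simps)
    finally have 2: "Im (q - v j) = u * Im (side j)" using s by (simp add: mult_ac)
    show ?thesis using 1 2 by (simp add: edge_def complex_eq_iff algebra_simps)
  qed
  have "d (Suc j) (v (Suc j)) = 0" by (simp add: d_def cross_def)
  then have "0 \<le> (1 - u) * d (Suc j) (v j)"
    using assms(1)[of "Suc j"] by (simp add: q d_edge)
  then have u1: "u \<le> 1" using d_next_pos[of j] by (simp add: zero_le_mult_iff)
  have "Suc (j + n - 1) = j + n" using n3 by simp
  then have "d (j + n - 1) (v j) = 0"
    using periodic[of j] unfolding d_vertex by (simp add: cross_def)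
  then have "0 \<le> u * d (j + n - 1) (v (Suc j))"
    using assms(1)[of "j + n - 1"] by (simp add: q d_edge)
  then have "u \<ge> 0" using d_prev_pos[of j] by (simp add: zero_le_mult_iff)
  then show ?thesis using u1 q by auto
qed

definition cone :: "complex \<Rightarrow> nat \<Rightarrow> real set \<Rightarrow> real set \<Rightarrow> complex set" where
  "cone p j S U = cone_set p (v j - p) (side j) S U"

lemma cone_def': "cone p j S U = {p + of_real s * (edge j u - p) |s u. s \<in> S \<and> u \<in> U}"
  by (simp add: cone_def cone_set_def edge_def algebra_simps)

lemma d_mod: "d (j mod n) x = d j x"
  using v_mod[of j] v_mod[of "Suc j"] v_mod[of "Suc (j mod n)"] 
  by (simp add: d_def side_def mod_Suc_eq)

text \<open>The ray from \<open>p\<close> through \<open>x\<close> leaves the polygon through the edge minimising the exit time.\<close>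

lemma cone_cover:
  assumes p: "p \<in> P" and x: "x \<in> P" and "x \<noteq> p"
  shows "\<exists>j<n. d j p > 0 \<and> x \<in> cone p j {0<..1} {0..1}"
proof -
  define J where "J = {j. j < n \<and> d j x < d j p}"
  \<comment> \<open>If no \<open>d j\<close> decreased from \<open>p\<close> to \<open>x\<close>,
    their constant sum would force all of them to stay equal, and two non-parallel sides already
    determine the point.\<close>
  have "J \<noteq> {}"
  proof
    assume "J = {}"
    then have ge: "\<And>j. j < n \<Longrightarrow> d j x \<ge> d j p" by (force simp: J_def)
    have "(\<Sum>j<n. d j x - d j p) = 0"
      using sum_d_const[of x p] by (simp add: sum_subtractf)
    then have "\<And>j. j < n \<Longrightarrow> d j x - d j p = 0"
      using ge by (subst (asm) sum_nonneg_eq_0_iff) auto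
    then have "d 0 x = d 0 p" "d 1 x = d 1 p" using n3 by auto
    then have "cross (x - p) (side 0) = 0" "cross (x - p) (side 1) = 0"
      by (simp_all add: d_def cross_def algebra_simps)
    moreover have "cross (side 0) (side 1) \<noteq> 0"
      using d_next_pos[of 0] by (simp add: d_def side_def cross_def algebra_simps)
    moreover have "Re (x - p) * cross (side 0) (side 1) = Re (side 0) * cross (x - p) (side 1) - Re (side 1) * cross (x - p) (side 0)"
       "Im (x - p) * cross (side 0) (side 1) = Im (side 0) * cross (x - p) (side 1) - Im (side 1) * cross (x - p) (side 0)"
      by (simp_all add: cross_def algebra_simps)
    ultimately have "x - p = 0" by (simp add: complex_eq_iff)
    then show False using assms by simp
  qed
  moreover have "finite J" by (simp add: J_def)
  \<comment> \<open>\<open>t j\<close> is the time at which the ray, at \<open>p\<close> at time 0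
    and at \<open>x\<close> at time 1, meets the line of side j.\<close>
  moreover define t where "t j = d j p / (d j p - d j x)" for j
  ultimately obtain j where j: "j \<in> J" and jmin: "\<And>i. i \<in> J \<Longrightarrow> t j \<le> t i"
    using ex_min_if_finite[of "t ` J"] by (force simp: not_less)
  have jn: "j < n" and dj: "d j x < d j p" using j by (auto simp: J_def)
  have t1: "t j \<ge> 1" using dj d_nonneg[OF x, of j] by (simp add: t_def)
  define q where "q = p + of_real (t j) * (x - p)"
  have dq: "d i q = (1 - t j) * d i p + t j * d i x" for i
    by (simp add: q_def d_line)
  have "d i q \<ge> 0" if "i < n" for i
  proof (cases "i \<in> J")
    case True
    then have lt: "d i p - d i x > 0" by (simp add: J_def)
    have "t j * (d i p - d i x) \<le> t i * (d i p - d i x)"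
      using jmin[OF True] lt by (intro mult_right_mono) auto
    also have "\<dots> = d i p" using lt by (simp add: t_def)
    finally show ?thesis by (simp add: dq algebra_simps)
  next
    case False
    then have "0 \<le> (t j) * (d i x - d i p)" using that t1 by (auto simp: J_def)
    then show ?thesis using d_nonneg[OF p, of i] by (simp add: dq algebra_simps)
  qed
  from this[of "_ mod n"] have "d i q \<ge> 0" for i using n3 by (simp add: d_mod)
  moreover have "d j q = 0" using dj by (simp add: dq t_def field_simps)
  ultimately obtain u where u: "u \<in> {0..1}" "q = edge j u" using on_edge by blast
  have "x = p + of_real (1 / t j) * (edge j u - p)"
    using t1 by (simp add: u(2)[symmetric] q_def)
  moreover have "1 / t j \<in> {0<..1}" using t1 by simp
  ultimately have "x \<in> cone p j {0<..1} {0..1}" using u(1) unfolding cone_def' by blast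
  moreover have "d j p > 0" using dj d_nonneg[OF x, of j] by linarith
  ultimately show ?thesis using jn by blast
qed

lemma cone_subset: "p \<in> P \<Longrightarrow> S \<subseteq> {0..1} \<Longrightarrow> U \<subseteq> {0..1} \<Longrightarrow> cone p j S U \<subseteq> P"
  unfolding cone_def' by (auto intro!: line_in_P edge_in_P)

text \<open>The point of side j would lie on the segment from \<open>p\<close> to an interior point
  of side i, and not at \<open>p\<close>; there \<open>d j\<close> is a combination of a nonnegative
  and a positive value, hence not 0.\<close>

lemma cone_disjoint_aux:
  assumes p: "p \<in> P" and ij: "i < n" "j < n" "i \<noteq> j"
    and "s > 0" "s \<le> s'" "u \<in> {0<..<1}"
    and eq: "p + of_real s * (edge i u - p) = p + of_real s' * (edge j w - p)"
  shows False
proof -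
  have k: "s / s' > 0" "s / s' \<le> 1" using assms by auto
  have "edge j w - p = of_real (1 / s') * (of_real s' * (edge j w - p))"
    using assms by simp
  also have "\<dots> = of_real (1 / s') * (of_real s * (edge i u - p))"
    using eq by simp
  finally have "edge j w = p + of_real (s / s') * (edge i u - p)"
    by (simp add: algebra_simps)
  then have "0 = (1 - s / s') * d j p + s / s' * d j (edge i u)"
    using d_line d_edge_same by metis
  moreover have "(1 - s / s') * d j p \<ge> 0" using k d_nonneg[OF p] by simp
  moreover have "s / s' * d j (edge i u) > 0" using k d_edge_pos[OF ij assms(7)] by (intro mult_pos_pos)
  ultimately show False by linarith
qed

lemma cone_disjoint:
  assumes "p \<in> P" "i < n" "j < n" "i \<noteq> j"
  shows "cone p i {0<..<1} {0<..<1} \<inter> cone p j {0<..<1} {0<..<1} = {}"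
proof -
  {
    fix s u s' w assume *: "s \<in> {0<..<1}" "u \<in> {0<..<1}" "s' \<in> {0<..<1}" "w \<in> {0<..<1}"
      "p + of_real s * (edge i u - p) = p + of_real s' * (edge j w - p)"
    have False
    proof (cases "s \<le> s'")
      case True
      then show False using cone_disjoint_aux[of p i j s s' u w] * assms by auto
    next
      case False
      then show False using cone_disjoint_aux[of p j i s' s w u] * assms by auto
    qed
  }
  then show ?thesis unfolding cone_def' by blast
qed

lemma cross_d: "cross (v j - p) (side j) = d j p"
  by (simp add: d_def)

lemma cone_measurable:
  assumes "d j p > 0" "S \<subseteq> {0<..}" and "S \<in> sets borel" "U \<in> sets borel"
  shows "cone p j S U \<in> sets borel"
  unfolding cone_def using assms by (intro cone_set_measurable) (auto simp: cross_d)

text \<open>A sandwich: the open cones are disjoint subsets of \<open>P\<close>, the half-closed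
  ones cover \<open>P\<close> up to the point \<open>p\<close>, and both families have the same
  integrals. Sides whose line contains \<open>p\<close> have degenerate cones; they are left out of
  \<open>?J\<close> and carry weight 0.\<close>

theorem cone_decomposition:
  assumes [measurable]: "f \<in> borel_measurable borel" and p: "p \<in> P"
  shows "(\<integral>\<^sup>+z. f z * indicator P z \<partial>lborel)
    = (\<Sum>j<n. ennreal (d j p) * (\<integral>\<^sup>+s. \<integral>\<^sup>+u. ennreal s * f (p + of_real s * (edge j u - p)) *
        indicator {0<..<1} s * indicator {0<..<1} u \<partial>lborel \<partial>lborel))"
proof -
  let ?J = "{j. j < n \<and> d j p > 0}"
  let ?I = "\<lambda>j. ennreal (d j p) * (\<integral>\<^sup>+s. \<integral>\<^sup>+u. ennreal s * f (p + of_real s * (edge j u - p)) *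
        indicator {0<..<1} s * indicator {0<..<1} u \<partial>lborel \<partial>lborel)"
  have eo: "(\<integral>\<^sup>+z. f z * indicator (cone p j {0<..<1} {0<..<1}) z \<partial>lborel) = ?I j" if "d j p > 0" for j
    unfolding cone_def using that
    by (subst nn_integral_cone_set) (auto simp: cross_d edge_def algebra_simps)
  have ec: "(\<integral>\<^sup>+z. f z * indicator (cone p j {0<..1} {0..1}) z \<partial>lborel) = ?I j" if "d j p > 0" for j
  proof -
    have e: "v j - p + complex_of_real u * side j = edge j u - p" for u by (simp add: edge_def)
    have "(\<integral>\<^sup>+z. f z * indicator (cone p j {0<..1} {0..1}) z \<partial>lborel)
      = ennreal (d j p) * (\<integral>\<^sup>+s. \<integral>\<^sup>+u. ennreal s * f (p + of_real s * (edge j u - p)) *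
        indicator {0<..1} s * indicator {0..1} u \<partial>lborel \<partial>lborel)"
      unfolding cone_def using that
      by (subst nn_integral_cone_set) (auto simp: cross_d e)
    also have "(\<integral>\<^sup>+s. \<integral>\<^sup>+u. ennreal s * f (p + of_real s * (edge j u - p)) *
        indicator {0<..1} s * indicator {0..1} u \<partial>lborel \<partial>lborel)
      = (\<integral>\<^sup>+s. \<integral>\<^sup>+u. ennreal s * f (p + of_real s * (edge j u - p)) *
        indicator {0<..<1} s * indicator {0<..<1} u \<partial>lborel \<partial>lborel)"
    proof (rule nn_integral_cong_AE)
      show "AE s in lborel. (\<integral>\<^sup>+u. ennreal s * f (p + of_real s * (edge j u - p)) *
        indicator {0<..1} s * indicator {0..1} u \<partial>lborel)
        = (\<integral>\<^sup>+u. ennreal s * f (p + of_real s * (edge j u - p)) *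
        indicator {0<..<1} s * indicator {0<..<1} u \<partial>lborel)"
        using AE_unit_interval(2)
      proof eventually_elim
        case (elim s)
        show ?case unfolding elim
          by (intro nn_integral_cong_AE) (use AE_unit_interval(1) in \<open>eventually_elim, simp\<close>)
      qed
    qed
    finally show ?thesis .
  qed
  have sum_J: "(\<Sum>j<n. ?I j) = (\<Sum>j\<in>?J. ?I j)"
  proof (rule sum.mono_neutral_right)
    show "\<forall>i\<in>{..<n} - ?J. ?I i = 0"
      by (auto simp: not_less intro: ennreal_neg)
  qed auto
  have measO: "cone p j {0<..<1} {0<..<1} \<in> sets borel" and measC: "cone p j {0<..1} {0..1} \<in> sets borel"
    if "j \<in> ?J" for j using that by (auto intro!: cone_measurable)
  have "(\<Sum>j\<in>?J. ?I j) = (\<Sum>j\<in>?J. \<integral>\<^sup>+z. f z * indicator (cone p j {0<..<1} {0<..<1}) z \<partial>lborel)"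
    by (intro sum.cong) (auto simp: eo)
  also have "\<dots> = (\<integral>\<^sup>+z. (\<Sum>j\<in>?J. f z * indicator (cone p j {0<..<1} {0<..<1}) z) \<partial>lborel)"
    using measO by (subst nn_integral_sum) auto
  also have "\<dots> \<le> (\<integral>\<^sup>+z. f z * indicator P z \<partial>lborel)"
  proof (rule nn_integral_mono)
    fix z
    show "(\<Sum>j\<in>?J. f z * indicator (cone p j {0<..<1} {0<..<1}) z) \<le> f z * indicator P z"
    proof (cases "\<exists>j\<in>?J. z \<in> cone p j {0<..<1} {0<..<1}")
      case True
      then obtain j where j: "j \<in> ?J" "z \<in> cone p j {0<..<1} {0<..<1}" by blast
      have "(\<Sum>i\<in>?J. f z * indicator (cone p i {0<..<1} {0<..<1}) z)
        = (\<Sum>i\<in>?J. if i = j then f z else 0)"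
        using j cone_disjoint[OF p] by (intro sum.cong) (auto simp: indicator_def)
      also have "\<dots> = f z" using j by simp
      finally show ?thesis using j cone_subset[OF p, of "{0<..<1}" "{0<..<1}" j]
        by (auto simp: indicator_def subset_iff)
    next
      case False
      then have "(\<Sum>j\<in>?J. f z * indicator (cone p j {0<..<1} {0<..<1}) z) = 0"
        by (intro sum.neutral) (auto simp: indicator_def)
      then show ?thesis by (rule order_trans[OF eq_refl]) simp
    qed
  qed
  finally have 1: "(\<Sum>j<n. ?I j) \<le> (\<integral>\<^sup>+z. f z * indicator P z \<partial>lborel)" by (simp only: sum_J)
  have "(\<integral>\<^sup>+z. f z * indicator P z \<partial>lborel)
     \<le> (\<integral>\<^sup>+z. (\<Sum>j\<in>?J. f z * indicator (cone p j {0<..1} {0..1}) z) \<partial>lborel)"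
  proof (rule nn_integral_mono_AE)
    show "AE z in lborel. f z * indicator P z \<le> (\<Sum>j\<in>?J. f z * indicator (cone p j {0<..1} {0..1}) z)"
      using AE_lborel_singleton[of p]
    proof eventually_elim
      case (elim z)
      show ?case
      proof (cases "z \<in> P")
        case True
        then obtain j where j: "j < n" "d j p > 0" "z \<in> cone p j {0<..1} {0..1}"
          using cone_cover[OF p True elim] by blast
        have "f z * indicator P z = f z * indicator (cone p j {0<..1} {0..1}) z"
          using True j by simp
        also have "\<dots> \<le> (\<Sum>j\<in>?J. f z * indicator (cone p j {0<..1} {0..1}) z)"
          using j by (intro member_le_sum) auto
        finally show ?thesis .
      qed simp
    qed
  qed
  also have "\<dots> = (\<Sum>j\<in>?J. \<integral>\<^sup>+z. f z * indicator (cone p j {0<..1} {0..1}) z \<partial>lborel)"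
    using measC by (subst nn_integral_sum) auto
  also have "\<dots> = (\<Sum>j\<in>?J. ?I j)"
    by (intro sum.cong) (auto simp: ec)
  finally show ?thesis using 1 sum_J by (intro antisym) auto
qed

end

subsection \<open>Powers of the norm along lines\<close>

text \<open>At z = 0 both sides are 0 because q \<ge> 1, even for q = 1, where the exponent on the
  left is negative.\<close>

lemma norm_sq_powi:
  assumes "q \<ge> (1::nat)"
  shows "(norm (z::complex))\<^sup>2 * norm z powi (int q - 2) = norm z ^ q"
proof (cases "z = 0")
  case False
  then have "(norm z)\<^sup>2 * norm z powi (int q - 2) = norm z powi 2 * norm z powi (int q - 2)"
    by (simp add: power_int_def)
  also have "\<dots> = norm z powi int q"
    using False by (subst power_int_add[symmetric]) auto
  finally show ?thesis by simp
qed (use assms in auto)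

lemma has_real_derivative_norm_line:
  fixes p a :: complex
  assumes "p + of_real t * a \<noteq> 0"
  shows "((\<lambda>t. norm (p + of_real t * a)) has_real_derivative
    ((p + of_real t * a) \<bullet> a) / norm (p + of_real t * a)) (at t)"
proof -
  have "((\<lambda>t. p + of_real t * a) has_derivative (\<lambda>h. of_real h * a)) (at t)"
    by (auto intro!: derivative_eq_intros)
  then have D: "((\<lambda>t. norm (p + of_real t * a)) has_derivative (\<lambda>h. (of_real h * a) \<bullet> sgn (p + of_real t * a))) (at t)"
    using has_derivative_norm[OF assms] by (rule has_derivative_compose)
  have "(of_real h * a) \<bullet> sgn (p + of_real t * a)
    = ((p + of_real t * a) \<bullet> a) / norm (p + of_real t * a) * h" for h
    by (simp add: sgn_div_norm inner_complex_def divide_simps algebra_simps)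
  then show ?thesis
    unfolding has_field_derivative_def by (intro has_derivative_eq_rhs[OF D] ext)
qed

text \<open>A linear factor compensates the failure of differentiability of \<open>norm z\<close> at the origin.\<close>

lemma has_real_derivative_linear_norm_power:
  fixes p a :: complex
  assumes "bounded_linear L" "q \<ge> (1::nat)"
  shows "((\<lambda>t. L (p + of_real t * a) * norm (p + of_real t * a) ^ q) has_real_derivative
    L a * norm (p + of_real t * a) ^ q
      + real q * (L (p + of_real t * a) * ((p + of_real t * a) \<bullet> a) * norm (p + of_real t * a) powi (int q - 2))) (at t)"
proof -
  interpret L: bounded_linear L by fact
  have Lz: "L (p + of_real t * a) = L p + t * L a" for t
    using L.scaleR[of t a] by (simp add: L.add scaleR_conv_of_real)
  show ?thesis
  proof (cases "p + of_real t * a = 0")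
    case True
    \<comment> \<open>At the origin, the difference quotient is exactly this function of h \<noteq>
      0: a linear functional along a line through 0 cancels the division by h.\<close>
    have "((\<lambda>h. \<bar>h\<bar> ^ q * (L a * norm a ^ q)) \<longlongrightarrow> \<bar>0\<bar> ^ q * (L a * norm a ^ q)) (at 0)"
      by (intro tendsto_intros)
    then have lim: "((\<lambda>h. \<bar>h\<bar> ^ q * (L a * norm a ^ q)) \<longlongrightarrow> 0) (at 0)"
      using assms(2) by (simp add: power_0_left)
    have "((\<lambda>h. (L (p + of_real (t + h) * a) * norm (p + of_real (t + h) * a) ^ q
        - L (p + of_real t * a) * norm (p + of_real t * a) ^ q) / h) \<longlongrightarrow> 0) (at 0)"
    proof (rule Lim_transform_eventually[OF lim])
      have "p + of_real (t + h) * a = of_real h * a" for h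
        using True by (simp add: algebra_simps add_eq_0_iff)
      moreover have "L (of_real h * a) = h * L a" for h
        using L.scaleR[of h a] by (simp add: scaleR_conv_of_real)
      ultimately show "\<forall>\<^sub>F h in at 0. \<bar>h\<bar> ^ q * (L a * norm a ^ q)
          = (L (p + of_real (t + h) * a) * norm (p + of_real (t + h) * a) ^ q
        - L (p + of_real t * a) * norm (p + of_real t * a) ^ q) / h"
        using True assms(2) by (auto simp: eventually_at_filter norm_mult power_mult_distrib L.zero)
    qed
    then show ?thesis using True assms(2) by (simp add: DERIV_def L.zero power_0_left)
  next
    case False
    have D: "((\<lambda>t. (L p + t * L a) * norm (p + of_real t * a) ^ q) has_real_derivative
      L a * norm (p + of_real t * a) ^ q + (L p + t * L a) *
       (real q * (norm (p + of_real t * a) ^ (q - 1) * (((p + of_real t * a) \<bullet> a) / norm (p + of_real t * a))))) (at t)"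
      by (rule derivative_eq_intros has_real_derivative_norm_line[OF False] refl | simp)+
    have N: "norm (p + of_real t * a) ^ (q - 1) / norm (p + of_real t * a)
       = norm (p + of_real t * a) powi (int q - 2)" 
    proof -
      have "norm (p + of_real t * a) powi (int q - 2) = norm (p + of_real t * a) powi (int (q - 1) - 1)"
        using assms(2) by (simp add: of_nat_diff)
      also have "\<dots> = norm (p + of_real t * a) powi int (q - 1) / norm (p + of_real t * a) powi 1"
        using False by (intro power_int_diff) auto
      finally show ?thesis by (simp only: power_int_of_nat power_int_1_right)
    qed
    show ?thesis unfolding Lz
      by (rule DERIV_cong[OF D]) (simp only: N[symmetric], simp add: mult_ac)
  qed
qed

text \<open>The extra square of the norm is written as the sum of the squares of \<open>Re\<close>
  and \<open>Im\<close>, so that the rule with a linear factor applies to each coordinate and covers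
  the origin too.\<close>

lemma has_real_derivative_norm_power:
  fixes p a :: complex
  assumes "q \<ge> (1::nat)"
  shows "((\<lambda>t. norm (p + of_real t * a) ^ (q + 2)) has_real_derivative
    real (q + 2) * (((p + of_real t * a) \<bullet> a) * norm (p + of_real t * a) ^ q)) (at t)"
proof -
  let ?z = "\<lambda>t. p + of_real t * a"
  have 1: "((\<lambda>t. Re (?z t)) has_real_derivative Re a) (at t)" "((\<lambda>t. Im (?z t)) has_real_derivative Im a) (at t)"
    by (auto intro!: derivative_eq_intros)
  note D = has_real_derivative_linear_norm_power[OF bounded_linear_Re assms, of p a t]
    has_real_derivative_linear_norm_power[OF bounded_linear_Im assms, of p a t]
  have "((\<lambda>t. Re (?z t) * (Re (?z t) * norm (?z t) ^ q) + Im (?z t) * (Im (?z t) * norm (?z t) ^ q)) has_real_derivative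
     (Re a * (Re (?z t) * norm (?z t) ^ q) + (Re a * norm (?z t) ^ q + real q * (Re (?z t) * (?z t \<bullet> a) * norm (?z t) powi (int q - 2))) * Re (?z t))
    + (Im a * (Im (?z t) * norm (?z t) ^ q) + (Im a * norm (?z t) ^ q + real q * (Im (?z t) * (?z t \<bullet> a) * norm (?z t) powi (int q - 2))) * Im (?z t))) (at t)"
    by (intro DERIV_add DERIV_mult 1 D)
  also have "(\<lambda>t. Re (?z t) * (Re (?z t) * norm (?z t) ^ q) + Im (?z t) * (Im (?z t) * norm (?z t) ^ q))
    = (\<lambda>t. norm (?z t) ^ (q + 2))"
  proof
    fix t
    have "Re (?z t) * (Re (?z t) * norm (?z t) ^ q) + Im (?z t) * (Im (?z t) * norm (?z t) ^ q)
       = ((Re (?z t))\<^sup>2 + (Im (?z t))\<^sup>2) * norm (?z t) ^ q" by algebra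
    also have "\<dots> = norm (?z t) ^ (q + 2)" by (simp only: cmod_power2[symmetric] power_add mult.commute)
    finally show "Re (?z t) * (Re (?z t) * norm (?z t) ^ q) + Im (?z t) * (Im (?z t) * norm (?z t) ^ q)
       = norm (?z t) ^ (q + 2)" .
  qed
  also have "(Re a * (Re (?z t) * norm (?z t) ^ q) + (Re a * norm (?z t) ^ q + real q * (Re (?z t) * (?z t \<bullet> a) * norm (?z t) powi (int q - 2))) * Re (?z t))
    + (Im a * (Im (?z t) * norm (?z t) ^ q) + (Im a * norm (?z t) ^ q + real q * (Im (?z t) * (?z t \<bullet> a) * norm (?z t) powi (int q - 2))) * Im (?z t))
    = 2 * ((Re (?z t) * Re a + Im (?z t) * Im a) * norm (?z t) ^ q)
      + real q * (?z t \<bullet> a) * (((Re (?z t))\<^sup>2 + (Im (?z t))\<^sup>2) * norm (?z t) powi (int q - 2))"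
    by algebra
  also have "((Re (?z t))\<^sup>2 + (Im (?z t))\<^sup>2) * norm (?z t) powi (int q - 2) = norm (?z t) ^ q"
    using norm_sq_powi[OF assms, of "?z t"] by (simp only: cmod_power2)
  also have "2 * ((Re (?z t) * Re a + Im (?z t) * Im a) * norm (?z t) ^ q) + real q * (?z t \<bullet> a) * norm (?z t) ^ q
     = real (q + 2) * ((?z t \<bullet> a) * norm (?z t) ^ q)"
    by (simp add: inner_complex_def algebra_simps)
  finally show ?thesis .
qed

text \<open>For \<open>q = 1\<close> continuity at the origin uses the junk value \<open>0 powi (-1) = 0\<close>.\<close>

lemma continuous_on_linear_kernel:
  fixes L1 L2 :: "complex \<Rightarrow> real"
  assumes "bounded_linear L1" "bounded_linear L2" "q \<ge> (1::nat)"
  shows "continuous_on UNIV (\<lambda>z. L1 z * L2 z * norm z powi (int q - 2))"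
proof -
  interpret L1: bounded_linear L1 by fact
  interpret L2: bounded_linear L2 by fact
  have "isCont (\<lambda>z. L1 z * L2 z * norm z powi (int q - 2)) z" for z
  proof (cases "z = 0")
    case False
    then show ?thesis
      by (intro continuous_intros L1.isCont L2.isCont) auto
  next
    case True
    obtain K1 where K1: "\<And>x. norm (L1 x) \<le> norm x * K1" using L1.bounded by auto
    obtain K2 where K2: "\<And>x. norm (L2 x) \<le> norm x * K2" using L2.bounded by auto
    have "((\<lambda>x::complex. K1 * K2 * norm x ^ q) \<longlongrightarrow> K1 * K2 * norm (0::complex) ^ q) (at 0)"
      by (intro tendsto_intros)
    then have lim: "((\<lambda>x::complex. K1 * K2 * norm x ^ q) \<longlongrightarrow> 0) (at 0)" using assms(3) by (simp add: power_0_left)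
    have "((\<lambda>z. L1 z * L2 z * norm z powi (int q - 2)) \<longlongrightarrow> 0) (at 0)"
    proof (rule Lim_null_comparison[OF _ lim], intro always_eventually allI)
      fix x :: complex
      have "norm (L1 x * L2 x * norm x powi (int q - 2)) = norm (L1 x) * norm (L2 x) * norm x powi (int q - 2)"
        by (simp add: abs_mult)
      also have "\<dots> \<le> (norm x * K1) * (norm x * K2) * norm x powi (int q - 2)"
        by (intro mult_right_mono mult_mono K1 K2) (auto intro: order_trans[OF norm_ge_zero K1])
      also have "\<dots> = K1 * K2 * ((norm x)\<^sup>2 * norm x powi (int q - 2))"
        by (simp add: power2_eq_square)
      also have "\<dots> = K1 * K2 * norm x ^ q" by (simp only: norm_sq_powi[OF assms(3)])
      finally show "norm (L1 x * L2 x * norm x powi (int q - 2)) \<le> K1 * K2 * norm x ^ q" .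
    qed
    then show ?thesis by (simp add: True isCont_def L1.zero)
  qed
  then show ?thesis by (simp add: continuous_at_imp_continuous_on)
qed

lemma bounded_linear_cross: "bounded_linear (\<lambda>z. cross z c)"
  unfolding cross_def
  by (intro bounded_linear_intros bounded_linear_sub bounded_linear_compose[OF bounded_linear_mult_left]
    bounded_linear_Re bounded_linear_Im)

section \<open>Iterated integrals over the parameter square\<close>

definition dbl :: "(real \<Rightarrow> real \<Rightarrow> real) \<Rightarrow> real" where
  "dbl g = integral {0..1} (\<lambda>u. integral {0..1} (\<lambda>w. g u w))"

definition cont2 :: "(real \<Rightarrow> real \<Rightarrow> real) \<Rightarrow> bool" where
  "cont2 g = continuous_on UNIV (\<lambda>x. g (fst x) (snd x))"

lemma cont2_sub:
  assumes "cont2 g" shows "continuous_on A (\<lambda>(x, y). g x y)"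
  using assms unfolding cont2_def by (auto simp: case_prod_beta intro: continuous_on_subset)

lemma cont2_snd: 
  assumes "cont2 g" shows "continuous_on A (g u)"
proof -
  have "continuous_on A (\<lambda>w. (u, w))" by (intro continuous_intros)
  from continuous_on_compose2[OF assms[unfolded cont2_def] this] show ?thesis by simp
qed

lemma cont2_fst: 
  assumes "cont2 g" shows "continuous_on A (\<lambda>u. g u w)"
proof -
  have "continuous_on A (\<lambda>u. (u, w))" by (intro continuous_intros)
  from continuous_on_compose2[OF assms[unfolded cont2_def] this] show ?thesis by simp
qed

lemma cont2_inner:
  assumes "cont2 g" shows "continuous_on A (\<lambda>u. integral {0..1} (g u))"
  using integral_continuous_on_param[of A 0 "1::real" g] cont2_sub[OF assms] by simp

lemma dbl_flip:
  assumes "cont2 g" shows "dbl g = dbl (\<lambda>u w. g w u)"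
  using integral_swap_continuous[of 0 0 "1::real" "1::real" g] cont2_sub[OF assms] by (simp add: dbl_def)

lemma dbl_add:
  assumes "cont2 f" "cont2 g" shows "dbl (\<lambda>u w. f u w + g u w) = dbl f + dbl g"
proof -
  have "dbl (\<lambda>u w. f u w + g u w) = integral {0..1} (\<lambda>u. integral {0..1} (f u) + integral {0..1} (g u))"
    unfolding dbl_def
    by (intro integral_cong integral_add integrable_continuous_real cont2_snd assms)
  also have "\<dots> = dbl f + dbl g"
    unfolding dbl_def by (intro integral_add integrable_continuous_real cont2_inner assms)
  finally show ?thesis .
qed

lemma dbl_cmult: "dbl (\<lambda>u w. c * g u w) = c * dbl g"
  unfolding dbl_def by simp

lemma cont2_mult: "cont2 f \<Longrightarrow> cont2 g \<Longrightarrow> cont2 (\<lambda>u w. f u w * g u w)"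
  unfolding cont2_def by (auto intro: continuous_intros)

lemma cont2_comp:
  assumes "continuous_on UNIV (f :: complex \<Rightarrow> real)"
  shows "cont2 (\<lambda>u w. f (p + of_real w * a + of_real u * b))"
  unfolding cont2_def
  by (rule continuous_on_compose2[OF assms]) (auto intro!: continuous_intros)

lemma FTC_real:
  assumes "\<And>x. x \<in> {0..1} \<Longrightarrow> (f has_real_derivative f' x) (at x)"
  shows "(f' has_integral (f 1 - f 0)) {0..1::real}"
  using assms by (intro fundamental_theorem_of_calculus)
    (auto simp: has_real_derivative_iff_has_vector_derivative[symmetric] intro: DERIV_subset)

text \<open>The identity cross x a * cross x b = |x|^2 (a . b) - (x . a) (x . b) splits the kernel.
  The last product is removed by integrating the w-derivative of (z . b) |z|^q, and the boundary
  terms this leaves are u-derivatives of |z|^(q+2) up to a constant, so they end in the four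
  corners.\<close>

lemma dbl_cross_kernel:
  fixes p a b :: complex
  assumes q: "q \<ge> (1::nat)"
  defines "z \<equiv> \<lambda>u w. p + of_real w * a + of_real u * (- b)"
  shows "dbl (\<lambda>u w. - (cross (z u w) a * cross (z u w) b * norm (z u w) powi (int q - 2)))
   = - (1 + 1 / real q) * (a \<bullet> b) * dbl (\<lambda>u w. norm (z u w) ^ q)
     - (norm (p + a - b) ^ (q + 2) - norm (p + a) ^ (q + 2) - norm (p - b) ^ (q + 2) + norm p ^ (q + 2))
       / (real q * real (q + 2))"
proof -
  have z1: "z u w = (p + of_real u * (- b)) + of_real w * a" 
    and z2: "z u w = (p + of_real w * a) + of_real u * (- b)" for u w
    by (simp_all add: z_def)
  have bl: "bounded_linear (\<lambda>z. z \<bullet> c)" for c :: complex by (rule bounded_linear_inner_left)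
  have cN: "cont2 (\<lambda>u w. norm (z u w) ^ q)"
    unfolding z_def by (rule cont2_comp) (intro continuous_intros)
  have cK: "cont2 (\<lambda>u w. (z u w \<bullet> a) * (z u w \<bullet> b) * norm (z u w) powi (int q - 2))"
    unfolding z_def by (rule cont2_comp, rule continuous_on_linear_kernel[OF bl bl q])
  have cB: "continuous_on UNIV (\<lambda>u. (z u w \<bullet> b) * norm (z u w) ^ q)" for w
    unfolding z_def by (intro continuous_intros)
  have id: "- (cross x a * cross x b * norm x powi (int q - 2))
    = - (a \<bullet> b) * norm x ^ q + (x \<bullet> a) * (x \<bullet> b) * norm x powi (int q - 2)" for x
  proof -
    have c: "cross x a * cross x b = (norm x)\<^sup>2 * (a \<bullet> b) - (x \<bullet> a) * (x \<bullet> b)"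
      unfolding cmod_power2 by (simp add: cross_def inner_complex_def power2_eq_square algebra_simps)
    have "- (cross x a * cross x b * norm x powi (int q - 2))
       = - (a \<bullet> b) * ((norm x)\<^sup>2 * norm x powi (int q - 2)) + (x \<bullet> a) * (x \<bullet> b) * norm x powi (int q - 2)"
      unfolding c by (simp only: algebra_simps)
    then show ?thesis by (simp only: norm_sq_powi[OF q])
  qed
  have inner: "integral {0..1} (\<lambda>w. (z u w \<bullet> a) * (z u w \<bullet> b) * norm (z u w) powi (int q - 2))
     = (1 / real q) * ((z u 1 \<bullet> b) * norm (z u 1) ^ q) - (1 / real q) * ((z u 0 \<bullet> b) * norm (z u 0) ^ q)
       - (a \<bullet> b) / real q * integral {0..1} (\<lambda>w. norm (z u w) ^ q)" for u
  proof -
    have "((\<lambda>w. (a \<bullet> b) * norm (z u w) ^ q + real q * ((z u w \<bullet> b) * (z u w \<bullet> a) * norm (z u w) powi (int q - 2)))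
       has_integral ((z u 1 \<bullet> b) * norm (z u 1) ^ q - (z u 0 \<bullet> b) * norm (z u 0) ^ q)) {0..1}"
      unfolding z1 by (rule FTC_real) (rule has_real_derivative_linear_norm_power[OF bl q])
    moreover have "((\<lambda>w. (a \<bullet> b) * norm (z u w) ^ q + real q * ((z u w \<bullet> a) * (z u w \<bullet> b) * norm (z u w) powi (int q - 2)))
       has_integral ((a \<bullet> b) * integral {0..1} (\<lambda>w. norm (z u w) ^ q)
        + real q * integral {0..1} (\<lambda>w. (z u w \<bullet> a) * (z u w \<bullet> b) * norm (z u w) powi (int q - 2)))) {0..1}"
      by (intro has_integral_add has_integral_mult_right integrable_integral
         integrable_continuous_real cont2_snd[OF cN] cont2_snd[OF cK])
    ultimately have "(z u 1 \<bullet> b) * norm (z u 1) ^ q - (z u 0 \<bullet> b) * norm (z u 0) ^ q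
      = (a \<bullet> b) * integral {0..1} (\<lambda>w. norm (z u w) ^ q)
        + real q * integral {0..1} (\<lambda>w. (z u w \<bullet> a) * (z u w \<bullet> b) * norm (z u w) powi (int q - 2))"
      by (subst (asm) mult.commute[of "z _ _ \<bullet> b" "z _ _ \<bullet> a"]) (rule has_integral_unique)
    then show ?thesis using q by (simp add: field_simps)
  qed
  have outer: "integral {0..1} (\<lambda>u. (z u w \<bullet> b) * norm (z u w) ^ q)
     = - (1 / real (q + 2)) * (norm (z 1 w) ^ (q + 2) - norm (z 0 w) ^ (q + 2))" for w
  proof -
    have "((\<lambda>u. real (q + 2) * ((z u w \<bullet> (- b)) * norm (z u w) ^ q)) has_integral
       (norm (z 1 w) ^ (q + 2) - norm (z 0 w) ^ (q + 2))) {0..1}"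
      unfolding z2 by (rule FTC_real) (rule has_real_derivative_norm_power[OF q])
    then have "((\<lambda>u. - (1 / real (q + 2)) * (real (q + 2) * ((z u w \<bullet> (- b)) * norm (z u w) ^ q))) has_integral
       - (1 / real (q + 2)) * (norm (z 1 w) ^ (q + 2) - norm (z 0 w) ^ (q + 2))) {0..1}"
      by (rule has_integral_mult_right)
    also have "(\<lambda>u. - (1 / real (q + 2)) * (real (q + 2) * ((z u w \<bullet> (- b)) * norm (z u w) ^ q)))
       = (\<lambda>u. (z u w \<bullet> b) * norm (z u w) ^ q)" by simp
    finally show ?thesis by (rule integral_unique)
  qed
  have ci: "(\<lambda>u. c * ((z u w \<bullet> b) * norm (z u w) ^ q)) integrable_on {0..1}" for w c
    by (intro integrable_continuous_real continuous_intros continuous_on_subset[OF cB]) auto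
  have cn: "(\<lambda>u. c * integral {0..1} (\<lambda>w. norm (z u w) ^ q)) integrable_on {0..1}" for c
    by (intro integrable_continuous_real continuous_intros cont2_inner[OF cN])
  have X: "dbl (\<lambda>u w. (z u w \<bullet> a) * (z u w \<bullet> b) * norm (z u w) powi (int q - 2))
     = (1 / real q) * integral {0..1} (\<lambda>u. (z u 1 \<bullet> b) * norm (z u 1) ^ q)
       - (1 / real q) * integral {0..1} (\<lambda>u. (z u 0 \<bullet> b) * norm (z u 0) ^ q)
       - (a \<bullet> b) / real q * dbl (\<lambda>u w. norm (z u w) ^ q)"
    unfolding dbl_def inner
    by (simp only: integral_diff integrable_diff ci cn integral_mult_right)
  have Y: "dbl (\<lambda>u w. - (cross (z u w) a * cross (z u w) b * norm (z u w) powi (int q - 2)))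
     = - (a \<bullet> b) * dbl (\<lambda>u w. norm (z u w) ^ q) 
      + dbl (\<lambda>u w. (z u w \<bullet> a) * (z u w \<bullet> b) * norm (z u w) powi (int q - 2))"
    unfolding id
    by (subst dbl_add[OF cont2_mult cK], unfold dbl_cmult) (auto simp: cont2_def[of "\<lambda>_ _. _"] cN)
  have zs: "z 0 0 = p" "z 0 1 = p + a" "z 1 0 = p - b" "z 1 1 = p + a - b" by (simp_all add: z_def)
  have arith: "x = 1 / Q * (- (1 / R) * (N11 - N01)) - 1 / Q * (- (1 / R) * (N10 - N00)) - e / Q * D
     \<Longrightarrow> y = - e * D + x \<Longrightarrow> Q \<noteq> 0 \<Longrightarrow> R \<noteq> 0
     \<Longrightarrow> y = - (1 + 1 / Q) * e * D - (N11 - N01 - N10 + N00) / (Q * R)" for x y e Q R D N11 N01 N10 N00 :: real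
    by hypsubst (simp add: field_simps)
  show ?thesis
    by (rule arith[OF X[unfolded outer zs] Y]) (use q in auto)
qed

subsection \<open>Riesz energy of a convex polygon\<close>

lemma nn_integral_unit_power: "(\<integral>\<^sup>+s. ennreal (s ^ k) * indicator {0<..<1} s \<partial>lborel) = ennreal (1 / (real k + 1))"
proof -
  have "((\<lambda>s. s ^ k) has_integral (1 ^ Suc k / real (Suc k) - 0 ^ Suc k / real (Suc k))) {0..1::real}"
  proof (rule FTC_real)
    fix x :: real
    have "((\<lambda>s. s ^ Suc k / real (Suc k)) has_real_derivative real (Suc k) * x ^ (Suc k - Suc 0) / real (Suc k)) (at x)"
      by (rule DERIV_cdivide[OF DERIV_pow])
    then show "((\<lambda>s. s ^ Suc k / real (Suc k)) has_real_derivative x ^ k) (at x)"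
      by (simp del: power_Suc of_nat_Suc)
  qed
  then have "(\<integral>\<^sup>+s. ennreal (s ^ k) * indicator {0..1} s \<partial>lborel) = ennreal (1 / (real k + 1))"
    by (subst nn_integral_has_integral_lebesgue') (auto simp: add.commute)
  moreover have "(\<integral>\<^sup>+s. ennreal (s ^ k) * indicator {0<..<1} s \<partial>lborel) = (\<integral>\<^sup>+s. ennreal (s ^ k) * indicator {0..1} s \<partial>lborel)"
    by (intro nn_integral_cong_AE) (use AE_unit_interval(1) in \<open>eventually_elim, simp\<close>)
  ultimately show ?thesis by simp
qed

lemma nn_integral_dbl:
  assumes c: "cont2 g" and nonneg: "\<And>u w. u \<in> {0..1} \<Longrightarrow> w \<in> {0..1} \<Longrightarrow> g u w \<ge> 0"
  shows "(\<integral>\<^sup>+u. (\<integral>\<^sup>+w. ennreal (g u w) * indicator {0<..<1} w \<partial>lborel) * indicator {0<..<1} u \<partial>lborel) = ennreal (dbl g)"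
    and "dbl g \<ge> 0"
proof -
  have inner: "(\<integral>\<^sup>+w. ennreal (g u w) * indicator {0<..<1} w \<partial>lborel) = ennreal (integral {0..1} (g u))" if "u \<in> {0..1}" for u
  proof -
    have "(\<integral>\<^sup>+w. ennreal (g u w) * indicator {0<..<1} w \<partial>lborel) = (\<integral>\<^sup>+w. ennreal (g u w) * indicator {0..1} w \<partial>lborel)"
      by (intro nn_integral_cong_AE) (use AE_unit_interval(1) in \<open>eventually_elim, simp\<close>)
    also have "\<dots> = ennreal (integral {0..1} (g u))"
      by (intro nn_integral_has_integral_lebesgue' nonneg that integrable_integral integrable_continuous_real cont2_snd[OF c])
    finally show ?thesis .
  qed
  have nn: "integral {0..1} (g u) \<ge> 0" if "u \<in> {0..1}" for u
    by (intro integral_nonneg integrable_continuous_real cont2_snd[OF c] nonneg that)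
  have "(\<integral>\<^sup>+u. (\<integral>\<^sup>+w. ennreal (g u w) * indicator {0<..<1} w \<partial>lborel) * indicator {0<..<1} u \<partial>lborel)
    = (\<integral>\<^sup>+u. ennreal (integral {0..1} (g u)) * indicator {0..1} u \<partial>lborel)"
  proof (intro nn_integral_cong_AE)
    show "AE u in lborel. (\<integral>\<^sup>+w. ennreal (g u w) * indicator {0<..<1} w \<partial>lborel) * indicator {0<..<1} u
      = ennreal (integral {0..1} (g u)) * indicator {0..1} u"
      using AE_unit_interval(1)
    proof eventually_elim
      case (elim u)
      then show ?case by (cases "u \<in> {0..1}") (simp_all add: inner)
    qed
  qed
  also have "\<dots> = ennreal (dbl g)"
    unfolding dbl_def
    by (intro nn_integral_has_integral_lebesgue' nn integrable_integral integrable_continuous_real cont2_inner[OF c])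
  finally show "(\<integral>\<^sup>+u. (\<integral>\<^sup>+w. ennreal (g u w) * indicator {0<..<1} w \<partial>lborel) * indicator {0<..<1} u \<partial>lborel) = ennreal (dbl g)" .
  show "dbl g \<ge> 0"
    unfolding dbl_def by (intro integral_nonneg nn integrable_continuous_real cont2_inner[OF c])
qed

lemma borel_measurable_power_int[measurable (raw)]:
  fixes f :: "'a \<Rightarrow> real"
  assumes [measurable]: "f \<in> borel_measurable M"
  shows "(\<lambda>x. f x powi k) \<in> borel_measurable M"
  by (cases "k \<ge> 0") (simp_all add: power_int_def)

context cyclic_polygon
begin

lemma borel_measurable_d[measurable (raw)]:
  assumes [measurable]: "f \<in> borel_measurable M"
  shows "(\<lambda>x. d j (f x)) \<in> borel_measurable M"
  unfolding d_def by measurable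

lemma borel_measurable_edge[measurable (raw)]:
  assumes [measurable]: "f \<in> borel_measurable M"
  shows "(\<lambda>x. edge j (f x)) \<in> borel_measurable M"
  unfolding edge_def by measurable

text \<open>The exponent \<open>k\<close> includes the Jacobian: \<open>f\<close> itself has degree
  k - 1 about \<open>p\<close>. The radial integral is then 1 / (k + 1), and only the values of
  \<open>f\<close> on the edges remain.\<close>

lemma cone_decomposition_homogeneous:
  assumes [measurable]: "f \<in> borel_measurable borel" and p: "p \<in> P"
    and hom: "\<And>s z. s > 0 \<Longrightarrow> ennreal s * f (p + of_real s * z) = ennreal (s ^ k) * f (p + z)"
  shows "(\<integral>\<^sup>+z. f z * indicator P z \<partial>lborel)
    = (\<Sum>j<n. ennreal (d j p / (real k + 1)) * (\<integral>\<^sup>+u. f (edge j u) * indicator {0<..<1} u \<partial>lborel))"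
proof -
  have "(\<integral>\<^sup>+s. \<integral>\<^sup>+u. ennreal s * f (p + of_real s * (edge j u - p)) *
        indicator {0<..<1} s * indicator {0<..<1} u \<partial>lborel \<partial>lborel)
     = ennreal (1 / (real k + 1)) * (\<integral>\<^sup>+u. f (edge j u) * indicator {0<..<1} u \<partial>lborel)" for j
  proof -
    have "(\<integral>\<^sup>+u. ennreal s * f (p + of_real s * (edge j u - p)) *
        indicator {0<..<1} s * indicator {0<..<1} u \<partial>lborel)
      = (ennreal (s ^ k) * indicator {0<..<1} s) * (\<integral>\<^sup>+u. f (edge j u) * indicator {0<..<1} u \<partial>lborel)" for s
    proof -
      have "(\<integral>\<^sup>+u. ennreal s * f (p + of_real s * (edge j u - p)) *
        indicator {0<..<1} s * indicator {0<..<1} u \<partial>lborel)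
        = (\<integral>\<^sup>+u. (ennreal (s ^ k) * indicator {0<..<1} s) * (f (edge j u) * indicator {0<..<1} u) \<partial>lborel)"
        using hom[of s] by (intro nn_integral_cong) (auto simp: indicator_def)
      also have "\<dots> = (ennreal (s ^ k) * indicator {0<..<1} s) * (\<integral>\<^sup>+u. f (edge j u) * indicator {0<..<1} u \<partial>lborel)"
        by (rule nn_integral_cmult) measurable
      finally show ?thesis .
    qed
    then show ?thesis
      by (simp add: nn_integral_multc nn_integral_unit_power)
  qed
  then show ?thesis
    using d_nonneg[OF p]
    by (subst cone_decomposition[OF assms(1) p])
      (simp add: mult.assoc[symmetric] ennreal_mult[symmetric])
qed

lemma emeasure_P: "p \<in> P \<Longrightarrow> emeasure lborel P = ennreal ((\<Sum>j<n. d j p) / 2)"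
  using cone_decomposition_homogeneous[of "\<lambda>_. 1" p 1] d_nonneg[of p]
  by (simp add: sum_ennreal sum_divide_distrib)

definition chord_integral :: "nat \<Rightarrow> nat \<Rightarrow> nat \<Rightarrow> real" where
  "chord_integral q i j = dbl (\<lambda>u w. norm (edge i w - edge j u) ^ q)"

lemma edge_diff: "edge i w - edge j u = (v i - v j) + of_real w * side i + of_real u * (- side j)"
  by (simp add: edge_def)

text \<open>\<open>d i\<close> does not change if its base point \<open>v i\<close> is replaced by
  another point of side i. So both factors are, up to sign, cross products of the single difference
  \<open>edge i w - edge j u\<close> with the two sides, which is the setting of
  \<open>dbl_cross_kernel\<close>.\<close>

lemma pair_integral:
  assumes q: "q \<ge> (1::nat)"
  defines "G \<equiv> \<lambda>i j u w. d i (edge j u) * d j (edge i w) * norm (edge i w - edge j u) powi (int q - 2)"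
  shows "cont2 (G i j)"
    and "u \<in> {0..1} \<Longrightarrow> w \<in> {0..1} \<Longrightarrow> G i j u w \<ge> 0"
    and "dbl (G i j) = - (1 + 1 / real q) * (side i \<bullet> side j) * chord_integral q i j
     - (norm (v (Suc i) - v (Suc j)) ^ (q + 2) - norm (v (Suc i) - v j) ^ (q + 2)
        - norm (v i - v (Suc j)) ^ (q + 2) + norm (v i - v j) ^ (q + 2)) / (real q * real (q + 2))"
proof -
  let ?z = "\<lambda>u w. (v i - v j) + of_real w * side i + of_real u * (- side j)"
  have G: "G i j = (\<lambda>u w. - (cross (?z u w) (side i) * cross (?z u w) (side j) * norm (?z u w) powi (int q - 2)))"
    unfolding G_def edge_diff[symmetric]
    by (intro ext) (simp add: d_def edge_def cross_def algebra_simps)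
  show "cont2 (G i j)"
    unfolding G by (rule cont2_comp, intro continuous_on_minus continuous_on_linear_kernel[OF bounded_linear_cross bounded_linear_cross q])
  show "u \<in> {0..1} \<Longrightarrow> w \<in> {0..1} \<Longrightarrow> G i j u w \<ge> 0"
    unfolding G_def by (intro mult_nonneg_nonneg d_nonneg edge_in_P zero_le_power_int) auto
  have *: "v (Suc i) - v j - side j = v (Suc i) - v (Suc j)" "v i - v j + side i = v (Suc i) - v j"
    "v i - v j - side j = v i - v (Suc j)" by (simp_all add: side_def)
  show "dbl (G i j) = - (1 + 1 / real q) * (side i \<bullet> side j) * chord_integral q i j
     - (norm (v (Suc i) - v (Suc j)) ^ (q + 2) - norm (v (Suc i) - v j) ^ (q + 2)
        - norm (v i - v (Suc j)) ^ (q + 2) + norm (v i - v j) ^ (q + 2)) / (real q * real (q + 2))"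
    using dbl_cross_kernel[OF q, of "v i - v j" "side i" "side j"]
    unfolding G chord_integral_def edge_diff * .
qed

text \<open>The first apex is x, with exponent q - 1. After exchanging the integrals over x and u,
  the apex is \<open>edge j u\<close>, with exponent q: \<open>d j\<close> vanishes there and adds
  one degree. The radial factors are 1 / q and 1 / (q + 1).\<close>

lemma riesz_energy_aux:
  assumes q: "q \<ge> (1::nat)"
  shows "(\<integral>\<^sup>+x. (\<integral>\<^sup>+y. ennreal (norm (x - y) powi (int q - 2)) * indicator P y \<partial>lborel) * indicator P x \<partial>lborel)
    = ennreal ((\<Sum>j<n. \<Sum>i<n. dbl (\<lambda>u w. d i (edge j u) * d j (edge i w) * norm (edge i w - edge j u) powi (int q - 2)))
        / (real q * real (q + 1)))"
proof -
  define N where "N z = ennreal (norm z powi (int q - 2))" for z :: complex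
  define G where "G i j u w = d i (edge j u) * d j (edge i w) * norm (edge i w - edge j u) powi (int q - 2)" for i j u w
  have [measurable]: "N \<in> borel_measurable borel"
    unfolding N_def by measurable
  have Nhom: "ennreal s * N (of_real s * z) = ennreal (s ^ (q - 1)) * N z" if "s > 0" for s z
  proof -
    have "s * (norm (of_real s * z) powi (int q - 2)) = s powi 1 * s powi (int q - 2) * norm z powi (int q - 2)"
      using that by (simp add: norm_mult power_int_mult_distrib)
    also have "s powi 1 * s powi (int q - 2) = s powi (int (q - 1))"
      using that q by (subst power_int_add[symmetric]) (auto simp: of_nat_diff)
    finally show ?thesis
      using that by (simp add: N_def ennreal_mult'[symmetric])
  qed
  have step1: "(\<integral>\<^sup>+y. N (x - y) * indicator P y \<partial>lborel)
      = (\<Sum>j<n. ennreal (d j x / real q) * (\<integral>\<^sup>+u. N (edge j u - x) * indicator {0<..<1} u \<partial>lborel))" if "x \<in> P" for x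
  proof -
    have "N (x - y) = N (y - x)" for y by (simp add: N_def norm_minus_commute)
    then show ?thesis
      using cone_decomposition_homogeneous[of "\<lambda>y. N (y - x)" x "q - 1"] that Nhom q
      by (simp add: of_nat_diff)
  qed
  have step2: "(\<integral>\<^sup>+x. ennreal (d j x) * N (edge j u - x) * indicator P x \<partial>lborel)
      = (\<Sum>i<n. ennreal (1 / real (q + 1)) * (\<integral>\<^sup>+w. ennreal (G i j u w) * indicator {0<..<1} w \<partial>lborel))"
    if u: "u \<in> {0<..<1}" for j u
  proof -
    let ?p = "edge j u"
    have p: "?p \<in> P" using u by (intro edge_in_P) auto
    have "N (?p - x) = N (x - ?p)" for x by (simp add: N_def norm_minus_commute)
    then have "(\<integral>\<^sup>+x. ennreal (d j x) * N (?p - x) * indicator P x \<partial>lborel)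
      = (\<integral>\<^sup>+x. (ennreal (d j x) * N (x - ?p)) * indicator P x \<partial>lborel)" by simp
    also have "\<dots> = (\<Sum>i<n. ennreal (d i ?p / (real q + 1)) *
        (\<integral>\<^sup>+w. ennreal (d j (edge i w)) * N (edge i w - ?p) * indicator {0<..<1} w \<partial>lborel))"
    proof (rule cone_decomposition_homogeneous[OF _ p])
      fix s :: real and z :: complex assume s: "s > 0"
      have "d j (?p + of_real s * z) = s * d j (?p + z)"
        using d_edge_same[of j u] by (simp add: d_def cross_def algebra_simps)
      then have "ennreal s * (ennreal (d j (?p + of_real s * z)) * N (?p + of_real s * z - ?p))
        = ennreal s * ennreal (d j (?p + z)) * (ennreal s * N (of_real s * z))"
        using s by (simp add: ennreal_mult' mult_ac)
      also have "\<dots> = ennreal s * ennreal (d j (?p + z)) * (ennreal (s ^ (q - 1)) * N z)"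
        by (simp only: Nhom[OF s])
      also have "\<dots> = ennreal s * ennreal (s ^ (q - 1)) * (ennreal (d j (?p + z)) * N z)"
        by (simp only: mult_ac)
      also have "ennreal s * ennreal (s ^ (q - 1)) = ennreal (s ^ q)"
        using s q by (cases q) (simp_all add: ennreal_mult[symmetric])
      finally show "ennreal s * (ennreal (d j (?p + of_real s * z)) * N (?p + of_real s * z - ?p))
        = ennreal (s ^ q) * (ennreal (d j (?p + z)) * N (?p + z - ?p))" by simp
    qed measurable
    also have "\<dots> = (\<Sum>i<n. ennreal (1 / real (q + 1)) * (\<integral>\<^sup>+w. ennreal (G i j u w) * indicator {0<..<1} w \<partial>lborel))"
    proof (rule sum.cong[OF refl])
      fix i
      have di: "d i ?p \<ge> 0" using d_nonneg[OF p] .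
      have "ennreal (d i ?p / (real q + 1)) * (\<integral>\<^sup>+w. ennreal (d j (edge i w)) * N (edge i w - ?p) * indicator {0<..<1} w \<partial>lborel)
        = ennreal (1 / real (q + 1)) * (ennreal (d i ?p) * (\<integral>\<^sup>+w. ennreal (d j (edge i w)) * N (edge i w - ?p) * indicator {0<..<1} w \<partial>lborel))"
        using di by (simp add: mult.assoc[symmetric] ennreal_mult[symmetric] add.commute)
      also have "ennreal (d i ?p) * (\<integral>\<^sup>+w. ennreal (d j (edge i w)) * N (edge i w - ?p) * indicator {0<..<1} w \<partial>lborel)
         = (\<integral>\<^sup>+w. ennreal (d i ?p) * (ennreal (d j (edge i w)) * N (edge i w - ?p) * indicator {0<..<1} w) \<partial>lborel)"
        by (rule nn_integral_cmult[symmetric]) measurable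
      also have "\<dots> = (\<integral>\<^sup>+w. ennreal (G i j u w) * indicator {0<..<1} w \<partial>lborel)"
      proof (rule nn_integral_cong)
        fix w
        show "ennreal (d i ?p) * (ennreal (d j (edge i w)) * N (edge i w - ?p) * indicator {0<..<1} w)
          = ennreal (G i j u w) * indicator {0<..<1} w"
        proof (cases "w \<in> {0<..<1}")
          case True
          then have "d j (edge i w) \<ge> 0" by (intro d_nonneg edge_in_P) auto
          then show ?thesis using di
            by (simp add: G_def N_def ennreal_mult' mult_ac)
        qed simp
      qed
      finally show "ennreal (d i ?p / (real q + 1)) * (\<integral>\<^sup>+w. ennreal (d j (edge i w)) * N (edge i w - ?p) * indicator {0<..<1} w \<partial>lborel)
        = ennreal (1 / real (q + 1)) * (\<integral>\<^sup>+w. ennreal (G i j u w) * indicator {0<..<1} w \<partial>lborel)" .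
    qed
    finally show ?thesis .
  qed
  have [measurable]: "(\<lambda>x. G i j (f x) (g x)) \<in> borel_measurable M"
    if [measurable]: "f \<in> borel_measurable M" "g \<in> borel_measurable M" for i j f g and M :: "real measure"
    unfolding G_def by measurable
  have [measurable]: "(\<lambda>x. G i j (f x) (g x)) \<in> borel_measurable M"
    if [measurable]: "f \<in> borel_measurable M" "g \<in> borel_measurable M" for i j f g and M :: "(real \<times> real) measure"
    unfolding G_def by measurable
  have Gd: "cont2 (G i j)" "\<And>u w. u \<in> {0..1} \<Longrightarrow> w \<in> {0..1} \<Longrightarrow> G i j u w \<ge> 0" for i j
    using pair_integral(1,2)[OF q] by (simp_all add: G_def[abs_def])
  have dG: "dbl (G i j) \<ge> 0" for i j by (rule nn_integral_dbl(2)[OF Gd])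
  have "(\<integral>\<^sup>+x. (\<integral>\<^sup>+y. N (x - y) * indicator P y \<partial>lborel) * indicator P x \<partial>lborel)
    = (\<integral>\<^sup>+x. (\<Sum>j<n. \<integral>\<^sup>+u. ennreal (1 / real q) * (ennreal (d j x) * N (edge j u - x) * indicator P x) * indicator {0<..<1} u \<partial>lborel) \<partial>lborel)"
  proof (rule nn_integral_cong)
    fix x
    show "(\<integral>\<^sup>+y. N (x - y) * indicator P y \<partial>lborel) * indicator P x
     = (\<Sum>j<n. \<integral>\<^sup>+u. ennreal (1 / real q) * (ennreal (d j x) * N (edge j u - x) * indicator P x) * indicator {0<..<1} u \<partial>lborel)"
    proof (cases "x \<in> P")
      case True
      have "(\<integral>\<^sup>+y. N (x - y) * indicator P y \<partial>lborel) * indicator P x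
        = (\<Sum>j<n. ennreal (d j x / real q) * (\<integral>\<^sup>+u. N (edge j u - x) * indicator {0<..<1} u \<partial>lborel))"
        using True by (simp add: step1)
      also have "\<dots> = (\<Sum>j<n. \<integral>\<^sup>+u. ennreal (d j x / real q) * (N (edge j u - x) * indicator {0<..<1} u) \<partial>lborel)"
        by (intro sum.cong refl nn_integral_cmult[symmetric]) measurable
      also have "\<dots> = (\<Sum>j<n. \<integral>\<^sup>+u. ennreal (1 / real q) * (ennreal (d j x) * N (edge j u - x) * indicator P x) * indicator {0<..<1} u \<partial>lborel)"
      proof (intro sum.cong refl nn_integral_cong)
        fix j u
        have "ennreal (d j x / real q) = ennreal (1 / real q) * ennreal (d j x)"
          using d_nonneg[OF True, of j] by (simp add: ennreal_mult[symmetric])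
        then show "ennreal (d j x / real q) * (N (edge j u - x) * indicator {0<..<1} u)
          = ennreal (1 / real q) * (ennreal (d j x) * N (edge j u - x) * indicator P x) * indicator {0<..<1} u"
          using True by (simp add: mult_ac)
      qed
      finally show ?thesis .
    qed simp
  qed
  also have "\<dots> = (\<Sum>j<n. \<integral>\<^sup>+x. \<integral>\<^sup>+u. ennreal (1 / real q) * (ennreal (d j x) * N (edge j u - x) * indicator P x) * indicator {0<..<1} u \<partial>lborel \<partial>lborel)"
    by (rule nn_integral_sum) measurable
  also have "\<dots> = (\<Sum>j<n. \<integral>\<^sup>+u. \<integral>\<^sup>+x. ennreal (1 / real q) * (ennreal (d j x) * N (edge j u - x) * indicator P x) * indicator {0<..<1} u \<partial>lborel \<partial>lborel)"
    by (intro sum.cong refl lborel_pair.Fubini'[symmetric]) measurable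
  also have "\<dots> = (\<Sum>j<n. \<Sum>i<n. ennreal (1 / (real q * real (q + 1))) * ennreal (dbl (G i j)))"
  proof (intro sum.cong refl)
    fix j
    have "(\<integral>\<^sup>+u. \<integral>\<^sup>+x. ennreal (1 / real q) * (ennreal (d j x) * N (edge j u - x) * indicator P x) * indicator {0<..<1} u \<partial>lborel \<partial>lborel)
      = (\<integral>\<^sup>+u. (\<Sum>i<n. ennreal (1 / (real q * real (q + 1))) * ((\<integral>\<^sup>+w. ennreal (G i j u w) * indicator {0<..<1} w \<partial>lborel) * indicator {0<..<1} u)) \<partial>lborel)"
    proof (rule nn_integral_cong)
      fix u
      show "(\<integral>\<^sup>+x. ennreal (1 / real q) * (ennreal (d j x) * N (edge j u - x) * indicator P x) * indicator {0<..<1} u \<partial>lborel)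
        = (\<Sum>i<n. ennreal (1 / (real q * real (q + 1))) * ((\<integral>\<^sup>+w. ennreal (G i j u w) * indicator {0<..<1} w \<partial>lborel) * indicator {0<..<1} u))"
      proof (cases "u \<in> {0<..<1}")
        case True
        have "(\<integral>\<^sup>+x. ennreal (1 / real q) * (ennreal (d j x) * N (edge j u - x) * indicator P x) * indicator {0<..<1} u \<partial>lborel)
          = (\<integral>\<^sup>+x. ennreal (1 / real q) * (ennreal (d j x) * N (edge j u - x) * indicator P x) \<partial>lborel)"
          using True by simp
        also have "\<dots> = ennreal (1 / real q) * (\<integral>\<^sup>+x. (ennreal (d j x) * N (edge j u - x) * indicator P x) \<partial>lborel)"
          by (rule nn_integral_cmult) measurable
        also have "\<dots> = (\<Sum>i<n. ennreal (1 / real q) * ennreal (1 / real (q + 1)) * (\<integral>\<^sup>+w. ennreal (G i j u w) * indicator {0<..<1} w \<partial>lborel))"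
          unfolding step2[OF True] sum_distrib_left by (simp only: mult.assoc)
        also have "ennreal (1 / real q) * ennreal (1 / real (q + 1)) = ennreal (1 / (real q * real (q + 1)))"
          by (simp add: ennreal_mult[symmetric])
        finally show ?thesis using True by simp
      qed simp
    qed
    also have "\<dots> = (\<Sum>i<n. ennreal (1 / (real q * real (q + 1))) *
        (\<integral>\<^sup>+u. (\<integral>\<^sup>+w. ennreal (G i j u w) * indicator {0<..<1} w \<partial>lborel) * indicator {0<..<1} u \<partial>lborel))"
      by (subst nn_integral_sum, measurable, subst nn_integral_cmult, measurable)
    also have "\<dots> = (\<Sum>i<n. ennreal (1 / (real q * real (q + 1))) * ennreal (dbl (G i j)))"
      by (simp only: nn_integral_dbl(1)[OF Gd])
    finally show "(\<integral>\<^sup>+u. \<integral>\<^sup>+x. ennreal (1 / real q) * (ennreal (d j x) * N (edge j u - x) * indicator P x) * indicator {0<..<1} u \<partial>lborel \<partial>lborel)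
      = (\<Sum>i<n. ennreal (1 / (real q * real (q + 1))) * ennreal (dbl (G i j)))" .
  qed
  also have "\<dots> = ennreal (\<Sum>j<n. \<Sum>i<n. 1 / (real q * real (q + 1)) * dbl (G i j))"
    using dG by (simp add: ennreal_mult[symmetric] sum_nonneg)
  also have "(\<Sum>j<n. \<Sum>i<n. 1 / (real q * real (q + 1)) * dbl (G i j)) = (\<Sum>j<n. \<Sum>i<n. dbl (G i j)) / (real q * real (q + 1))"
    by (simp add: sum_divide_distrib)
  finally show ?thesis by (simp add: N_def G_def[abs_def])
qed

lemma sum_corner: "(\<Sum>j<n. \<Sum>i<n. norm (v (Suc i) - v (Suc j)) ^ k - norm (v (Suc i) - v j) ^ k
        - norm (v i - v (Suc j)) ^ k + norm (v i - v j) ^ k) = 0"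
proof -
  have 1: "(\<Sum>i<n. norm (v (Suc i) - x) ^ k) = (\<Sum>i<n. norm (v i - x) ^ k)" for x
    by (rule sum_shift[of "\<lambda>y. norm (y - x) ^ k"])
  have "(\<Sum>j<n. \<Sum>i<n. norm (v (Suc i) - v (Suc j)) ^ k - norm (v (Suc i) - v j) ^ k
        - norm (v i - v (Suc j)) ^ k + norm (v i - v j) ^ k)
     = (\<Sum>j<n. 0)"
    by (intro sum.cong refl) (simp add: sum.distrib sum_subtractf 1)
  then show ?thesis by simp
qed

text \<open>The factor 1 + 1 / q from the integration by parts cancels 1 / (q + 1). The sign is
  recorded separately because \<open>ennreal\<close> maps negative numbers to 0 and would hide
  it.\<close>

theorem riesz_energy:
  assumes q: "q \<ge> (1::nat)"
  shows "(\<integral>\<^sup>+x. (\<integral>\<^sup>+y. ennreal (norm (x - y) powi (int q - 2)) * indicator P y \<partial>lborel) * indicator P x \<partial>lborel)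
    = ennreal (- (\<Sum>j<n. \<Sum>i<n. (side i \<bullet> side j) * chord_integral q i j) / (real q)\<^sup>2)"
    and "- (\<Sum>j<n. \<Sum>i<n. (side i \<bullet> side j) * chord_integral q i j) / (real q)\<^sup>2 \<ge> 0"
proof -
  have "(\<Sum>j<n. \<Sum>i<n. dbl (\<lambda>u w. d i (edge j u) * d j (edge i w) * norm (edge i w - edge j u) powi (int q - 2)))
    = - (1 + 1 / real q) * (\<Sum>j<n. \<Sum>i<n. (side i \<bullet> side j) * chord_integral q i j)
      - (\<Sum>j<n. \<Sum>i<n. norm (v (Suc i) - v (Suc j)) ^ (q + 2) - norm (v (Suc i) - v j) ^ (q + 2)
        - norm (v i - v (Suc j)) ^ (q + 2) + norm (v i - v j) ^ (q + 2)) / (real q * real (q + 2))"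
    unfolding pair_integral(3)[OF q]
    by (simp only: sum_subtractf sum_distrib_left sum_divide_distrib mult.assoc)
  also have "\<dots> = - (1 + 1 / real q) * (\<Sum>j<n. \<Sum>i<n. (side i \<bullet> side j) * chord_integral q i j)"
    by (simp only: sum_corner)
  finally have *: "(\<Sum>j<n. \<Sum>i<n. dbl (\<lambda>u w. d i (edge j u) * d j (edge i w) * norm (edge i w - edge j u) powi (int q - 2)))
    = - (1 + 1 / real q) * (\<Sum>j<n. \<Sum>i<n. (side i \<bullet> side j) * chord_integral q i j)" .
  have "- (1 + 1 / Q) * S / (Q * (Q + 1)) = - S / Q\<^sup>2" if "Q > 0" for Q S :: real
    using that by (simp add: divide_simps power2_eq_square)
  from this[of "real q"] have **: "(\<Sum>j<n. \<Sum>i<n. dbl (\<lambda>u w. d i (edge j u) * d j (edge i w) * norm (edge i w - edge j u) powi (int q - 2)))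
      / (real q * real (q + 1)) = - (\<Sum>j<n. \<Sum>i<n. (side i \<bullet> side j) * chord_integral q i j) / (real q)\<^sup>2"
    unfolding * of_nat_add of_nat_1 using q by (simp only: of_nat_0_less_iff)
  show "(\<integral>\<^sup>+x. (\<integral>\<^sup>+y. ennreal (norm (x - y) powi (int q - 2)) * indicator P y \<partial>lborel) * indicator P x \<partial>lborel)
    = ennreal (- (\<Sum>j<n. \<Sum>i<n. (side i \<bullet> side j) * chord_integral q i j) / (real q)\<^sup>2)"
    unfolding riesz_energy_aux[OF q] ** ..
  show "- (\<Sum>j<n. \<Sum>i<n. (side i \<bullet> side j) * chord_integral q i j) / (real q)\<^sup>2 \<ge> 0"
    unfolding **[symmetric] by (intro divide_nonneg_nonneg sum_nonneg nn_integral_dbl(2) pair_integral(1,2)[OF q]) simp_all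
qed

text \<open>The integrand degenerates for two copies of the same side, which evaluates the double integral.\<close>

lemma chord_integral_same:
  assumes q: "q \<ge> (1::nat)"
  shows "real (q + 1) * real (q + 2) * chord_integral q i i = 2 * norm (side i) ^ q"
proof -
  have "(\<lambda>u w. d i (edge i u) * d i (edge i w) * norm (edge i w - edge i u) powi (int q - 2)) = (\<lambda>u w. 0)"
    by (simp add: d_edge_same)
  then have "dbl (\<lambda>u w. d i (edge i u) * d i (edge i w) * norm (edge i w - edge i u) powi (int q - 2)) = 0"
    by (simp add: dbl_def)
  moreover have "side i \<bullet> side i = (norm (side i))\<^sup>2" "norm (v (Suc i) - v i) = norm (side i)"
    "norm (v i - v (Suc i)) = norm (side i)"
    by (simp only: power2_norm_eq_inner, simp only: side_def, simp only: side_def norm_minus_commute[of "v i"])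
  ultimately have "0 = - (1 + 1 / real q) * (norm (side i))\<^sup>2 * chord_integral q i i
      - (0 ^ (q + 2) - norm (side i) ^ (q + 2) - norm (side i) ^ (q + 2) + 0 ^ (q + 2)) / (real q * real (q + 2))"
    unfolding pair_integral(3)[OF q] by simp
  also have "\<dots> = (norm (side i))\<^sup>2 / (real q * real (q + 2)) *
     (2 * norm (side i) ^ q - real (q + 1) * real (q + 2) * chord_integral q i i)"
    using q by (simp add: divide_simps power_add) (simp add: algebra_simps power2_eq_square)
  finally show ?thesis using side_nonzero[of i] q by simp
qed

end

subsection \<open>Pairs of chords of a circle\<close>

text \<open>Divergence theorem on the square for the field (w - w0, u - u0) |z|^q: as z is linear in
  (w - w0, u - u0), Euler's relation makes the divergence (q + 2) |z|^q, and the flux through the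
  four sides is the right-hand side.\<close>

lemma dbl_homogeneous:
  fixes a b :: complex and w0 u0 :: real
  assumes q: "q \<ge> (1::nat)" and ab: "cross a b \<noteq> 0"
  defines "z \<equiv> \<lambda>u w. of_real (w - w0) * a - of_real (u - u0) * b"
  shows "real (q + 2) * dbl (\<lambda>u w. norm (z u w) ^ q)
    = (1 - w0) * integral {0..1} (\<lambda>u. norm (z u 1) ^ q) + w0 * integral {0..1} (\<lambda>u. norm (z u 0) ^ q)
    + (1 - u0) * integral {0..1} (\<lambda>w. norm (z 1 w) ^ q) + u0 * integral {0..1} (\<lambda>w. norm (z 0 w) ^ q)"
proof -
  define p where "p = of_real u0 * b - of_real w0 * a"
  have z: "z u w = p + of_real w * a + of_real u * (- b)" for u w
    by (simp add: z_def p_def algebra_simps)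
  have zw: "z u w = (p + of_real u * (- b)) + of_real w * a" 
    and zu: "z u w = (p + of_real w * a) + of_real u * (- b)" for u w
    by (simp_all add: z)
  \<comment> \<open>\<open>L1\<close> and \<open>L2\<close> recover w - w0 and u - u0 as linear
    functionals of z, so that the differentiation rule with a linear factor applies even where z
    vanishes in the square.\<close>
  define L1 where "L1 x = cross x b / cross a b" for x
  define L2 where "L2 x = cross x a / cross a b" for x
  have bl: "bounded_linear L1" "bounded_linear L2"
    unfolding L1_def L2_def by (intro bounded_linear_compose[OF bounded_linear_divide bounded_linear_cross])+
  have bi: "bounded_linear (\<lambda>x. x \<bullet> c)" for c :: complex by (rule bounded_linear_inner_left)
  have L1z: "L1 (z u w) = w - w0" and L2z: "L2 (z u w) = u - u0" for u w
    using ab by (simp_all add: L1_def L2_def z_def cross_def divide_simps) (simp_all add: algebra_simps)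
  have L1a: "L1 a = 1" and L2b: "L2 (- b) = 1"
    using ab by (simp_all add: L1_def L2_def cross_def divide_simps)
  define g1 where "g1 u w = norm (z u w) ^ q + real q * (L1 (z u w) * (z u w \<bullet> a) * norm (z u w) powi (int q - 2))" for u w
  define g2 where "g2 u w = norm (z u w) ^ q + real q * (L2 (z u w) * (z u w \<bullet> (- b)) * norm (z u w) powi (int q - 2))" for u w
  have cz: "cont2 (\<lambda>u w. f (z u w))" if "continuous_on UNIV f" for f :: "complex \<Rightarrow> real"
    unfolding z by (rule cont2_comp[OF that])
  have c0: "cont2 (\<lambda>u w. norm (z u w) ^ q)"
    by (rule cz) (intro continuous_intros)
  have c1: "cont2 g1"
    unfolding g1_def by (rule cz, intro continuous_intros continuous_on_linear_kernel bl bi q)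
  have c2: "cont2 g2"
    unfolding g2_def by (rule cz, intro continuous_intros continuous_on_linear_kernel bl bi q)
  have i1: "integral {0..1} (g1 u) = (1 - w0) * norm (z u 1) ^ q + w0 * norm (z u 0) ^ q" for u
  proof -
    have "((\<lambda>w. L1 a * norm (z u w) ^ q + real q * (L1 (z u w) * (z u w \<bullet> a) * norm (z u w) powi (int q - 2)))
      has_integral (L1 (z u 1) * norm (z u 1) ^ q - L1 (z u 0) * norm (z u 0) ^ q)) {0..1}"
      unfolding zw by (rule FTC_real) (rule has_real_derivative_linear_norm_power[OF bl(1) q])
    then have "(g1 u has_integral (L1 (z u 1) * norm (z u 1) ^ q - L1 (z u 0) * norm (z u 0) ^ q)) {0..1}"
      unfolding L1a mult_1_left g1_def[symmetric] .
    then show ?thesis by (simp add: integral_unique L1z)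
  qed
  have i2: "integral {0..1} (\<lambda>u. g2 u w) = (1 - u0) * norm (z 1 w) ^ q + u0 * norm (z 0 w) ^ q" for w
  proof -
    have "((\<lambda>u. L2 (- b) * norm (z u w) ^ q + real q * (L2 (z u w) * (z u w \<bullet> (- b)) * norm (z u w) powi (int q - 2)))
      has_integral (L2 (z 1 w) * norm (z 1 w) ^ q - L2 (z 0 w) * norm (z 0 w) ^ q)) {0..1}"
      unfolding zu by (rule FTC_real) (rule has_real_derivative_linear_norm_power[OF bl(2) q])
    then have "((\<lambda>u. g2 u w) has_integral (L2 (z 1 w) * norm (z 1 w) ^ q - L2 (z 0 w) * norm (z 0 w) ^ q)) {0..1}"
      unfolding L2b mult_1_left g2_def[symmetric] .
    then show ?thesis by (simp add: integral_unique L2z)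
  qed
  have sum: "g1 u w + g2 u w = real (q + 2) * norm (z u w) ^ q" for u w
  proof -
    have "L1 (z u w) * (z u w \<bullet> a) + L2 (z u w) * (z u w \<bullet> (- b)) = z u w \<bullet> z u w"
    proof -
      have zz: "(w - w0) *\<^sub>R a - (u - u0) *\<^sub>R b = z u w"
        by (simp add: z_def scaleR_conv_of_real)
      have "(w - w0) * (z u w \<bullet> a) + (u - u0) * (z u w \<bullet> (- b)) = z u w \<bullet> ((w - w0) *\<^sub>R a - (u - u0) *\<^sub>R b)"
        by (simp add: inner_diff_right)
      then show ?thesis unfolding zz L1z L2z .
    qed
    moreover have "g1 u w + g2 u w = 2 * norm (z u w) ^ q
        + real q * ((L1 (z u w) * (z u w \<bullet> a) + L2 (z u w) * (z u w \<bullet> (- b))) * norm (z u w) powi (int q - 2))"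
      unfolding g1_def g2_def by (simp add: algebra_simps)
    ultimately have "g1 u w + g2 u w = 2 * norm (z u w) ^ q + real q * ((norm (z u w))\<^sup>2 * norm (z u w) powi (int q - 2))"
      by (simp only: power2_norm_eq_inner)
    then show ?thesis by (simp add: norm_sq_powi[OF q] algebra_simps)
  qed
  have int: "(\<lambda>x. c * f x) integrable_on {0..1}" if "continuous_on {0..1} f" for c and f :: "real \<Rightarrow> real"
    using that by (intro integrable_continuous_real continuous_intros)
  have "real (q + 2) * dbl (\<lambda>u w. norm (z u w) ^ q) = dbl g1 + dbl g2"
    by (simp only: dbl_cmult[symmetric] sum[symmetric] dbl_add[OF c1 c2])
  also have "dbl g1 = (1 - w0) * integral {0..1} (\<lambda>u. norm (z u 1) ^ q) + w0 * integral {0..1} (\<lambda>u. norm (z u 0) ^ q)"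
    unfolding dbl_def i1 by (simp only: integral_add int[OF cont2_fst[OF c0]] integral_mult_right)
  also have "dbl g2 = dbl (\<lambda>w u. g2 u w)" by (rule dbl_flip[OF c2])
  also have "\<dots> = (1 - u0) * integral {0..1} (\<lambda>w. norm (z 1 w) ^ q) + u0 * integral {0..1} (\<lambda>w. norm (z 0 w) ^ q)"
    unfolding dbl_def i2 by (simp only: integral_add int[OF cont2_snd[OF c0]] integral_mult_right)
  finally show ?thesis by simp
qed

lemma integral_reflect_unit: "integral {0..1} (\<lambda>x. f (1 - x)) = integral {0..1} (f :: real \<Rightarrow> real)"
proof -
  have "integral {-1..-0} (\<lambda>x. f (1 - (- x))) = integral {0..1} (\<lambda>x. f (1 - x))"
    by (rule Henstock_Kurzweil_Integration.integral_reflect_real[where a = 0 and b = 1 and f = "\<lambda>x. f (1 - x)"])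
  then have "integral {0..1} (\<lambda>x. f (1 - x)) = integral {0-1..1-1} (\<lambda>x. f (x + 1))"
    by (simp add: add.commute)
  also have "\<dots> = integral {0..1} f" by (rule integral_shift_real_ivl)
  finally show ?thesis .
qed

text \<open>For uniform u and w the variable w + u - 1 has the triangular density 1 - |t| on
  [-1, 1]. For even g this leaves twice the integral of (1 - t) g(t) over [0, 1].\<close>

lemma dbl_sum_even:
  fixes g G :: "real \<Rightarrow> real"
  assumes cont: "continuous_on UNIV g" and even: "\<And>t. g (- t) = g t" "G (-1) = G 1"
    and G: "\<And>t. (G has_real_derivative t * g t) (at t)"
  shows "dbl (\<lambda>u w. g (w + u - 1)) = 2 * integral {0..1} g - 2 * (G 1 - G 0)"
proof -
  have "continuous_on {-2..2} g" using cont by (rule continuous_on_subset) simp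
  \<comment> \<open>The interval is larger than needed so that F has two-sided derivatives at -1 and
    1.\<close>
  then obtain F where F: "\<And>x. x \<in> {-2..2} \<Longrightarrow> (F has_vector_derivative g x) (at x within {-2..2})"
    using antiderivative_continuous by blast
  have F': "(F has_real_derivative g x) (at x)" if "x \<in> {-1..1}" for x
    using F[of x] that at_within_Icc_at[of "-2" x "2::real"]
    by (simp add: has_real_derivative_iff_has_vector_derivative)
  have F'': "((\<lambda>x. F (x + c)) has_real_derivative g (x + c)) (at x)" if "x + c \<in> {-1..1}" for x c
    using DERIV_shift[of F "g (x + c)" x c] F'[OF that] by simp
  have F''': "((\<lambda>x. F (x - 1)) has_real_derivative g (x - 1)) (at x)" if "x - 1 \<in> {-1..1}" for x
    using F''[of x "-1"] that by simp
  have inner: "integral {0..1} (\<lambda>w. g (w + u - 1)) = F u - F (u - 1)" if "u \<in> {0..1}" for u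
  proof -
    have "((\<lambda>w. g (w + (u - 1))) has_integral (F (1 + (u - 1)) - F (0 + (u - 1)))) {0..1}"
      by (rule FTC_real, rule F'') (use that in auto)
    then show ?thesis by (simp add: integral_unique algebra_simps)
  qed
  have a1: "((\<lambda>u. F u + u * g u) has_integral (1 * F 1 - 0 * F 0)) {0..1}"
    by (rule FTC_real) (auto intro!: derivative_eq_intros F')
  have a2: "((\<lambda>u. u * g u) has_integral (G 1 - G 0)) {0..1}"
    by (rule FTC_real) (rule G)
  have i1: "(F has_integral (F 1 - (G 1 - G 0))) {0..1}"
    using has_integral_diff[OF a1 a2] by simp
  have b1: "((\<lambda>u. F (u - 1) + (u - 1) * g (u - 1)) has_integral ((1 - 1) * F (1 - 1) - (0 - 1) * F (0 - 1))) {0..1}"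
    by (rule FTC_real) (auto intro!: derivative_eq_intros F''')
  have b2: "((\<lambda>u. (u - 1) * g (u - 1)) has_integral (G (1 - 1) - G (0 - 1))) {0..1}"
  proof (rule FTC_real)
    fix x :: real
    show "((\<lambda>u. G (u - 1)) has_real_derivative (x - 1) * g (x - 1)) (at x)"
      using DERIV_shift[of G "(x - 1) * g (x - 1)" x "-1"] G by simp
  qed
  have i2: "((\<lambda>u. F (u - 1)) has_integral (F (-1) - (G 0 - G 1))) {0..1}"
    using has_integral_diff[OF b1 b2] even(2) by simp
  have i3: "(g has_integral (F 1 - F 0)) {0..1}"
    by (rule FTC_real) (auto intro!: F')
  have c1: "((\<lambda>x. g (x - 1)) has_integral (F (1 - 1) - F (0 - 1))) {0..1}"
    by (rule FTC_real) (auto intro!: F''')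
  have "g (x - 1) = g (1 - x)" for x using even(1)[of "1 - x"] by simp
  then have "integral {0..1} (\<lambda>x. g (x - 1)) = integral {0..1} g"
    by (simp only: integral_reflect_unit)
  then have i4: "integral {0..1} g = F 0 - F (-1)"
    using integral_unique[OF c1] by simp
  have "dbl (\<lambda>u w. g (w + u - 1)) = integral {0..1} (\<lambda>u. F u - F (u - 1))"
    unfolding dbl_def by (intro integral_cong inner)
  also have "\<dots> = (F 1 - (G 1 - G 0)) - (F (-1) - (G 0 - G 1))"
    by (intro integral_unique has_integral_diff i1 i2)
  finally show ?thesis using i4 integral_unique[OF i3] by simp
qed

lemma sum_periodic_shift:
  fixes f :: "int \<Rightarrow> real"
  assumes "\<And>k. f (k + int n) = f k"
  shows "(\<Sum>i<n. f (int i - int j)) = (\<Sum>i<n. f (int i))"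
proof (induction j)
  case (Suc j)
  let ?g = "\<lambda>i. f (int i - int j - 1)"
  have "(\<Sum>i<n. ?g (Suc i)) + ?g 0 = (\<Sum>i<n. ?g i) + ?g n"
    using sum.lessThan_Suc_shift[of ?g n] sum.lessThan_Suc[of ?g n] by (simp only: add.commute)
  moreover have "?g n = ?g 0" using assms[of "- int j - 1"] by (simp add: algebra_simps)
  moreover have "?g (Suc i) = f (int i - int j)" for i by simp
  ultimately show ?case using Suc by (simp add: algebra_simps)
qed simp

section \<open>Chord integrals of two edges at index distance k\<close>

locale regular_chords =
  fixes r \<alpha> :: real and q :: nat
  assumes r_pos: "r > 0" and sin_pos: "sin \<alpha> > 0" and q1: "q \<ge> 1"
begin

text \<open>The edge from angle 0 to angle 2 \<alpha> of the polygon centred at 0;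
  \<open>E 0\<close> is the vertex r.\<close>

definition E :: "real \<Rightarrow> complex" where
  "E u = of_real r * (1 + of_real u * (cis (2 * \<alpha>) - 1))"

text \<open>In a regular polygon with central angle \<open>2 * \<alpha>\<close>, the vector from the point with parameter \<open>u\<close> on an
  edge to the point with parameter \<open>w\<close> on the \<open>k\<close>-th next edge is a rotation of \<open>Z k u w\<close>.\<close>

definition Z :: "real \<Rightarrow> real \<Rightarrow> real \<Rightarrow> complex" where
  "Z k u w = cis (2 * \<alpha> * k) * E w - E u"

text \<open>The index is a real number, so that -k, k - 1 and shifts by a period can be used
  freely.\<close>

definition C :: "real \<Rightarrow> real" where
  "C k = dbl (\<lambda>u w. norm (Z k u w) ^ q)"

definition I :: "real \<Rightarrow> real" where
  "I k = integral {0..1} (\<lambda>w. norm (Z k 0 w) ^ q)"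

text \<open>Reflection in the line at angle \<alpha>, the perpendicular bisector of the
  edge.\<close>

lemma E_reflect: "E u = cis (2 * \<alpha>) * cnj (E (1 - u))"
  by (simp add: E_def cis_cnj algebra_simps cis_mult)

lemma norm_cis_mult: "norm (cis x * z) = norm z"
  by (simp add: norm_mult)

lemma norm_Z_0: "norm (Z k 0 w) = norm (of_real r - cis (2 * \<alpha> * k) * E w)"
  by (simp add: Z_def E_def norm_minus_commute)

lemma norm_Z_conj: "norm (cis x * of_real r - cnj z) = norm (of_real r - cis x * z)"
proof -
  have "norm (cis x * of_real r - cnj z) = norm (cnj (cis x * of_real r - cnj z))"
    by (simp only: complex_mod_cnj)
  also have "\<dots> = norm (cis x * (cis (- x) * of_real r - z))"
    unfolding norm_cis_mult by (simp add: cis_cnj)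
  also have "cis x * (cis (- x) * of_real r - z) = of_real r - cis x * z"
    by (simp add: algebra_simps cis_mult)
  finally show ?thesis .
qed

text \<open>This and the next two lemmas treat the sides of the parameter square in
  \<open>dbl_homogeneous\<close>: one endpoint is then a vertex, and a rotation or reflection turns
  the boundary integral into \<open>I k\<close> or \<open>I (k - 1)\<close>.\<close>

lemma Z_w1: "norm (Z k u 1) = norm (Z k 0 (1 - u))"
proof -
  have "Z k u 1 = cis (2 * \<alpha>) * (cis (2 * \<alpha> * k) * of_real r - cnj (E (1 - u)))"
    unfolding Z_def by (subst E_reflect[of u]) (simp add: E_def algebra_simps)
  then show ?thesis by (simp only: norm_cis_mult norm_Z_conj norm_Z_0)
qed

lemma Z_w0: "norm (Z k u 0) = norm (Z (k - 1) 0 (1 - u))"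
proof -
  have "cis (2 * \<alpha> * k) = cis (2 * \<alpha>) * cis (2 * \<alpha> * (k - 1))"
    by (simp add: cis_mult algebra_simps)
  then have "Z k u 0 = cis (2 * \<alpha>) * (cis (2 * \<alpha> * (k - 1)) * of_real r - cnj (E (1 - u)))"
    unfolding Z_def by (subst E_reflect[of u]) (simp add: E_def algebra_simps)
  then show ?thesis by (simp only: norm_cis_mult norm_Z_conj norm_Z_0)
qed

lemma Z_u1: "norm (Z k 1 w) = norm (Z (k - 1) 0 w)"
proof -
  have "cis (2 * \<alpha> * k) = cis (2 * \<alpha>) * cis (2 * \<alpha> * (k - 1))"
    by (simp add: cis_mult algebra_simps)
  then have "Z k 1 w = cis (2 * \<alpha>) * Z (k - 1) 0 w"
    by (simp add: Z_def E_def algebra_simps)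
  then show ?thesis by (simp only: norm_cis_mult)
qed

lemma norm_Z_neg: "norm (Z (- k) u w) = norm (Z k w u)"
proof -
  have "Z (- k) u w = - (cis (- (2 * \<alpha> * k)) * Z k w u)"
    by (simp add: Z_def algebra_simps cis_mult)
  then show ?thesis by (simp only: norm_minus_cancel norm_cis_mult)
qed

lemma Z_affine: "Z k u w = Z k 0 0 + of_real w * (cis (2 * \<alpha> * k) * (of_real r * (cis (2 * \<alpha>) - 1)))
    + of_real u * (- (of_real r * (cis (2 * \<alpha>) - 1)))"
  by (simp add: Z_def E_def algebra_simps)

lemma cont2_Z: "cont2 (\<lambda>u w. norm (Z k u w) ^ q)"
  by (subst Z_affine) (intro cont2_comp continuous_intros)

lemma C_neg: "C (- k) = C k"
  unfolding C_def norm_Z_neg by (rule dbl_flip[OF cont2_Z, symmetric])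

text \<open>The edges k and -1 - k are mirror images in the axis through the vertex
  \<open>E 0\<close>.\<close>

lemma I_reflect: "I (- 1 - k) = I k"
proof -
  have "norm (Z (- 1 - k) 0 w) = norm (Z k 0 (1 - w))" for w
  proof -
    have "- 1 - k = - (k + 1)" by simp
    then show ?thesis by (simp only: norm_Z_neg Z_w0) simp
  qed
  then show ?thesis unfolding I_def by (simp add: integral_reflect_unit[of "\<lambda>w. norm (Z k 0 w) ^ q"])
qed

lemma chord_eq: "cis x - 1 = of_real (2 * sin (x / 2)) * (\<i> * cis (x / 2))"
proof -
  have "cos x = 1 - 2 * (sin (x / 2))\<^sup>2" "sin x = 2 * sin (x / 2) * cos (x / 2)"
    using cos_double_sin[of "x / 2"] sin_double[of "x / 2"] by simp_all
  then show ?thesis by (simp add: complex_eq_iff power2_eq_square)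
qed

lemma Z_00: "Z k 0 0 = of_real (2 * r * sin (k * \<alpha>)) * (\<i> * cis (k * \<alpha>))"
  using chord_eq[of "2 * \<alpha> * k"] by (simp add: Z_def E_def algebra_simps)

text \<open>The parameter on the \<open>0\<close>-th edge where its line meets the line of the \<open>k\<close>-th edge.\<close>

definition u_star :: "real \<Rightarrow> real" where
  "u_star k = sin ((k + 1) * \<alpha>) / (2 * sin \<alpha> * cos (k * \<alpha>))"

text \<open>The lines meet at parameter \<open>u_star k\<close> on edge 0 and, by the mirror
  symmetry that exchanges the two edges and reverses their direction, at 1 - \<open>u_star k\<close>
  on edge k. The four boundary integrals of \<open>dbl_homogeneous\<close> then agree in
  pairs.\<close>

lemma C_nonparallel:
  assumes "sin (k * \<alpha>) \<noteq> 0" "cos (k * \<alpha>) \<noteq> 0"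
  shows "real (q + 2) * C k = 2 * u_star k * I k + 2 * (1 - u_star k) * I (k - 1)"
proof -
  define b where "b = of_real r * (cis (2 * \<alpha>) - 1)"
  define a where "a = cis (2 * \<alpha> * k) * b"
  let ?u = "u_star k"
  have cr: "cross (cis x * z) z = - sin x * (norm z)\<^sup>2" for x z
    unfolding cmod_power2 by (simp add: cross_def power2_eq_square algebra_simps)
  have b0: "b \<noteq> 0"
    unfolding b_def chord_eq using sin_pos r_pos by simp
  have "sin (2 * \<alpha> * k) = 2 * sin (k * \<alpha>) * cos (k * \<alpha>)"
    using sin_double[of "k * \<alpha>"] by (simp add: mult_ac)
  then have ab: "cross a b \<noteq> 0"
    unfolding a_def cr using b0 assms by simp
  have k1: "sin ((k + 1) * \<alpha>) = sin (k * \<alpha>) * cos \<alpha> + cos (k * \<alpha>) * sin \<alpha>"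
    by (simp add: algebra_simps sin_add)
  have bb: "b = of_real (2 * r * sin \<alpha>) * (\<i> * cis \<alpha>)"
    using chord_eq[of "2 * \<alpha>"] by (simp add: b_def algebra_simps)
  have u: "2 * sin \<alpha> * cos (k * \<alpha>) * ?u = sin (k * \<alpha>) * cos \<alpha> + cos (k * \<alpha>) * sin \<alpha>"
    using sin_pos assms by (simp add: u_star_def k1)
  have z0: "Z k 0 0 = of_real (- (1 - ?u)) * a + of_real ?u * b"
  proof -
    have e1: "cis (2 * \<alpha> * k) = cis (k * \<alpha>) * cis (k * \<alpha>)" by (simp add: cis_mult algebra_simps)
    have "of_real (sin (k * \<alpha>)) * cis (k * \<alpha>) = of_real (sin \<alpha>) * cis \<alpha> * (of_real ?u - of_real (1 - ?u) * (cis (k * \<alpha>) * cis (k * \<alpha>)))"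
    proof -
      define s c S T where sc: "s = sin \<alpha>" "c = cos \<alpha>" "S = sin (k * \<alpha>)" "T = cos (k * \<alpha>)"
      have sq: "s\<^sup>2 + c\<^sup>2 = 1" "S\<^sup>2 + T\<^sup>2 = 1" by (simp_all add: sc)
      have u': "2 * s * T * ?u = S * c + T * s" using u by (simp add: sc)
      have nz: "T \<noteq> 0" using assms by (simp add: sc)
      \<comment> \<open>Multiplying by 2 T lets the defining equation of \<open>?u\<close>, which
        contains 2 s T \<open>?u\<close>, be used without division.\<close>
      have "2 * T * (S * T) = 2 * T * (s * (c * (?u - (1 - ?u) * (T * T - S * S)) + s * ((1 - ?u) * (2 * S * T))))"
        using sq u' by algebra
      then have e1: "S * T = s * (c * (?u - (1 - ?u) * (T * T - S * S)) + s * ((1 - ?u) * (2 * S * T)))"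
        using nz by simp
      have "2 * T * (S * S) = 2 * T * (s * (s * (?u - (1 - ?u) * (T * T - S * S)) - c * ((1 - ?u) * (2 * S * T))))"
        using sq u' by algebra
      then have e2: "S * S = s * (s * (?u - (1 - ?u) * (T * T - S * S)) - c * ((1 - ?u) * (2 * S * T)))"
        using nz by simp
      show ?thesis
      proof (rule complex_eqI)
        show "Re (of_real (sin (k * \<alpha>)) * cis (k * \<alpha>)) = Re (of_real (sin \<alpha>) * cis \<alpha> * (of_real ?u - of_real (1 - ?u) * (cis (k * \<alpha>) * cis (k * \<alpha>))))"
          by (simp flip: sc) (use e1 in algebra)
        show "Im (of_real (sin (k * \<alpha>)) * cis (k * \<alpha>)) = Im (of_real (sin \<alpha>) * cis \<alpha> * (of_real ?u - of_real (1 - ?u) * (cis (k * \<alpha>) * cis (k * \<alpha>))))"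
          by (simp flip: sc) (use e2 in algebra)
      qed
    qed
    then have "of_real (2 * r) * \<i> * (of_real (sin (k * \<alpha>)) * cis (k * \<alpha>)) = of_real (2 * r) * \<i> * (of_real (sin \<alpha>) * cis \<alpha> * (of_real ?u - of_real (1 - ?u) * (cis (k * \<alpha>) * cis (k * \<alpha>))))"
      by (rule arg_cong)
    then show ?thesis unfolding Z_00 a_def bb e1 by (simp add: algebra_simps)
  qed
  have Z: "Z k u w = of_real (w - (1 - ?u)) * a - of_real (u - ?u) * b" for u w
    by (subst Z_affine, simp only: z0 b_def[symmetric] a_def[symmetric]) (simp add: algebra_simps)
  have "real (q + 2) * C k = (1 - (1 - ?u)) * integral {0..1} (\<lambda>u. norm (Z k u 1) ^ q)
      + (1 - ?u) * integral {0..1} (\<lambda>u. norm (Z k u 0) ^ q)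
      + (1 - ?u) * integral {0..1} (\<lambda>w. norm (Z k 1 w) ^ q) + ?u * integral {0..1} (\<lambda>w. norm (Z k 0 w) ^ q)"
    unfolding C_def Z by (rule dbl_homogeneous[OF q1 ab])
  also have "integral {0..1} (\<lambda>u. norm (Z k u 1) ^ q) = I k"
    unfolding Z_w1 I_def by (rule integral_reflect_unit)
  also have "integral {0..1} (\<lambda>u. norm (Z k u 0) ^ q) = I (k - 1)"
    unfolding Z_w0 I_def by (rule integral_reflect_unit)
  also have "integral {0..1} (\<lambda>w. norm (Z k 1 w) ^ q) = I (k - 1)"
    unfolding Z_u1 I_def ..
  finally show ?thesis by (simp add: I_def[symmetric] algebra_simps)
qed

text \<open>The difference of points on opposite edges is h + (w + u - 1) b with h orthogonal to b,
  where 2 r cos \<alpha> is the distance of the two edges. Orthogonality makes the norm even in w +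
  u - 1, and t |h + t b|^q has an explicit antiderivative.\<close>

lemma C_opposite:
  assumes "2 * k * \<alpha> = pi" "cos \<alpha> \<ge> 0"
  shows "C k = 2 * I k - 2 * ((2 * r) ^ (q + 2) - (2 * r * cos \<alpha>) ^ (q + 2)) / (real (q + 2) * (2 * r * sin \<alpha>)\<^sup>2)"
proof -
  define b where "b = - (of_real r * (cis (2 * \<alpha>) - 1))"
  define h where "h = - (of_real r * (cis (2 * \<alpha>) + 1))"
  have ck: "cis (2 * \<alpha> * k) = - 1" using assms(1) by (simp add: mult_ac)
  have Z: "Z k u w = h + of_real (w + u - 1) * b" for u w
    unfolding Z_def E_def ck by (simp add: b_def h_def algebra_simps)
  have hb: "h \<bullet> b = 0"
  proof -
    have "h \<bullet> b = (r * (cos (2 * \<alpha>) + 1)) * (r * (cos (2 * \<alpha>) - 1)) + (r * sin (2 * \<alpha>)) * (r * sin (2 * \<alpha>))"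
      by (simp add: h_def b_def inner_complex_def)
    also have "\<dots> = 0" using sin_cos_squared_add[of "2 * \<alpha>"] by algebra
    finally show ?thesis .
  qed
  have nb: "norm b = 2 * r * sin \<alpha>"
    unfolding b_def chord_eq using r_pos sin_pos by (simp add: norm_mult)
  have nz: "norm (h + of_real t * b) = sqrt ((norm h)\<^sup>2 + t\<^sup>2 * (norm b)\<^sup>2)" for t
  proof -
    have "(norm (h + of_real t * b))\<^sup>2 = (norm h)\<^sup>2 + 2 * t * (h \<bullet> b) + t\<^sup>2 * (norm b)\<^sup>2"
      unfolding power2_norm_eq_inner by (simp add: inner_complex_def power2_eq_square algebra_simps)
    then show ?thesis using hb by (intro real_sqrt_unique[symmetric]) auto
  qed
  have nh: "(norm h)\<^sup>2 = (2 * r * cos \<alpha>)\<^sup>2"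
  proof -
    have "(norm h)\<^sup>2 = (r * (cos (2 * \<alpha>) + 1))\<^sup>2 + (r * sin (2 * \<alpha>))\<^sup>2"
      unfolding cmod_power2 h_def by (simp add: power2_eq_square)
    also have "\<dots> = (2 * r * cos \<alpha>)\<^sup>2"
      using sin_cos_squared_add[of "2 * \<alpha>"] cos_double_cos[of \<alpha>] by algebra
    finally show ?thesis .
  qed
  define g where "g t = norm (h + of_real t * b) ^ q" for t
  define G where "G t = norm (h + of_real t * b) ^ (q + 2) / (real (q + 2) * (norm b)\<^sup>2)" for t
  have cg: "continuous_on UNIV g" unfolding g_def by (intro continuous_intros)
  have even: "g (- t) = g t" "G (- 1) = G 1" for t
    unfolding g_def G_def nz by simp_all
  have "(h + of_real t * b) \<bullet> b = t * (norm b)\<^sup>2" for t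
  proof -
    have "(h + of_real t * b) \<bullet> b = h \<bullet> b + t * (b \<bullet> b)" by (simp add: inner_complex_def algebra_simps)
    then show ?thesis by (simp add: hb power2_norm_eq_inner)
  qed
  moreover have "norm b \<noteq> 0" using nb r_pos sin_pos by simp
  ultimately have dG: "(G has_real_derivative t * g t) (at t)" for t
    using DERIV_cdivide[OF has_real_derivative_norm_power[OF q1, of h b t], of "real (q + 2) * (norm b)\<^sup>2"]
    unfolding G_def g_def by simp
  have "C k = 2 * integral {0..1} g - 2 * (G 1 - G 0)"
    unfolding C_def Z g_def[symmetric] by (rule dbl_sum_even[OF cg even dG])
  also have "integral {0..1} g = I k"
  proof -
    have "I k = integral {0..1} (\<lambda>w. g (1 - w))"
      unfolding I_def Z g_def[symmetric] using even(1)[of "1 - _"] by simp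
    then show ?thesis by (simp only: integral_reflect_unit)
  qed
  also have "G 1 - G 0 = ((2 * r) ^ (q + 2) - (2 * r * cos \<alpha>) ^ (q + 2)) / (real (q + 2) * (2 * r * sin \<alpha>)\<^sup>2)"
  proof -
    have "norm (h + of_real 0 * b) = 2 * r * cos \<alpha>"
      unfolding nz nh using r_pos assms(2) by simp
    moreover have "norm (h + of_real 1 * b) = 2 * r"
    proof -
      have eq: "(2 * r * cos \<alpha>)\<^sup>2 + (2 * r * sin \<alpha>)\<^sup>2 = (2 * r)\<^sup>2"
        using sin_cos_squared_add[of \<alpha>] by algebra
      have "sqrt ((2 * r)\<^sup>2) = 2 * r"
        using r_pos by (simp only: real_sqrt_abs)
      then show ?thesis unfolding nz nh nb power_one mult_1_left eq .
    qed
    ultimately show ?thesis by (simp only: G_def nb diff_divide_distrib)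
  qed
  finally show ?thesis by simp
qed

end

subsection \<open>Regular polygons\<close>

definition rvert :: "complex \<Rightarrow> real \<Rightarrow> nat \<Rightarrow> real \<Rightarrow> nat \<Rightarrow> complex" where
  "rvert c \<theta> n r j = c + of_real r * cis (\<theta> + 2 * alpha n * real j)"

lemma cis_add_2pi: "cis (x + 2 * pi) = cis x"
  by (simp add: complex_eq_iff)

lemma cross_rotate: "cross (cis x * a) (cis x * b) = cross a b"
  by (simp add: cross_def) (use sin_cos_squared_add[of x] in algebra)

lemma inner_rotate: "(cis x * a) \<bullet> (cis y * a) = cos (x - y) * (norm a)\<^sup>2"
  unfolding cmod_power2
  by (simp add: inner_complex_def cos_diff power2_eq_square algebra_simps)

text \<open>A closed form from which the orientation axioms can be read off: for i = j and i = j + 1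
  the angle in the last cosine is -\<alpha> and \<alpha>, and the expression is 0.\<close>

lemma cross_chords:
  "cross (rvert c \<theta> n r j - rvert c \<theta> n r i) (rvert c \<theta> n r (Suc j) - rvert c \<theta> n r i)
   = 2 * r\<^sup>2 * sin (alpha n) * (cos (alpha n) - cos ((2 * (real i - real j) - 1) * alpha n))"
proof -
  define \<alpha> where "\<alpha> = alpha n"
  define x where "x = \<theta> + 2 * \<alpha> * real j"
  define y where "y = \<theta> + 2 * \<alpha> * real i"
  have "cross (rvert c \<theta> n r j - rvert c \<theta> n r i) (rvert c \<theta> n r (Suc j) - rvert c \<theta> n r i)
    = r\<^sup>2 * cross (cis x - cis y) (cis (x + 2 * \<alpha>) - cis y)"
    by (simp add: rvert_def x_def y_def \<alpha>_def cross_def power2_eq_square algebra_simps)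
  also have "cross (cis x - cis y) (cis (x + 2 * \<alpha>) - cis y)
     = sin ((x + 2 * \<alpha>) - x) + sin (x - y) - sin ((x + 2 * \<alpha>) - y)"
    unfolding sin_diff by (simp add: cross_def algebra_simps)
  also have "\<dots> = sin (2 * \<alpha>) + (sin (x - y) - sin (x - y + 2 * \<alpha>))"
    by (simp add: algebra_simps)
  also have "sin (x - y) - sin (x - y + 2 * \<alpha>) = - 2 * sin \<alpha> * cos (x - y + \<alpha>)"
  proof -
    have eqs: "(x - y - (x - y + 2 * \<alpha>)) / 2 = - \<alpha>" "(x - y + (x - y + 2 * \<alpha>)) / 2 = x - y + \<alpha>"
      by simp_all
    show ?thesis using sin_diff_sin[of "x - y" "x - y + 2 * \<alpha>"] by (simp only: eqs sin_minus)
  qed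
  also have "cos (x - y + \<alpha>) = cos ((2 * (real i - real j) - 1) * \<alpha>)"
    using cos_minus[of "x - y + \<alpha>"] by (simp add: x_def y_def algebra_simps)
  finally show ?thesis unfolding \<alpha>_def sin_double by (simp add: algebra_simps)
qed

lemma alpha_bounds:
  assumes "n \<ge> 3"
  shows "alpha n > 0" "alpha n \<le> pi / 3" "sin (alpha n) > 0" "cos (alpha n) > 0" "real n * alpha n = pi"
proof -
  show 1: "alpha n > 0" "alpha n \<le> pi / 3" "real n * alpha n = pi"
    using assms by (auto simp: alpha_def divide_simps)
  have "alpha n < pi" "alpha n < pi / 2" using 1(2) pi_gt_zero by linarith+
  then show "sin (alpha n) > 0" "cos (alpha n) > 0"
    using 1(1) by (auto intro: sin_gt_zero cos_gt_zero)
qed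

text \<open>The angle runs from \<open>alpha n\<close> up to 2 pi - 3 \<open>alpha n\<close>; beyond
  pi it is reflected to 2 pi - t, which is still larger than \<open>alpha n\<close>.\<close>

lemma cos_half_turns:
  assumes n: "n \<ge> 3" and "k \<ge> 1" "k < int n"
  shows "cos ((2 * real_of_int k - 1) * alpha n) \<le> cos (alpha n)"
    and "k > 1 \<Longrightarrow> cos ((2 * real_of_int k - 1) * alpha n) < cos (alpha n)"
proof -
  note a = alpha_bounds[OF n]
  define t where "t = (2 * real_of_int k - 1) * alpha n"
  have t1: "alpha n \<le> t" using assms a(1) by (simp add: t_def)
  have "(2 * real_of_int k - 1) * alpha n \<le> (2 * real n - 3) * alpha n"
    using assms a(1) by (intro mult_right_mono) auto
  then have t2: "t \<le> 2 * pi - 3 * alpha n" using a(5) by (simp add: t_def algebra_simps)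
  have lt: "cos t < cos (alpha n)" if "k > 1"
  proof (cases "t \<le> pi")
    case True
    have "1 * alpha n < (2 * real_of_int k - 1) * alpha n"
      using that a(1) by (intro mult_strict_right_mono) auto
    then show ?thesis using True a(1) by (intro cos_monotone_0_pi) (auto simp: t_def)
  next
    case False
    have "cos (2 * pi - t) < cos (alpha n)"
      using False t2 a(1) by (intro cos_monotone_0_pi) auto
    then show ?thesis by (simp add: cos_diff)
  qed
  then show "k > 1 \<Longrightarrow> cos ((2 * real_of_int k - 1) * alpha n) < cos (alpha n)" by (simp add: t_def)
  show "cos ((2 * real_of_int k - 1) * alpha n) \<le> cos (alpha n)"
  proof (cases "k = 1")
    case False
    then show ?thesis using lt assms by (simp add: t_def)
  qed simp
qed

lemma cos_period_alpha:
  assumes n: "n \<ge> 3"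
  shows "cos ((2 * real_of_int (k mod int n) - 1) * alpha n) = cos ((2 * real_of_int k - 1) * alpha n)"
proof -
  have "real_of_int k = real_of_int (k mod int n) + real n * real_of_int (k div int n)"
    by (metis mod_mult_div_eq of_int_add of_int_mult of_int_of_nat_eq)
  then have "(2 * real_of_int k - 1) * alpha n
      = (2 * real_of_int (k mod int n) - 1) * alpha n + 2 * real_of_int (k div int n) * (real n * alpha n)"
    by (simp add: algebra_simps)
  also have "\<dots> = (2 * real_of_int (k mod int n) - 1) * alpha n + 2 * pi * real_of_int (k div int n)"
    unfolding alpha_bounds(5)[OF n] by simp
  finally show ?thesis
    using cos.plus_of_int[of "(2 * real_of_int (k mod int n) - 1) * alpha n" "k div int n"] by (simp add: mult_ac)
qed

lemma cyclic_polygon_rvert: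
  assumes n: "n \<ge> 3" and r: "r > 0"
  shows "cyclic_polygon (rvert c \<theta> n r) n"
proof
  show "n \<ge> 3" by fact
  note a = alpha_bounds[OF n]
  show "rvert c \<theta> n r (j + n) = rvert c \<theta> n r j" for j
  proof -
    have "\<theta> + 2 * alpha n * real (j + n) = (\<theta> + 2 * alpha n * real j) + 2 * (real n * alpha n)"
      by (simp add: algebra_simps)
    also have "\<dots> = (\<theta> + 2 * alpha n * real j) + 2 * pi" by (simp only: a(5))
    finally have "cis (\<theta> + 2 * alpha n * real (j + n)) = cis (\<theta> + 2 * alpha n * real j)"
      by (simp only: cis_add_2pi)
    then show ?thesis by (simp add: rvert_def)
  qed
  fix i j
  \<comment> \<open>Reducing the index difference modulo n leaves 0 and 1 as the only values for
    which the triangle degenerates.\<close>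
  define k where "k = (int i - int j) mod int n"
  have kn: "0 \<le> k" "k < int n" using n by (simp_all add: k_def)
  have cr: "cross (rvert c \<theta> n r j - rvert c \<theta> n r i) (rvert c \<theta> n r (Suc j) - rvert c \<theta> n r i)
    = 2 * r\<^sup>2 * sin (alpha n) * (cos (alpha n) - cos ((2 * real_of_int k - 1) * alpha n))"
    unfolding cross_chords k_def cos_period_alpha[OF n] by simp
  have "cos ((2 * real_of_int k - 1) * alpha n) \<le> cos (alpha n)"
    using cos_half_turns(1)[OF n _ kn(2)] kn(1) by (cases "k = 0") auto
  then show "cross (rvert c \<theta> n r j - rvert c \<theta> n r i) (rvert c \<theta> n r (Suc j) - rvert c \<theta> n r i) \<ge> 0"
    unfolding cr using a(3) by simp
  assume ne: "i mod n \<noteq> j mod n" "i mod n \<noteq> Suc j mod n"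
  have "k \<noteq> 0"
  proof
    assume "k = 0"
    then have "int i mod int n = int j mod int n" unfolding k_def by (simp add: mod_eq_dvd_iff dvd_eq_mod_eq_0)
    then show False using ne(1) by (metis of_nat_eq_iff zmod_int)
  qed
  moreover have "k \<noteq> 1"
  proof
    assume "k = 1"
    then have "(int i - int j) mod int n = 1 mod int n" using n by (simp add: k_def)
    then have "int i mod int n = int (Suc j) mod int n" by (simp add: mod_eq_dvd_iff algebra_simps)
    then show False using ne(2) by (metis of_nat_eq_iff zmod_int)
  qed
  ultimately have "cos ((2 * real_of_int k - 1) * alpha n) < cos (alpha n)"
    using cos_half_turns(2)[OF n _ kn(2)] kn(1) by simp
  then show "cross (rvert c \<theta> n r j - rvert c \<theta> n r i) (rvert c \<theta> n r (Suc j) - rvert c \<theta> n r i) > 0"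
    unfolding cr using a(3) r by simp
qed

text \<open>The parameter \<open>q\<close> stands for \<open>m + 2\<close>.\<close>

locale regular_ngon =
  fixes c :: complex and \<theta> :: real and n :: nat and r :: real and q :: nat
  assumes n3: "n \<ge> 3" and r_pos: "r > 0" and q1: "q \<ge> 1"
begin

sublocale poly: cyclic_polygon "rvert c \<theta> n r" n
  by (rule cyclic_polygon_rvert[OF n3 r_pos])

sublocale chords: regular_chords r "alpha n" q
  by standard (use r_pos q1 alpha_bounds[OF n3] in auto)

lemma P_eq: "poly.P = regular_polygon c \<theta> n r"
  unfolding poly.P_def regular_polygon_def by (simp add: rvert_def[abs_def] alpha_def)

definition b :: complex where
  "b = of_real r * (cis (2 * alpha n) - 1)"

lemma norm_b: "norm b = 2 * r * sin (alpha n)"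
  unfolding b_def chords.chord_eq using r_pos alpha_bounds[OF n3] by (simp add: norm_mult)

lemma side_eq: "poly.side j = cis (\<theta> + 2 * alpha n * real j) * b"
  by (simp add: poly.side_def rvert_def b_def algebra_simps flip: cis_mult)

lemma edge_eq: "poly.edge j u = c + cis (\<theta> + 2 * alpha n * real j) * chords.E u"
  by (simp add: poly.edge_def side_eq rvert_def b_def chords.E_def algebra_simps)

lemma chord_integral_eq: "poly.chord_integral q i j = chords.C (real i - real j)"
proof -
  have "norm (poly.edge i w - poly.edge j u) = norm (chords.Z (real i - real j) u w)" for u w
  proof -
    have "cis (\<theta> + 2 * alpha n * real i) = cis (\<theta> + 2 * alpha n * real j) * cis (2 * alpha n * (real i - real j))"
      by (simp add: cis_mult algebra_simps)
    then have "poly.edge i w - poly.edge j u = cis (\<theta> + 2 * alpha n * real j) * chords.Z (real i - real j) u w"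
      by (simp add: edge_eq chords.Z_def algebra_simps)
    then show ?thesis by (simp only: chords.norm_cis_mult)
  qed
  then show ?thesis by (simp add: poly.chord_integral_def chords.C_def)
qed

lemma cis_alpha_period: "cis (2 * alpha n * (k + real n)) = cis (2 * alpha n * k)"
proof -
  have "2 * alpha n * (k + real n) = 2 * alpha n * k + 2 * (real n * alpha n)" by (simp add: algebra_simps)
  then show ?thesis by (simp only: alpha_bounds(5)[OF n3] cis_add_2pi)
qed

lemma C_period: "chords.C (k + real n) = chords.C k"
  and I_period: "chords.I (k + real n) = chords.I k"
  by (simp_all add: chords.C_def chords.I_def chords.Z_def cis_alpha_period)

lemma C_0: "real (q + 1) * real (q + 2) * chords.C 0 = 2 * (2 * r * sin (alpha n)) ^ q"
  using poly.chord_integral_same[OF q1, of 0]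
  by (simp add: chord_integral_eq side_eq chords.norm_cis_mult norm_b)

text \<open>Sides i and j enclose the angle 2 (i - j) \<open>alpha n\<close>, and the chord integral
  also depends only on i - j. The summand is periodic, so all n rows of the double sum are
  equal.\<close>

lemma energy:
  "(\<integral>\<^sup>+x. (\<integral>\<^sup>+y. ennreal (norm (x - y) powi (int q - 2)) * indicator (regular_polygon c \<theta> n r) y \<partial>lborel)
      * indicator (regular_polygon c \<theta> n r) x \<partial>lborel)
   = ennreal (- (real n * (2 * r * sin (alpha n))\<^sup>2 * (\<Sum>d<n. cos (2 * alpha n * real d) * chords.C (real d))) / (real q)\<^sup>2)"
    (is "?lhs = ennreal ?rhs")
  and energy_nonneg: "- (real n * (2 * r * sin (alpha n))\<^sup>2 * (\<Sum>d<n. cos (2 * alpha n * real d) * chords.C (real d))) / (real q)\<^sup>2 \<ge> 0"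
proof -
  define f where "f k = cos (2 * alpha n * real_of_int k) * chords.C (real_of_int k)" for k :: int
  have per: "f (k + int n) = f k" for k
    using cis_alpha_period[of "real_of_int k"] C_period[of "real_of_int k"]
    by (simp add: f_def complex_eq_iff)
  have *: "(poly.side i \<bullet> poly.side j) * poly.chord_integral q i j
     = (2 * r * sin (alpha n))\<^sup>2 * f (int i - int j)" for i j
    unfolding side_eq inner_rotate norm_b chord_integral_eq f_def
    by (simp add: algebra_simps)
  have "(\<Sum>j<n. \<Sum>i<n. (poly.side i \<bullet> poly.side j) * poly.chord_integral q i j)
     = (2 * r * sin (alpha n))\<^sup>2 * (\<Sum>j<n. \<Sum>i<n. f (int i - int j))"
    unfolding * by (simp only: sum_distrib_left)
  also have "(\<Sum>j<n. \<Sum>i<n. f (int i - int j)) = real n * (\<Sum>i<n. f (int i))"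
    by (simp add: sum_periodic_shift[of f n, OF per])
  finally have **: "(\<Sum>j<n. \<Sum>i<n. (poly.side i \<bullet> poly.side j) * poly.chord_integral q i j)
     = real n * (2 * r * sin (alpha n))\<^sup>2 * (\<Sum>d<n. cos (2 * alpha n * real d) * chords.C (real d))"
    by (simp add: f_def)
  show "?lhs = ennreal ?rhs" "?rhs \<ge> 0"
    using poly.riesz_energy[OF q1] unfolding ** P_eq .
qed

lemma emeasure_regular_polygon: "emeasure lborel (regular_polygon c \<theta> n r) = ennreal (area n r)"
proof -
  have "poly.d j c = r\<^sup>2 * sin (2 * alpha n)" for j
  proof -
    have "poly.d j c = cross (cis (\<theta> + 2 * alpha n * real j) * of_real r) (cis (\<theta> + 2 * alpha n * real j) * b)"
      by (simp add: poly.d_def side_eq rvert_def mult.commute)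
    then show ?thesis unfolding cross_rotate by (simp add: cross_def b_def power2_eq_square)
  qed
  \<comment> \<open>\<open>emeasure_P\<close> asks for a point of the polygon; a vertex serves, and
    \<open>sum_d_const\<close> moves the computation to the centre, where all summands are
    equal.\<close>
  then have "(\<Sum>j<n. poly.d j (rvert c \<theta> n r 0)) = real n * (r\<^sup>2 * sin (2 * alpha n))"
    by (subst poly.sum_d_const[of _ c]) simp
  then show ?thesis
    using poly.emeasure_P[OF poly.v_in_P[of 0]] by (simp add: P_eq area_def mult_ac)
qed

lemma area_pos: "area n r > 0"
proof -
  note a = alpha_bounds[OF n3]
  have "sin (2 * alpha n) > 0" using a by (simp add: sin_double)
  then show ?thesis using r_pos n3 by (simp add: area_def)
qed

lemma distance_moment:
  assumes "prob_space M" and indep: "prob_space.indep_var M borel X borel Y"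
    and dX: "distr M borel X = uniform_measure lborel (regular_polygon c \<theta> n r)"
    and dY: "distr M borel Y = uniform_measure lborel (regular_polygon c \<theta> n r)"
  shows "integrable M (\<lambda>\<omega>. dist (X \<omega>) (Y \<omega>) powi (int q - 2))"
    and "prob_space.expectation M (\<lambda>\<omega>. dist (X \<omega>) (Y \<omega>) powi (int q - 2))
      = - (real n * (2 * r * sin (alpha n))\<^sup>2 * (\<Sum>d<n. cos (2 * alpha n * real d) * chords.C (real d))) / (real q)\<^sup>2
        / (area n r)\<^sup>2"
proof -
  interpret prob_space M by fact
  let ?R = "regular_polygon c \<theta> n r"
  let ?N = "\<lambda>z. norm z powi (int q - 2)"
  define S where "S = - (real n * (2 * r * sin (alpha n))\<^sup>2 * (\<Sum>d<n. cos (2 * alpha n * real d) * chords.C (real d))) / (real q)\<^sup>2"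
  have S0: "S \<ge> 0" unfolding S_def by (rule energy_nonneg)
  have [measurable]: "X \<in> borel_measurable M" "Y \<in> borel_measurable M"
    using indep_var_rv1[OF indep] indep_var_rv2[OF indep] by auto
  have [measurable]: "?R \<in> sets borel" using poly.P_borel by (simp add: P_eq)
  have joint: "distr M (borel \<Otimes>\<^sub>M borel) (\<lambda>x. (X x, Y x)) = uniform_measure lborel ?R \<Otimes>\<^sub>M uniform_measure lborel ?R"
    using indep unfolding indep_var_distribution_eq dX dY by simp
  interpret U: prob_space "uniform_measure lborel ?R"
    using prob_space_distr[of Y borel] by (simp add: dY)
  have "(\<integral>\<^sup>+\<omega>. ennreal (?N (X \<omega> - Y \<omega>)) \<partial>M)
    = (\<integral>\<^sup>+z. ennreal (?N (fst z - snd z)) \<partial>(distr M (borel \<Otimes>\<^sub>M borel) (\<lambda>x. (X x, Y x))))"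
    by (subst nn_integral_distr) auto
  also have "\<dots> = (\<integral>\<^sup>+x. \<integral>\<^sup>+y. ennreal (?N (x - y)) \<partial>uniform_measure lborel ?R \<partial>uniform_measure lborel ?R)"
    unfolding joint by (subst U.nn_integral_fst[symmetric]) auto
  also have "\<dots> = (\<integral>\<^sup>+x. (\<integral>\<^sup>+y. ennreal (?N (x - y)) * indicator ?R y \<partial>lborel) / ennreal (area n r) * indicator ?R x \<partial>lborel) / ennreal (area n r)"
    by (simp add: nn_integral_uniform_measure emeasure_regular_polygon)
  also have "\<dots> = (\<integral>\<^sup>+x. (\<integral>\<^sup>+y. ennreal (?N (x - y)) * indicator ?R y \<partial>lborel) * indicator ?R x \<partial>lborel) / ennreal (area n r) / ennreal (area n r)"
    by (subst nn_integral_divide[symmetric]) (auto simp: divide_ennreal_def mult_ac)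
  also have "\<dots> = ennreal S / ennreal (area n r) / ennreal (area n r)"
    unfolding energy S_def ..
  also have "\<dots> = ennreal (S / (area n r)\<^sup>2)"
    using S0 area_pos by (simp add: divide_ennreal power2_eq_square)
  finally have nn: "(\<integral>\<^sup>+\<omega>. ennreal (?N (X \<omega> - Y \<omega>)) \<partial>M) = ennreal (S / (area n r)\<^sup>2)" .
  \<comment> \<open>A nonnegative function with finite nonnegative integral is integrable with the
    same value; this needs the sign of \<open>S\<close>.\<close>
  have "integrable M (\<lambda>\<omega>. ?N (X \<omega> - Y \<omega>)) \<and> integral\<^sup>L M (\<lambda>\<omega>. ?N (X \<omega> - Y \<omega>)) = S / (area n r)\<^sup>2"
    using S0 nn by (subst nn_integral_eq_integrable[symmetric]) auto
  then show "integrable M (\<lambda>\<omega>. dist (X \<omega>) (Y \<omega>) powi (int q - 2))"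
    "prob_space.expectation M (\<lambda>\<omega>. dist (X \<omega>) (Y \<omega>) powi (int q - 2)) = - (real n * (2 * r * sin (alpha n))\<^sup>2 * (\<Sum>d<n. cos (2 * alpha n * real d) * chords.C (real d))) / (real q)\<^sup>2
        / (area n r)\<^sup>2"
    unfolding dist_norm S_def by simp_all
qed

end

subsection \<open>The antiderivatives psi, sigma and tau\<close>

text \<open>Raising \<mu> by 2 adds exactly one summand, and the product for index \<nu> + 1 is its
  first factor times the old product for \<nu>, as j and \<mu> shift together.\<close>

lemma gam_rec:
  assumes "\<mu> \<ge> 1"
  shows "gam (\<mu> + 2) a x = 1 + (a / x)\<^sup>2 * ((of_int \<mu> + 1) / of_int \<mu>) * gam \<mu> a x"
proof -
  define N where "N = nat ((\<mu> - 1) div 2)"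
  define g where "g \<nu> = (a / x) ^ (2 * \<nu>) * (\<Prod>j=1..\<nu>. (of_int \<mu> + 3 - 2 * real j) / (of_int \<mu> + 2 - 2 * real j))" for \<nu>
  have "(\<mu> + 2 - 1) div 2 = (\<mu> - 1) div 2 + 1" by linarith
  then have N: "nat ((\<mu> + 2 - 1) div 2) = Suc N" using assms by (simp add: N_def nat_add_distrib)
  have 1: "gam (\<mu> + 2) a x = 1 + (\<Sum>\<nu>=1..Suc N. g \<nu>)"
    unfolding gam_def N g_def by (simp add: algebra_simps)
  have 2: "(\<Sum>\<nu>=1..Suc N. g \<nu>) = g 1 + (\<Sum>\<nu>=1..N. g (Suc \<nu>))"
    by (subst sum.atLeast_Suc_atMost) (auto simp: sum.shift_bounds_cl_Suc_ivl simp del: sum.cl_ivl_Suc)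
  have 3: "g (Suc \<nu>) = (a / x)\<^sup>2 * ((of_int \<mu> + 1) / of_int \<mu>) *
     ((a / x) ^ (2 * \<nu>) * (\<Prod>j=1..\<nu>. (of_int \<mu> + 1 - 2 * real j) / (of_int \<mu> - 2 * real j)))" for \<nu>
  proof -
    have "(\<Prod>j=1..Suc \<nu>. (of_int \<mu> + 3 - 2 * real j) / (of_int \<mu> + 2 - 2 * real j))
      = (of_int \<mu> + 1) / of_int \<mu> * (\<Prod>j=1..\<nu>. (of_int \<mu> + 1 - 2 * real j) / (of_int \<mu> - 2 * real j))"
      by (subst prod.atLeast_Suc_atMost) (auto simp: prod.shift_bounds_cl_Suc_ivl algebra_simps simp del: prod.cl_ivl_Suc)
    then show ?thesis by (simp add: g_def power2_eq_square mult_ac)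
  qed
  have 4: "g 1 = (a / x)\<^sup>2 * ((of_int \<mu> + 1) / of_int \<mu>)"
    by (simp add: g_def)
  show ?thesis
    unfolding 1 2 3 4 by (simp add: gam_def N_def[symmetric] sum_distrib_left distrib_left)
qed

text \<open>The reduction formula for the integral of x^\<mu> / sqrt (x^2 - a^2), of which
  \<open>psi\<close> is an antiderivative. The case \<mu> = 0 is separate because \<open>psi\<close>
  has its own branch there and \<open>gam_rec\<close> divides by \<mu>.\<close>

lemma psi_rec:
  assumes "\<mu> \<ge> 0" "a > 0" "x > 0"
  shows "psi (\<mu> + 2) a x = (x powi (\<mu> + 1) * sqrt (x\<^sup>2 - a\<^sup>2) + (of_int \<mu> + 1) * a\<^sup>2 * psi \<mu> a x) / (of_int \<mu> + 2)"
proof (cases "\<mu> = 0")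
  case True
  have "dfact (nat 1) = 1" "dfact (nat 2) = 2" by (simp_all add: numeral_2_eq_2)
  then show ?thesis using True by (simp add: psi_def gam_def power_int_def field_simps)
next
  case False
  then have mu: "\<mu> \<ge> 1" using assms(1) by simp
  define s where "s = sqrt (x\<^sup>2 - a\<^sup>2)"
  define l where "l = ln ((x + s) / a)"
  define m where "m = (of_int \<mu> :: real)"
  have m: "m \<ge> 1" using mu by (simp add: m_def)
  have p1: "x powi (\<mu> + 1) = x powi (\<mu> - 1) * x\<^sup>2"
    using power_int_add[of x "\<mu> - 1" 2] assms(3) by (simp add: add.commute)
  have p2: "a powi (\<mu> + 2) = a powi \<mu> * a\<^sup>2"
    using power_int_add[of a \<mu> 2] assms(2) by simp
  have main: "x powi (\<mu> + 1) * s * gam (\<mu> + 2) a x / (m + 2)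
    = (x powi (\<mu> + 1) * s + (m + 1) * a\<^sup>2 * (x powi (\<mu> - 1) * s * gam \<mu> a x / m)) / (m + 2)"
  proof -
    have e: "x\<^sup>2 * (1 + (a / x)\<^sup>2 * ((m + 1) / m) * g) = x\<^sup>2 + a\<^sup>2 * ((m + 1) / m) * g" for g
      using assms(3) by (simp add: power_divide distrib_left)
    have f: "p * x\<^sup>2 * s * (1 + (a / x)\<^sup>2 * ((m + 1) / m) * g) = p * s * (x\<^sup>2 + a\<^sup>2 * ((m + 1) / m) * g)" for p g
      unfolding e[symmetric] by (simp only: mult_ac)
    show ?thesis
      unfolding gam_rec[OF mu] m_def[symmetric] p1 f using m by (simp add: divide_simps) (simp add: algebra_simps)
  qed
  show ?thesis
  proof (cases "odd \<mu>")
    case True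
    have "psi (\<mu> + 2) a x = x powi (\<mu> + 1) * s * gam (\<mu> + 2) a x / (m + 2)"
      "psi \<mu> a x = x powi (\<mu> - 1) * s * gam \<mu> a x / m"
      using True mu by (simp_all add: psi_def s_def m_def add.commute)
    then show ?thesis using main by (simp add: s_def m_def)
  next
    case ev: False
    have n1: "nat (\<mu> + 1) = Suc (Suc (nat (\<mu> - 1)))" "nat (\<mu> + 2) = Suc (Suc (nat \<mu>))"
      using mu by linarith+
    have d: "real (dfact (nat (\<mu> + 1))) = (m + 1) * real (dfact (nat (\<mu> - 1)))"
      "real (dfact (nat (\<mu> + 2))) = (m + 2) * real (dfact (nat \<mu>))"
      unfolding n1 using mu by (simp_all add: m_def algebra_simps)
    have "dfact k > 0" for k by (induction k rule: dfact.induct) auto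
    then have d0: "real (dfact k) \<noteq> 0" for k by simp
    have 1: "psi (\<mu> + 2) a x = x powi (\<mu> + 1) * s * gam (\<mu> + 2) a x / (m + 2)
       + (m + 1) * real (dfact (nat (\<mu> - 1))) * (a powi \<mu> * a\<^sup>2) / ((m + 2) * real (dfact (nat \<mu>))) * l"
      using ev mu by (simp add: psi_def s_def m_def l_def p2 add.commute[of 1 \<mu>] flip: d[unfolded m_def])
    have 2: "psi \<mu> a x = x powi (\<mu> - 1) * s * gam \<mu> a x / m
       + real (dfact (nat (\<mu> - 1))) * a powi \<mu> / real (dfact (nat \<mu>)) * l"
      using ev mu by (simp add: psi_def s_def m_def l_def)
    have arith: "(X + (m + 1) * a2 * G) / (m + 2) + (m + 1) * D1 * (b * a2) / ((m + 2) * D2) * l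
      = (X + (m + 1) * a2 * (G + D1 * b / D2 * l)) / (m + 2)" if "D2 \<noteq> 0" for X a2 G D1 D2 b :: real
      using that m by (simp add: divide_simps) (simp add: algebra_simps)
    show ?thesis
      unfolding 1 2 main s_def[symmetric] m_def[symmetric] using m d0
      by (intro arith) auto
  qed
qed

text \<open>\<open>psi\<close> after the substitution \<open>x = sqrt (a\<^sup>2 + y\<^sup>2)\<close>, which makes it differentiable at \<open>x = a\<close>
  and extends it to an odd function of \<open>y\<close>.\<close>

fun Phi :: "real \<Rightarrow> nat \<Rightarrow> real \<Rightarrow> real" where
  "Phi a 0 y = ln ((sqrt (a\<^sup>2 + y\<^sup>2) + y) / a)"
| "Phi a (Suc 0) y = y"
| "Phi a (Suc (Suc k)) y = (sqrt (a\<^sup>2 + y\<^sup>2) ^ Suc k * y + (real k + 1) * a\<^sup>2 * Phi a k y) / (real k + 2)"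

lemma sqrt_plus_pos:
  assumes "a > (0::real)"
  shows "sqrt (a\<^sup>2 + y\<^sup>2) + y > 0"
proof -
  have "\<bar>y\<bar> < sqrt (a\<^sup>2 + y\<^sup>2)"
    using assms by (intro real_less_rsqrt) simp
  then show ?thesis by linarith
qed

lemma Phi_minus: 
  assumes "a > 0"
  shows "Phi a k (- y) = - Phi a k y"
  using assms
proof (induction a k y rule: Phi.induct)
  case (1 a y)
  define X where "X = sqrt (a\<^sup>2 + y\<^sup>2)"
  have pos: "X + y > 0" using sqrt_plus_pos[OF 1] by (simp add: X_def)
  have "X\<^sup>2 = a\<^sup>2 + y\<^sup>2" by (simp add: X_def)
  then have "(X - y) * (X + y) = a * a" by (simp add: power2_eq_square algebra_simps)
  then have "(X - y) / a = inverse ((X + y) / a)" using pos 1 by (simp add: field_simps)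
  then have "ln ((X - y) / a) = ln (inverse ((X + y) / a))" by (rule arg_cong)
  also have "\<dots> = - ln ((X + y) / a)" using pos 1 by (intro ln_inverse)
  finally have "ln ((X - y) / a) = - ln ((X + y) / a)" .
  then show ?case by (simp add: X_def)
qed (simp_all add: algebra_simps add_divide_distrib diff_divide_distrib)

text \<open>\<open>Phi a k y\<close> is thus the integral of (a^2 + t^2)^((k-1)/2) from 0 to y. With
  X' = y / X, the recursion is the integration by parts for X^(j+1) y. Unlike for
  \<open>psi\<close>, every real y is allowed.\<close>

lemma has_real_derivative_Phi:
  assumes a: "a > 0"
  shows "(Phi a k has_real_derivative sqrt (a\<^sup>2 + y\<^sup>2) powi (int k - 1)) (at y)"
proof -
  have pos: "a\<^sup>2 + y\<^sup>2 > 0" for y :: real using a by (simp add: add_pos_nonneg)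
  define X where "X y = sqrt (a\<^sup>2 + y\<^sup>2)" for y
  have X0: "X y > 0" and X2: "(X y)\<^sup>2 = a\<^sup>2 + y\<^sup>2" for y using pos[of y] by (simp_all add: X_def)
  have dX: "(X has_real_derivative y / X y) (at y)" for y
    unfolding X_def using pos[of y] by (auto intro!: derivative_eq_intros simp: field_simps)
  have "(Phi a k has_real_derivative X y powi (int k - 1)) (at y)" for y
  proof (induction k rule: less_induct)
    case (less k)
    consider "k = 0" | "k = 1" | j where "k = Suc (Suc j)" by (metis One_nat_def not0_implies_Suc)
    then show ?case
    proof cases
      case 1
      have p: "X y + y > 0" using sqrt_plus_pos[OF a] by (simp add: X_def)
      have "((\<lambda>y. ln ((X y + y) / a)) has_real_derivative ((y / X y + 1) / a) * (1 / ((X y + y) / a))) (at y)"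
        using a p by (auto intro!: derivative_eq_intros dX)
      also have "((y / X y + 1) / a) * (1 / ((X y + y) / a)) = X y powi (int 0 - 1)"
      proof -
        have "y / X y + 1 = (X y + y) / X y" using X0[of y] by (simp add: field_simps)
        then show ?thesis using a p X0[of y] by (simp add: divide_simps power_int_minus)
      qed
      finally show ?thesis using 1 by (simp add: X_def[abs_def])
    next
      case 2
      have "Phi a (Suc 0) = (\<lambda>y. y)" by (rule ext) simp
      then show ?thesis using 2 by simp
    next
      case 3
      have "(Phi a j has_real_derivative X y powi (int j - 1)) (at y)"
        using less[of j] 3 by simp
      moreover have dXp: "((\<lambda>y. X y ^ Suc j) has_real_derivative real (Suc j) * (y / X y) * X y ^ j) (at y)"
        using DERIV_power[OF dX, of "Suc j" y] by (simp add: mult.assoc del: power_Suc of_nat_Suc)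
      ultimately have "((\<lambda>y. (X y ^ Suc j * y + (real j + 1) * a\<^sup>2 * Phi a j y) / (real j + 2)) has_real_derivative
        ((real (Suc j) * (y / X y) * X y ^ j) * y + 1 * X y ^ Suc j + (real j + 1) * a\<^sup>2 * X y powi (int j - 1)) / (real j + 2)) (at y)"
        by (intro DERIV_cdivide DERIV_add DERIV_mult DERIV_cmult dXp DERIV_ident)
      also have "(\<lambda>y. (X y ^ Suc j * y + (real j + 1) * a\<^sup>2 * Phi a j y) / (real j + 2)) = Phi a k"
        unfolding 3 X_def by (rule ext) simp
      also have "((real (Suc j) * (y / X y) * X y ^ j) * y + 1 * X y ^ Suc j + (real j + 1) * a\<^sup>2 * X y powi (int j - 1)) / (real j + 2)
         = X y powi (int k - 1)"
      proof -
        have 1: "X y powi (int j - 1) = X y ^ j / X y" 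
          using X0[of y] power_int_diff[of "X y" "int j" 1] by simp
        have 2: "X y powi (int k - 1) = X y ^ Suc j"
          unfolding 3 by (simp add: power_int_def nat_add_distrib)
        have "(real (Suc j) * (y / X y) * X y ^ j) * y + 1 * X y ^ Suc j + (real j + 1) * a\<^sup>2 * (X y ^ j / X y)
          = (real j + 1) * (a\<^sup>2 + y\<^sup>2) * (X y ^ j / X y) + X y ^ Suc j"
          by (simp add: power2_eq_square algebra_simps add_divide_distrib)
        also have "\<dots> = (real j + 2) * X y ^ Suc j"
          unfolding X2[symmetric] using X0[of y] by (simp add: power2_eq_square algebra_simps)
        finally show ?thesis unfolding 1 2 by simp
      qed
      finally show ?thesis .
    qed
  qed
  then show ?thesis by (simp add: X_def)
qed

lemma psi_eq_Phi:
  assumes a: "a > 0" and x: "x \<ge> a"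
  shows "psi (int k) a x = Phi a k (sqrt (x\<^sup>2 - a\<^sup>2))"
proof -
  have "a\<^sup>2 \<le> x\<^sup>2" using a x by (intro power_mono) auto
  then have X: "sqrt (a\<^sup>2 + (sqrt (x\<^sup>2 - a\<^sup>2))\<^sup>2) = x" using a x by simp
  show ?thesis
  proof (induction k rule: less_induct)
    case (less k)
    consider "k = 0" | "k = 1" | j where "k = Suc (Suc j)" by (metis One_nat_def not0_implies_Suc)
    then show ?case
    proof cases
      case 1
      then show ?thesis using X by (simp add: psi_def)
    next
      case 2
      then show ?thesis by (simp add: psi_def gam_def)
    next
      case 3
      have k: "int k = int j + 2" using 3 by simp
      have "x powi (int j + 1) = x ^ Suc j" by (simp add: power_int_def nat_add_distrib)
      then show ?thesis
        unfolding k using less[of j] a x psi_rec[of "int j" a x] by (simp add: 3 X add.commute)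
    qed
  qed
qed

text \<open>x = a corresponds to y = 0, where the odd function \<open>Phi a k\<close>
  vanishes.\<close>

lemma psi_self: "a > 0 \<Longrightarrow> psi (int k) a a = 0"
proof -
  assume a: "a > 0"
  have "Phi a k 0 = 0" using Phi_minus[OF a, of k 0] by simp
  then show ?thesis using psi_eq_Phi[OF a, of a k] by simp
qed

text \<open>The mean of the k-th power of the distance from a point to a segment of length
  \<open>l\<close> (for l > 0): \<open>a\<close> is the height over its line and \<open>b\<close>
  the start of the segment measured from the foot. The foot may lie inside the segment.\<close>

lemma integral_Phi:
  assumes a: "a > 0"
  shows "l * integral {0..1} (\<lambda>w. sqrt (a\<^sup>2 + (l * w + b)\<^sup>2) ^ k) = Phi a (Suc k) (l + b) - Phi a (Suc k) b"
proof -
  have "((\<lambda>w. l * sqrt (a\<^sup>2 + (l * w + b)\<^sup>2) ^ k) has_integral (Phi a (Suc k) (l * 1 + b) - Phi a (Suc k) (l * 0 + b))) {0..1}"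
  proof (rule FTC_real)
    fix w :: real
    have "((\<lambda>w. l * w + b) has_real_derivative l) (at w)" by (auto intro!: derivative_eq_intros)
    from DERIV_chain'[OF this has_real_derivative_Phi[OF a, of "Suc k"]]
    show "((\<lambda>w. Phi a (Suc k) (l * w + b)) has_real_derivative l * sqrt (a\<^sup>2 + (l * w + b)\<^sup>2) ^ k) (at w)"
      by (simp add: mult.commute)
  qed
  from integral_unique[OF this] show ?thesis by simp
qed

context
  fixes q :: nat and h x :: real
  assumes q1: "q \<ge> 1" and h: "h > 0" and x: "x \<ge> h"
begin

lemma sigma_fn_eq: "sigma_fn (int q - 2 + 3) h x = (x ^ (q + 2) * arcsin (h / x) + h * psi (int (q + 1)) h x) / real (q + 2)"
proof -
  have "int q - 2 + 3 = int (q + 1)" "int (q + 1) + 1 = int (q + 2)" by simp_all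
  then show ?thesis using h by (simp only: sigma_fn_def power_int_of_nat of_int_of_nat_eq) simp
qed

text \<open>The lower index \<open>psi (q - 1)\<close> in \<open>tau_fn\<close> is eliminated by
  \<open>psi_rec\<close>, so that \<open>sigma_fn\<close> and \<open>tau_fn\<close> share the single
  transcendental term \<open>psi (q + 1)\<close>.\<close>

lemma tau_fn_eq: "tau_fn (int q - 2 + 1) h x = (x ^ q * sqrt (x\<^sup>2 - h\<^sup>2) - psi (int (q + 1)) h x) / real q"
proof -
  define s where "s = sqrt (x\<^sup>2 - h\<^sup>2)"
  define Q where "Q = real q"
  have Q: "Q \<ge> 1" using q1 by (simp add: Q_def)
  have e: "int q - 2 + 1 + 2 = int (q + 1)" "int q - 2 + 1 + 1 = int q" by simp_all
  have "psi (int q - 2 + 1 + 2) h x = (x powi (int q - 2 + 1 + 1) * s + (of_int (int q - 2 + 1) + 1) * h\<^sup>2 * psi (int q - 2 + 1) h x) / (of_int (int q - 2 + 1) + 2)"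
    unfolding s_def using q1 h x by (intro psi_rec) auto
  then have p: "psi (int (q + 1)) h x * (Q + 1) = x ^ q * s + Q * (h\<^sup>2 * psi (int q - 2 + 1) h x)"
    unfolding e using Q by (simp add: Q_def field_simps)
  have "tau_fn (int q - 2 + 1) h x = 1 / (Q + 1) * (x ^ q * s - h\<^sup>2 * psi (int q - 2 + 1) h x)"
    unfolding tau_fn_def e s_def using h by (simp add: Q_def)
  also have "h\<^sup>2 * psi (int q - 2 + 1) h x = (psi (int (q + 1)) h x * (Q + 1) - x ^ q * s) / Q"
    using p Q by (simp add: field_simps)
  also have "1 / (Q + 1) * (x ^ q * s - (psi (int (q + 1)) h x * (Q + 1) - x ^ q * s) / Q) = (x ^ q * s - psi (int (q + 1)) h x) / Q"
    using Q by (simp add: divide_simps) (simp add: algebra_simps)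
  finally show ?thesis by (simp only: s_def Q_def)
qed

end

subsection \<open>The regular pieces\<close>

text \<open>Coordinates along and perpendicular to edge k, seen from the vertex \<open>E 0\<close>:
  the first square is that of the height \<open>hh\<close>, the second contains the position
  measured from its foot. \<open>?y\<close> is the difference vector turned so that the edge is
  real.\<close>

lemma (in regular_chords) norm_Z_edge:
  "norm (Z k 0 w) = sqrt ((2 * r * sin (k * \<alpha>) * sin ((k + 1) * \<alpha>))\<^sup>2
     + (2 * r * sin \<alpha> * w + 2 * r * sin (k * \<alpha>) * cos ((k + 1) * \<alpha>))\<^sup>2)"
proof -
  let ?y = "of_real (2 * r * sin \<alpha> * w) + of_real (2 * r * sin (k * \<alpha>)) * cis (- ((k + 1) * \<alpha>))"
  have c: "cis (2 * \<alpha> * k) * cis \<alpha> = cis ((2 * k + 1) * \<alpha>)" "cis (k * \<alpha>) = cis ((2 * k + 1) * \<alpha>) * cis (- ((k + 1) * \<alpha>))"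
    by (simp_all add: cis_mult algebra_simps)
  have "of_real r * (cis (2 * \<alpha>) - 1) = of_real (2 * r * sin \<alpha>) * (\<i> * cis \<alpha>)"
    using chord_eq[of "2 * \<alpha>"] by simp
  then have "Z k 0 w = of_real (2 * r * sin (k * \<alpha>)) * (\<i> * cis (k * \<alpha>)) + of_real w * (cis (2 * \<alpha> * k) * (of_real (2 * r * sin \<alpha>) * (\<i> * cis \<alpha>)))"
    by (subst Z_affine) (simp only: Z_00, simp)
  also have "\<dots> = of_real (2 * r * sin (k * \<alpha>)) * (\<i> * cis (k * \<alpha>)) + of_real (2 * r * sin \<alpha> * w) * \<i> * (cis (2 * \<alpha> * k) * cis \<alpha>)"
    by simp
  also have "\<dots> = \<i> * (cis ((2 * k + 1) * \<alpha>) * ?y)"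
    unfolding c by (simp only: ring_distribs mult_ac add.commute)
  finally have "norm (Z k 0 w) = norm ?y"
    by (simp only: norm_mult norm_ii norm_cis mult_1_left)
  then show ?thesis by (simp add: cmod_def add.commute)
qed

lemma cot_double_diff:
  assumes "sin A \<noteq> 0" "cos A \<noteq> 0" "sin B \<noteq> 0" "cos (B::real) \<noteq> 0"
  shows "sin A * sin B * (cot (2 * A) - cot (2 * B)) = sin (B - A) * cos (B - A) / (2 * cos A * cos B)"
proof -
  define sA cA sB cB where sc: "sA = sin A" "cA = cos A" "sB = sin B" "cB = cos B"
  have c: "cot (2 * A) = (cA\<^sup>2 - sA\<^sup>2) / (2 * sA * cA)" "cot (2 * B) = (cB\<^sup>2 - sB\<^sup>2) / (2 * sB * cB)"
    by (simp_all add: cot_def sc cos_double sin_double)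
  have d: "sin (B - A) = sB * cA - cB * sA" "cos (B - A) = cB * cA + sB * sA"
    by (simp_all add: sc sin_diff cos_diff)
  show ?thesis
    using assms unfolding c d unfolding sc[symmetric]
    by (simp add: divide_simps) (simp add: power2_eq_square algebra_simps)
qed

lemma tan_diff_eq:
  assumes "cos A \<noteq> 0" "cos (B::real) \<noteq> 0"
  shows "tan A - tan B = - sin (B - A) / (cos A * cos B)"
  using assms by (simp add: tan_def sin_diff divide_simps)

context regular_ngon
begin

abbreviation \<alpha> where "\<alpha> \<equiv> alpha n"
abbreviation sn where "sn k \<equiv> sin (real k * \<alpha>)"
abbreviation cs where "cs k \<equiv> cos (real k * \<alpha>)"

lemmas \<alpha> = alpha_bounds[OF n3]

lemma ell_eq: "ell n r k = 2 * r * sn k" by (simp add: ell_def)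

lemma trig_pos:
  assumes "real (k + 1) * \<alpha> < pi / 2"
  shows "cs k > 0" "cs (Suc k) > 0" "sn (Suc k) > 0" "k \<ge> 1 \<Longrightarrow> sn k > 0"
proof -
  have "real k * \<alpha> \<le> real (k + 1) * \<alpha>" using \<alpha>(1) by (intro mult_right_mono) auto
  moreover have "real k * \<alpha> \<ge> 0" using \<alpha>(1) by simp
  moreover have "real (k + 1) * \<alpha> > 0" using \<alpha>(1) by simp
  ultimately have "cs k > 0" "cs (k + 1) > 0" "sn (k + 1) > 0"
    using assms pi_gt_zero by (intro cos_gt_zero_pi sin_gt_zero; linarith)+
  then show "cs k > 0" "cs (Suc k) > 0" "sn (Suc k) > 0" by simp_all
  assume "k \<ge> 1"
  then have "real k * \<alpha> > 0" using \<alpha>(1) by simp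
  then show "sn k > 0" using assms \<open>real k * \<alpha> \<le> _\<close> by (intro sin_gt_zero) linarith+
qed

text \<open>The triangle formed by vertex 0 and the k-th edge has sides \<open>ell n r k\<close> and
  \<open>ell n r (k + 1)\<close> and height \<open>hh n r k\<close>; the angles are inscribed
  angles. The bound is not strict because the last piece for even n has (k + 1) \<alpha> = pi /
  2.\<close>

lemma foot_coords:
  assumes "k \<ge> 1" "real (k + 1) * \<alpha> \<le> pi / 2"
  shows "hh n r k > 0" "hh n r k \<le> ell n r k" "hh n r k \<le> ell n r (k + 1)"
    "sqrt ((ell n r k)\<^sup>2 - (hh n r k)\<^sup>2) = ell n r k * cs (Suc k)"
    "sqrt ((ell n r (k + 1))\<^sup>2 - (hh n r k)\<^sup>2) = ell n r (k + 1) * cs k"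
    "arcsin (hh n r k / ell n r k) = real (k + 1) * \<alpha>"
    "arcsin (hh n r k / ell n r (k + 1)) = real k * \<alpha>"
    "ell n r k > 0" "ell n r (k + 1) > 0"
proof -
  have le: "real k * \<alpha> \<le> real (k + 1) * \<alpha>" using \<alpha>(1) by (intro mult_right_mono) auto
  have "0 < real k * \<alpha>" using \<alpha>(1) assms by simp
  then have b: "0 < real k * \<alpha>" "real k * \<alpha> \<le> pi / 2" "0 < real (k + 1) * \<alpha>"
    using assms(2) le by linarith+
  have s: "sn k > 0" "sn (k + 1) > 0"
    using b assms(2) pi_gt_zero by (intro sin_gt_zero; linarith)+
  have c: "cs k \<ge> 0" "cs (k + 1) \<ge> 0"
    using b assms(2) pi_gt_zero by (intro cos_ge_zero; linarith)+
  note e = ell_def hh_def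
  show "hh n r k > 0" "ell n r k > 0" "ell n r (k + 1) > 0"
    unfolding e using s r_pos by simp_all
  show "hh n r k \<le> ell n r k" "hh n r k \<le> ell n r (k + 1)"
    unfolding e using s r_pos by (simp_all add: mult_le_cancel_left1 mult_le_cancel_right1 mult_le_cancel_left2 mult_le_cancel_right2 mult.assoc)
  have "(ell n r k)\<^sup>2 - (hh n r k)\<^sup>2 = (ell n r k * cs (k + 1))\<^sup>2"
    unfolding e by (simp only: power_mult_distrib cos_squared_eq) (simp only: algebra_simps)
  then show "sqrt ((ell n r k)\<^sup>2 - (hh n r k)\<^sup>2) = ell n r k * cs (Suc k)"
    using s c r_pos by (simp add: ell_def)
  have "(ell n r (k + 1))\<^sup>2 - (hh n r k)\<^sup>2 = (ell n r (k + 1) * cs k)\<^sup>2"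
    unfolding e by (simp only: power_mult_distrib cos_squared_eq) (simp only: algebra_simps)
  then show "sqrt ((ell n r (k + 1))\<^sup>2 - (hh n r k)\<^sup>2) = ell n r (k + 1) * cs k"
    using s c r_pos by (simp add: ell_def)
  have "hh n r k / ell n r k = sn (k + 1)" "hh n r k / ell n r (k + 1) = sn k"
    unfolding e using s r_pos by simp_all
  then show "arcsin (hh n r k / ell n r k) = real (k + 1) * \<alpha>" "arcsin (hh n r k / ell n r (k + 1)) = real k * \<alpha>"
    using b assms(2) by (simp_all only:) (intro arcsin_sin; linarith)+
qed

lemma I_psi:
  assumes "k \<ge> 1" "real (k + 1) * \<alpha> \<le> pi / 2"
  shows "2 * r * sin \<alpha> * chords.I (real k)
    = psi (int (q + 1)) (hh n r k) (ell n r (k + 1)) - psi (int (q + 1)) (hh n r k) (ell n r k)"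
proof -
  note f = foot_coords[OF assms]
  have "2 * r * sin \<alpha> * chords.I (real k) = Phi (hh n r k) (Suc q) (2 * r * sin \<alpha> + ell n r k * cs (Suc k)) - Phi (hh n r k) (Suc q) (ell n r k * cs (Suc k))"
    unfolding integral_Phi[OF f(1), symmetric] chords.I_def chords.norm_Z_edge
    by (simp add: hh_def ell_def add.commute)
  also have "2 * r * sin \<alpha> + ell n r k * cs (Suc k) = ell n r (k + 1) * cs k"
  proof -
    have "\<alpha> = real (k + 1) * \<alpha> - real k * \<alpha>" by (simp add: algebra_simps)
    then have eq: "sin \<alpha> = sn (k + 1) * cs k - cs (k + 1) * sn k" by (metis sin_diff)
    show ?thesis unfolding eq ell_def by (simp add: algebra_simps)
  qed
  finally show ?thesis
    unfolding psi_eq_Phi[OF f(1,3)] psi_eq_Phi[OF f(1,2)] f(4,5) by simp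
qed

text \<open>The edge starts at the vertex from which it is seen, so the height is 0 and
  \<open>Phi\<close>, whose first argument must be positive, does not apply.\<close>

lemma I_0: "chords.I 0 = (2 * r * sin \<alpha>) ^ q / real (q + 1)"
proof -
  have s: "2 * r * sin \<alpha> > 0" using r_pos \<alpha>(3) by simp
  have "((\<lambda>w. (2 * r * sin \<alpha>) ^ q * w ^ q) has_integral ((2 * r * sin \<alpha>) ^ q * (1 ^ (q + 1) / real (q + 1)) - (2 * r * sin \<alpha>) ^ q * (0 ^ (q + 1) / real (q + 1)))) {0..1}"
  proof (rule FTC_real)
    fix x :: real
    have "((\<lambda>s. (2 * r * sin \<alpha>) ^ q * (s ^ (q + 1) / real (q + 1))) has_real_derivative (2 * r * sin \<alpha>) ^ q * (real (q + 1) * x ^ (q + 1 - Suc 0) / real (q + 1))) (at x)"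
      by (intro DERIV_cmult DERIV_cdivide DERIV_pow)
    then show "((\<lambda>s. (2 * r * sin \<alpha>) ^ q * (s ^ (q + 1) / real (q + 1))) has_real_derivative (2 * r * sin \<alpha>) ^ q * x ^ q) (at x)"
      by (simp del: of_nat_Suc)
  qed
  then have 1: "integral {0..1} (\<lambda>w. (2 * r * sin \<alpha>) ^ q * w ^ q) = (2 * r * sin \<alpha>) ^ q / real (q + 1)"
    by (subst integral_unique) auto
  have "chords.I 0 = integral {0..1} (\<lambda>w. (2 * r * sin \<alpha>) ^ q * w ^ q)"
    unfolding chords.I_def
  proof (rule integral_cong)
    fix w :: real assume "w \<in> {0..1}"
    then have "norm (chords.Z 0 0 w) = 2 * r * sin \<alpha> * w"
      using s unfolding chords.norm_Z_edge by simp
    then show "norm (chords.Z 0 0 w) ^ q = (2 * r * sin \<alpha>) ^ q * w ^ q"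
      by (simp only: power_mult_distrib)
  qed
  then show ?thesis by (simp only: 1)
qed

text \<open>Up to sign the two coefficients agree, so the \<open>psi\<close> terms of
  \<open>sigma_fn\<close> and \<open>tau_fn\<close> combine with factor g (1 / (q + 2) - 1 / q) = -2
  g / (q (q + 2)).\<close>

lemma H1_coeffs:
  assumes "k \<ge> 1" "real (k + 1) * \<alpha> < pi / 2" "n \<noteq> 3"
  defines "g \<equiv> r * sin \<alpha> * cos \<alpha> / (cs k * cs (Suc k))"
  shows "hh n r k * pp n k = g" "hh n r k * pp n k + 2 * r * qq n k * cos \<alpha> = - g"
proof -
  note t = trig_pos[OF assms(2)]
  have d: "real (k + 1) * \<alpha> - real k * \<alpha> = \<alpha>" by (simp add: algebra_simps)
  have "hh n r k * pp n k = 2 * r * (sn k * sn (k + 1) * (cot (2 * (real k * \<alpha>)) - cot (2 * (real (k + 1) * \<alpha>))))"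
    using assms(3) by (simp only: hh_def pp_def mult.assoc if_False)
  also have "\<dots> = g"
    using t assms(1) unfolding g_def by (subst cot_double_diff) (auto simp: d[simplified])
  finally show 1: "hh n r k * pp n k = g" .
  have "qq n k = - sin \<alpha> / (cs k * cs (k + 1))"
    using t unfolding qq_def by (subst tan_diff_eq) (auto simp: d[simplified])
  then show "hh n r k * pp n k + 2 * r * qq n k * cos \<alpha> = - g"
    unfolding 1 g_def by (simp add: algebra_simps)
qed

lemma powi_shift: "x powi (int q - 2 + 4) = x ^ (q + 2)" "real_of_int (int q - 2 + 4) = real q + 2"
  "x powi (int q - 2 + 3) = x ^ (q + 1)" "real_of_int (int q - 2 + 3) = real q + 1"
  "x powi (int q - 2 + 2) = x ^ q" "real_of_int (int q - 2 + 2) = real q"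
proof -
  have e: "int q - 2 + 4 = int (q + 2)" "int q - 2 + 3 = int (q + 1)" "int q - 2 + 2 = int q" by simp_all
  show "x powi (int q - 2 + 4) = x ^ (q + 2)" "real_of_int (int q - 2 + 4) = real q + 2"
  "x powi (int q - 2 + 3) = x ^ (q + 1)" "real_of_int (int q - 2 + 3) = real q + 1"
  "x powi (int q - 2 + 2) = x ^ q" "real_of_int (int q - 2 + 2) = real q"
    unfolding e power_int_of_nat by simp_all
qed

lemma Q: "real q \<ge> 1" using q1 by simp

lemma H1_eq:
  assumes "k \<ge> 1" "real (k + 1) * \<alpha> < pi / 2" "n \<noteq> 3" and x: "x \<ge> hh n r k"
  shows "H1 n r (int q - 2) k x = (pp n k * arcsin (hh n r k / x) - real k * \<alpha> * cot (2 * real k * \<alpha>)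
        + real (k + 1) * \<alpha> * cot (2 * real (k + 1) * \<alpha>)) * x ^ (q + 2) / (real q + 2)
     + r * sin \<alpha> * cos \<alpha> / (cs k * cs (Suc k)) * (x ^ q * sqrt (x\<^sup>2 - (hh n r k)\<^sup>2) / real q
       - 2 / (real q * (real q + 2)) * psi (int (q + 1)) (hh n r k) x)"
proof -
  note h = foot_coords(1)[OF assms(1) less_imp_le[OF assms(2)]]
  define g where "g = r * sin \<alpha> * cos \<alpha> / (cs k * cs (Suc k))"
  note c = H1_coeffs[OF assms(1-3), folded g_def]
  define p where "p = psi (int (q + 1)) (hh n r k) x"
  define y where "y = sqrt (x\<^sup>2 - (hh n r k)\<^sup>2)"
  define X where "X = x ^ q"
  have "H1 n r (int q - 2) k x = pp n k * ((x ^ (q + 2) * arcsin (hh n r k / x) + hh n r k * p) / (real q + 2))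
     - (real k * \<alpha> * cot (2 * real k * \<alpha>) - real (k + 1) * \<alpha> * cot (2 * real (k + 1) * \<alpha>)) * (x ^ (q + 2) / (real q + 2))
     - (- g) * ((X * y - p) / real q)"
    unfolding H1_def sigma_fn_eq[OF q1 h x] tau_fn_eq[OF q1 h x] powi_shift c(2) p_def y_def X_def by (simp add: add.commute)
  also have "\<dots> = (pp n k * arcsin (hh n r k / x) - real k * \<alpha> * cot (2 * real k * \<alpha>)
        + real (k + 1) * \<alpha> * cot (2 * real (k + 1) * \<alpha>)) * x ^ (q + 2) / (real q + 2)
      + g * (X * y / real q - 2 / (real q * (real q + 2)) * p)"
  proof -
    have "b * ((x2 * th + h * p) / (Q + 2)) - (c1 - c2) * (x2 / (Q + 2)) - (- (h * b)) * ((X * y - p) / Q)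
      = (b * th - c1 + c2) * x2 / (Q + 2) + h * b * (X * y / Q - 2 / (Q * (Q + 2)) * p)"
      if "Q > 0" for b x2 th h Q c1 c2 :: real
      using that by (simp add: divide_simps) (simp add: algebra_simps)
    then show ?thesis unfolding c(1)[symmetric] using Q by simp
  qed
  finally show ?thesis by (simp only: g_def p_def y_def X_def)
qed

text \<open>The telescoping part and the weight of \<open>I k\<close> in the \<open>k\<close>-th piece.\<close>

definition T :: "nat \<Rightarrow> real" where
  "T k = \<alpha> * cot (2 * real k * \<alpha>) * ell n r k ^ (q + 2) / (real q + 2)
     + r * sin \<alpha> * cos \<alpha> * ell n r k ^ (q + 1) / (real q * cs k)"

definition w :: "nat \<Rightarrow> real" where
  "w k = cos \<alpha> / (cs k * cs (Suc k))"

text \<open>At the two ends the arcsine takes the values k \<alpha> and (k + 1) \<alpha>. This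
  collapses the coefficient of the pure power to \<alpha> times one cotangent, so that the upper end
  of one piece and the lower end of the next are the same function \<open>T\<close>; only the
  \<open>psi\<close> difference, hence \<open>I k\<close>, is left.\<close>

lemma H1_diff:
  assumes "k \<ge> 1" "real (k + 1) * \<alpha> < pi / 2" "n \<noteq> 3"
  shows "H1 n r (int q - 2) k (ell n r (k + 1)) - H1 n r (int q - 2) k (ell n r k)
    = T (Suc k) - T k - (2 * r * sin \<alpha>)\<^sup>2 * w k / (real q * (real q + 2)) * chords.I (real k)"
proof -
  have le: "real (k + 1) * \<alpha> \<le> pi / 2" using assms by simp
  note f = foot_coords[OF assms(1) le]
  note t = trig_pos[OF assms(2)]
  let ?p = "\<lambda>x. psi (int (q + 1)) (hh n r k) x"
  let ?g = "r * sin \<alpha> * cos \<alpha> / (cs k * cs (Suc k))"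
  have pp: "pp n k = cot (2 * real k * \<alpha>) - cot (2 * real (k + 1) * \<alpha>)" using assms(3) by (simp add: pp_def)
  have u: "H1 n r (int q - 2) k (ell n r (k + 1)) = T (Suc k) - ?g * (2 / (real q * (real q + 2)) * ?p (ell n r (k + 1)))"
  proof -
    have "pp n k * (real k * \<alpha>) - real k * \<alpha> * cot (2 * real k * \<alpha>) + real (k + 1) * \<alpha> * cot (2 * real (k + 1) * \<alpha>)
      = \<alpha> * cot (2 * real (Suc k) * \<alpha>)"
      unfolding pp by (simp add: algebra_simps)
    moreover have "?g * (ell n r (k + 1) ^ q * (ell n r (k + 1) * cs k) / real q) = r * sin \<alpha> * cos \<alpha> * ell n r (Suc k) ^ (q + 1) / (real q * cs (Suc k))"
      using t by (simp add: divide_simps)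
    ultimately show ?thesis
      unfolding H1_eq[OF assms f(3)] f T_def right_diff_distrib by simp
  qed
  have l: "H1 n r (int q - 2) k (ell n r k) = T k - ?g * (2 / (real q * (real q + 2)) * ?p (ell n r k))"
  proof -
    have "pp n k * (real (k + 1) * \<alpha>) - real k * \<alpha> * cot (2 * real k * \<alpha>) + real (k + 1) * \<alpha> * cot (2 * real (k + 1) * \<alpha>)
      = \<alpha> * cot (2 * real k * \<alpha>)"
      unfolding pp by (simp add: algebra_simps)
    moreover have "?g * (ell n r k ^ q * (ell n r k * cs (Suc k)) / real q) = r * sin \<alpha> * cos \<alpha> * ell n r k ^ (q + 1) / (real q * cs k)"
      using t by (simp add: divide_simps)
    ultimately show ?thesis
      unfolding H1_eq[OF assms f(2)] f T_def right_diff_distrib by simp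
  qed
  have "?g * (2 / (real q * (real q + 2)) * ?p (ell n r (k + 1))) - ?g * (2 / (real q * (real q + 2)) * ?p (ell n r k))
    = ?g * (2 / (real q * (real q + 2))) * (2 * r * sin \<alpha> * chords.I (real k))"
    unfolding I_psi[OF assms(1) le] by (simp only: algebra_simps)
  also have "\<dots> = (2 * r * sin \<alpha>)\<^sup>2 * w k / (real q * (real q + 2)) * chords.I (real k)"
    by (simp add: w_def power2_eq_square)
  finally show ?thesis unfolding u l by linarith
qed

text \<open>\<open>cot 0\<close> is a default value, multiplied here by a positive power of
  \<open>ell n r 0\<close> = 0.\<close>

lemma T_0: "T 0 = 0"
  by (simp add: T_def ell_def)

lemma ell_1: "ell n r 1 = 2 * r * sin \<alpha>" by (simp add: ell_def)

text \<open>The first piece fits the pattern of \<open>H1_diff\<close>, with \<open>w 0\<close> = 1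
  and \<open>T 0\<close> = 0, thanks to tan \<alpha> - cot \<alpha> = -2 cot (2 \<alpha>).\<close>

lemma H0_ell_1:
  "H0 n r (int q - 2) (ell n r 1) = T 1 - (2 * r * sin \<alpha>)\<^sup>2 * w 0 / (real q * (real q + 2)) * chords.I 0"
proof -
  define s where "s = ell n r 1"
  have tc: "tan \<alpha> - cot \<alpha> = - 2 * cot (2 * \<alpha>)"
    using \<alpha>(3,4) by (simp add: tan_def cot_def cos_double sin_double divide_simps power2_eq_square)
  have w0: "w 0 = 1" using \<alpha>(4) by (simp add: w_def)
  have T1: "T 1 = \<alpha> * cot (2 * \<alpha>) * s ^ (q + 2) / (real q + 2) + s ^ (q + 2) / (2 * real q)"
    using \<alpha>(4) by (simp add: T_def s_def ell_def)
  have H: "H0 n r (int q - 2) s = s ^ (q + 2) / (real q + 1) - (1 - 2 * \<alpha> * cot (2 * \<alpha>)) * s ^ (q + 2) / (2 * (real q + 2))"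
    unfolding H0_def tc powi_shift s_def[symmetric] by simp
  have "s\<^sup>2 * (s ^ q / real (q + 1)) = s ^ (q + 2) / (real q + 1)"
    by (simp add: power_add power2_eq_square add.commute)
  then have "s\<^sup>2 * w 0 / (real q * (real q + 2)) * (s ^ q / real (q + 1)) = s ^ (q + 2) / (real q + 1) / (real q * (real q + 2))"
    unfolding w0 by (simp add: field_simps)
  moreover have "X / (Q + 1) - (1 - 2 * c) * X / (2 * (Q + 2)) = c * X / (Q + 2) + X / (2 * Q) - X / (Q + 1) / (Q * (Q + 2))"
    if "Q > 0" for X Q c :: real
    using that by (simp add: divide_simps) (simp add: algebra_simps)
  from this[of "real q" "s ^ (q + 2)" "\<alpha> * cot (2 * \<alpha>)"]
  have "s ^ (q + 2) / (real q + 1) - (1 - 2 * \<alpha> * cot (2 * \<alpha>)) * s ^ (q + 2) / (2 * (real q + 2))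
    = T 1 - s ^ (q + 2) / (real q + 1) / (real q * (real q + 2))"
    unfolding T1 using Q by (simp add: mult.assoc)
  ultimately show ?thesis
    unfolding I_0 ell_1[symmetric] s_def[symmetric] H by simp
qed

end

subsection \<open>The last piece and summation\<close>

context regular_ngon
begin

text \<open>The value of the k-th piece when \<open>ell n r (k + 1)\<close> is below
  \<open>lam\<close>. For odd n it is also formed for the last k, beyond \<open>lam\<close>, where
  \<open>D\<close> supplies the correction.\<close>

definition R :: "nat \<Rightarrow> real" where
  "R k = (if k = 0 then H0 n r (int q - 2) (ell n r 1)
     else H1 n r (int q - 2) k (ell n r (k + 1)) - H1 n r (int q - 2) k (ell n r k))"

lemma sum_R:
  assumes "real K * \<alpha> < pi / 2" "n \<noteq> 3 \<or> K \<le> 1"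
  shows "(\<Sum>k<K. R k) = T K - (2 * r * sin \<alpha>)\<^sup>2 / (real q * (real q + 2)) * (\<Sum>k<K. w k * chords.I (real k))"
  using assms
proof (induction K)
  case 0
  then show ?case by (simp add: T_0)
next
  case (Suc K)
  have "real K * \<alpha> \<le> real (Suc K) * \<alpha>" using \<alpha>(1) by (intro mult_right_mono) auto
  then have IH: "(\<Sum>k<K. R k) = T K - (2 * r * sin \<alpha>)\<^sup>2 / (real q * (real q + 2)) * (\<Sum>k<K. w k * chords.I (real k))"
    using Suc by (intro Suc.IH) auto
  have "R K = T (Suc K) - T K - (2 * r * sin \<alpha>)\<^sup>2 / (real q * (real q + 2)) * (w K * chords.I (real K))"
  proof (cases "K = 0")
    case True
    then show ?thesis using H0_ell_1 by (simp add: R_def T_0)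
  next
    case False
    then show ?thesis using H1_diff[of K] Suc.prems by (simp add: R_def)
  qed
  then show ?case by (simp add: IH distrib_left)
qed

text \<open>\<open>C d\<close> contributes to \<open>I d\<close> and \<open>I (d - 1)\<close>, so
  each \<open>I k\<close> with k < K collects two terms, from \<open>C k\<close> and
  \<open>C (k + 1)\<close>, while \<open>I K\<close> has only one so far. For k = 0 the first term
  comes from \<open>C 0\<close>, which fits since \<open>u_star 0\<close> = 1 / 2.\<close>

lemma sum_cos_C:
  assumes "real K * \<alpha> < pi / 2"
  shows "(real q + 2) * (chords.C 0 + 2 * (\<Sum>d=1..K. cos (2 * \<alpha> * real d) * chords.C (real d)))
    = 2 * (\<Sum>k<K. w k * chords.I (real k)) + 4 * cos (2 * \<alpha> * real K) * chords.u_star (real K) * chords.I (real K)"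
  using assms
proof (induction K)
  case 0
  have "chords.u_star 0 = 1 / 2" using \<alpha>(3) by (simp add: chords.u_star_def)
  moreover have "(real q + 2) * chords.C 0 = 2 * chords.I 0"
    using C_0 unfolding I_0 by (simp add: field_simps)
  ultimately show ?case by simp
next
  case (Suc K)
  have le: "real K * \<alpha> \<le> real (Suc K) * \<alpha>" using \<alpha>(1) by (intro mult_right_mono) auto
  then have "real K * \<alpha> < pi / 2" using Suc.prems by linarith
  note IH = Suc.IH[OF this]
  have t: "cs K > 0" "cs (Suc K) > 0" "sn (Suc K) > 0" using trig_pos[of K] Suc.prems by simp_all
  define A B where AB: "A = real K * \<alpha>" "B = real (Suc K) * \<alpha>"
  have BA: "\<alpha> = B - A" by (simp add: AB algebra_simps)
  define I1 where "I1 = chords.I (real (Suc K))"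
  define I0 where "I0 = chords.I (real K)"
  define u1 where "u1 = chords.u_star (real (Suc K))"
  define u0 where "u0 = chords.u_star (real K)"
  have C: "(real q + 2) * chords.C (real (Suc K)) = 2 * u1 * I1 + 2 * (1 - u1) * I0"
    using chords.C_nonparallel[of "real (Suc K)"] t by (simp add: I1_def I0_def u1_def add.commute)
  have u0: "u0 = sin B / (2 * sin \<alpha> * cos A)"
    by (simp add: u0_def chords.u_star_def AB add.commute)
  have u1: "1 - u1 = - sin A / (2 * sin \<alpha> * cos B)"
  proof -
    have "u1 = sin (B + \<alpha>) / (2 * sin \<alpha> * cos B)"
      by (simp add: u1_def chords.u_star_def AB algebra_simps)
    also have "sin (B + \<alpha>) = 2 * sin \<alpha> * cos B + sin A"
    proof -
      have "A = B - \<alpha>" by (simp add: BA)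
      then show ?thesis by (simp add: sin_add sin_diff)
    qed
    finally show ?thesis using t \<alpha>(3) by (simp add: AB field_simps)
  qed
  \<comment> \<open>The two contributions to \<open>I K\<close> combine to the weight found in the
    pieces of the formula; this is where both sides of the theorem meet.\<close>
  have coef: "4 * cos (2 * A) * u0 + 4 * cos (2 * B) * (1 - u1) = 2 * w K"
  proof -
    have "4 * cos (2 * A) * u0 + 4 * cos (2 * B) * (1 - u1)
      = 2 * (cos (2 * A) * (sin B * cos B) - cos (2 * B) * (sin A * cos A)) / (sin \<alpha> * (cos A * cos B))"
      unfolding u0 u1 using t[folded AB] \<alpha>(3) by (simp add: divide_simps)
    also have "cos (2 * A) * (sin B * cos B) - cos (2 * B) * (sin A * cos A) = sin (B - A) * cos (B - A)"
      unfolding cos_double sin_diff cos_diff by (simp add: power2_eq_square algebra_simps)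
    finally show ?thesis using \<alpha>(3) unfolding w_def AB[symmetric] BA[symmetric] by simp
  qed
  have "(real q + 2) * (chords.C 0 + 2 * (\<Sum>d=1..Suc K. cos (2 * \<alpha> * real d) * chords.C (real d)))
    = (real q + 2) * (chords.C 0 + 2 * (\<Sum>d=1..K. cos (2 * \<alpha> * real d) * chords.C (real d)))
      + 2 * cos (2 * B) * ((real q + 2) * chords.C (real (Suc K)))"
    by (simp add: AB algebra_simps)
  also have "\<dots> = 2 * (\<Sum>k<K. w k * chords.I (real k)) + (4 * cos (2 * A) * u0 + 4 * cos (2 * B) * (1 - u1)) * I0
      + 4 * cos (2 * B) * u1 * I1"
    unfolding IH C I0_def[symmetric] u0_def[symmetric] by (simp add: AB algebra_simps)
  also have "\<dots> = 2 * (\<Sum>k<Suc K. w k * chords.I (real k)) + 4 * cos (2 * \<alpha> * real (Suc K)) * u1 * I1"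
    unfolding coef I0_def by (simp add: AB algebra_simps)
  finally show ?case by (simp add: u1_def I1_def)
qed

definition moment_sum :: real where
  "moment_sum = (\<Sum>d<n. cos (2 * \<alpha> * real d) * chords.C (real d))"

lemma moment_sum_reflect:
  assumes "d \<le> n"
  shows "cos (2 * \<alpha> * real (n - d)) * chords.C (real (n - d)) = cos (2 * \<alpha> * real d) * chords.C (real d)"
proof -
  have 1: "real (n - d) = - real d + real n" using assms by simp
  have "cos (2 * \<alpha> * (- real d + real n)) = cos (2 * \<alpha> * (- real d))"
    using cis_alpha_period[of "- real d"] by (simp add: complex_eq_iff)
  then show ?thesis unfolding 1 C_period chords.C_neg by simp
qed

lemma sum_fold:
  fixes f :: "nat \<Rightarrow> real"
  assumes "\<And>d. d \<le> n \<Longrightarrow> f (n - d) = f d" and M: "n = 2 * M + 1 \<or> n = 2 * M + 2"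
  shows "(\<Sum>d<n. f d) = f 0 + 2 * (\<Sum>d=1..M. f d) + (if even n then f (M + 1) else 0)"
proof -
  have "(\<Sum>d=n-M..n-1. f d) = (\<Sum>d=1..M. f d)"
    by (rule sum.reindex_bij_witness[of _ "\<lambda>d. n - d" "\<lambda>d. n - d"]) (use M assms(1) in auto)
  moreover have "{..<n} = {0} \<union> {1..M} \<union> (if even n then {M + 1} else {}) \<union> {n-M..n-1}"
    using M by auto
  moreover have "sum f ({0} \<union> {1..M} \<union> (if even n then {M + 1} else {}) \<union> {n-M..n-1})
    = f 0 + (\<Sum>d=1..M. f d) + (if even n then f (M + 1) else 0) + (\<Sum>d=n-M..n-1. f d)"
    using M by (subst sum.union_disjoint | auto)+
  ultimately show ?thesis by simp
qed

section \<open>Even n: the side parallel to the first one\<close>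

lemma even_end:
  assumes n: "n = 2 * K + 2"
  shows "T K + (H2 n r (int q - 2) K (ell n r (K + 1)) - H2 n r (int q - 2) K (ell n r K))
    = - ((2 * r) ^ (q + 2) - (2 * r * cos \<alpha>) ^ (q + 2)) / (real q * (real q + 2))
      + 2 * r\<^sup>2 * (1 / real q - cos (2 * \<alpha>) / (real q + 2)) * chords.I (real K)"
proof -
  have K1: "K \<ge> 1" using n n3 by simp
  have KM: "real (K + 1) * \<alpha> = pi / 2" using \<alpha>(5) n by (simp add: field_simps)
  have le: "real (K + 1) * \<alpha> \<le> pi / 2" using KM by simp
  have Ka: "real K * \<alpha> = pi / 2 - \<alpha>" using KM by (simp add: algebra_simps)
  define s where "s = sin \<alpha>"
  define c where "c = cos \<alpha>"
  have s: "s > 0" and c: "c > 0" and sc: "s\<^sup>2 + c\<^sup>2 = 1" using \<alpha>(3,4) by (simp_all add: s_def c_def)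
  have snK: "sn K = c" and csK: "cs K = s" unfolding Ka by (simp_all add: s_def c_def sin_diff cos_diff)
  have snM: "sn (K + 1) = 1" and csM: "cs (Suc K) = 0" by (simp_all only: Suc_eq_plus1 KM sin_pi_half cos_pi_half)
  have l1: "ell n r (K + 1) = 2 * r" unfolding ell_eq snM by simp
  have l0: "ell n r K = 2 * r * c" unfolding ell_eq snK by simp
  \<comment> \<open>The height equals \<open>ell n r K\<close>, the distance of two opposite sides,
    since the angle at vertex K is right. The last piece therefore starts where the square root
    vanishes.\<close>
  have h: "hh n r K = 2 * r * c" using snM snK by (simp add: hh_def)
  define ct where "ct = cot (2 * real K * \<alpha>)"
  have "2 * real K * \<alpha> = pi - 2 * \<alpha>" using Ka by simp
  then have "ct = - cos (2 * \<alpha>) / sin (2 * \<alpha>)"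
    unfolding ct_def cot_def by (simp add: sin_diff cos_diff)
  then have ct: "ct = (s\<^sup>2 - c\<^sup>2) / (2 * s * c)"
    by (simp add: cos_double sin_double s_def c_def)
  have tn: "tan (real K * \<alpha>) = c / s" unfolding tan_def snK csK ..
  note f = foot_coords[OF K1 le]
  define Q where "Q = real q"
  have Q: "Q > 0" using q1 by (simp add: Q_def)
  define p1 where "p1 = psi (int (q + 1)) (2 * r * c) (2 * r)"
  define p0 where "p0 = psi (int (q + 1)) (2 * r * c) (2 * r * c)"
  define g where "g = 2 * r * c * ct + 2 * r * c * (c / s)"
  have g: "g = r / s"
    unfolding g_def ct using s c sc by (simp add: divide_simps) algebra
  \<comment> \<open>The summand of \<open>H2\<close> with exponent m + 2 drops out because its
    factor \<open>hh n r K - 2 * r * cos \<alpha>\<close> is 0.\<close>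
  have gen: "H2 n r (int q - 2) K x = (1 / 2 - real K * \<alpha> * ct) * (x ^ (q + 2) / (Q + 2))
      + ct * ((x ^ (q + 2) * arcsin (2 * r * c / x) + 2 * r * c * psi (int (q + 1)) (2 * r * c) x) / (Q + 2))
      - (r / s) * ((x ^ q * sqrt (x\<^sup>2 - (2 * r * c)\<^sup>2) - psi (int (q + 1)) (2 * r * c) x) / Q)"
    if "x \<ge> hh n r K" for x
    unfolding H2_def sigma_fn_eq[OF q1 f(1) that] tau_fn_eq[OF q1 f(1) that] powi_shift
    unfolding h tn ct_def[symmetric] c_def[symmetric] g_def[symmetric] g by (simp add: Q_def)
  have e1: "H2 n r (int q - 2) K (2 * r) = (2 * r) ^ (q + 2) / (2 * (Q + 2)) + ct * (2 * r * c * p1) / (Q + 2)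
      - (r / s) * (((2 * r) ^ q * (2 * r * s) - p1) / Q)"
  proof -
    have a: "arcsin (2 * r * c / (2 * r)) = real K * \<alpha>" using f(7) unfolding h l1 .
    have b: "sqrt ((2 * r)\<^sup>2 - (2 * r * c)\<^sup>2) = 2 * r * s" using f(5) unfolding h l1 csK .
    have le: "hh n r K \<le> 2 * r" using f(3) unfolding l1 .
    show ?thesis
      unfolding gen[OF le] a b p1_def[symmetric] using Q
      by (simp add: divide_simps) (simp add: algebra_simps)
  qed
  have e0: "H2 n r (int q - 2) K (2 * r * c) = (1 / 2 + \<alpha> * ct) * (2 * r * c) ^ (q + 2) / (Q + 2) + ct * (2 * r * c * p0) / (Q + 2)
      - (r / s) * ((0 - p0) / Q)"
  proof -
    have a: "arcsin (2 * r * c / (2 * r * c)) = real (K + 1) * \<alpha>" using f(6) unfolding h l0 .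
    have b: "sqrt ((2 * r * c)\<^sup>2 - (2 * r * c)\<^sup>2) = 0" by simp
    have le: "hh n r K \<le> 2 * r * c" unfolding h by simp
    show ?thesis
      unfolding gen[OF le] a b p0_def[symmetric] using Q
      by (simp add: divide_simps) (simp add: algebra_simps)
  qed
  have pI: "p1 = p0 + 2 * r * s * chords.I (real K)"
    using I_psi[OF K1 le] unfolding h l1 l0 p1_def p0_def s_def by simp
  have TK: "T K = \<alpha> * ct * (2 * r * c) ^ (q + 2) / (Q + 2) + (2 * r * c) ^ (q + 2) / (2 * Q)"
    unfolding T_def l0 csK ct_def Q_def s_def[symmetric] c_def[symmetric] using s by simp
  have c2: "cos (2 * \<alpha>) = c\<^sup>2 - s\<^sup>2" by (simp add: cos_double s_def c_def)
  have lp: "(2 * r) ^ q * (2 * r * s) = s / r * (2 * r) ^ (q + 2) / 2" using r_pos by (simp add: field_simps)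
  have arith: "\<alpha> * ct * X0 / (Q + 2) + X0 / (2 * Q) + ((X1 / (2 * (Q + 2)) + ct * (2 * r * c * (p0 + 2 * r * s * J)) / (Q + 2)
      - (r / s) * ((s / r * X1 / 2 - (p0 + 2 * r * s * J)) / Q)) - ((1 / 2 + \<alpha> * ct) * X0 / (Q + 2) + ct * (2 * r * c * p0) / (Q + 2)
      - (r / s) * ((0 - p0) / Q)))
    = - (X1 - X0) / (Q * (Q + 2)) + 2 * r\<^sup>2 * (1 / Q - (c\<^sup>2 - s\<^sup>2) / (Q + 2)) * J" for X0 X1 J
  proof -
    define V where "V = (r / s) * ((0 - p0) / Q)"
    define U where "U = ct * (2 * r * c * p0)"
    have 1: "ct * (2 * r * c * (p0 + 2 * r * s * J)) = U + 2 * r\<^sup>2 * (s\<^sup>2 - c\<^sup>2) * J"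
      unfolding ct U_def using s c by (simp add: field_simps power2_eq_square)
    have 2: "(r / s) * ((s / r * X1 / 2 - (p0 + 2 * r * s * J)) / Q) = (X1 / 2 - 2 * r\<^sup>2 * J) / Q + V"
      unfolding V_def using s r_pos Q by (simp add: field_simps power2_eq_square)
    show ?thesis
      unfolding 1 2 U_def[symmetric] V_def[symmetric] using Q
      by (simp add: divide_simps) (simp add: algebra_simps)
  qed
  show ?thesis
    unfolding l1 l0 e1 e0 TK pI lp c2 Q_def[symmetric] unfolding c_def[symmetric] by (rule arith)
qed

text \<open>The middle term of \<open>moment_sum\<close> belongs to parallel sides and comes from
  \<open>C_opposite\<close>; its difference of powers is the one left over in
  \<open>even_end\<close>.\<close>

lemma even_case:
  assumes n: "n = 2 * K + 2"
  shows "real q * 2 * ((\<Sum>k<K. R k) + (H2 n r (int q - 2) K (ell n r (K + 1)) - H2 n r (int q - 2) K (ell n r K)))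
    = - (2 * r * sin \<alpha>)\<^sup>2 * moment_sum"
proof -
  have KM: "real (K + 1) * \<alpha> = pi / 2" using \<alpha>(5) n by (simp add: field_simps)
  then have Ka: "real K * \<alpha> = pi / 2 - \<alpha>" by (simp add: algebra_simps)
  then have lt: "real K * \<alpha> < pi / 2" using \<alpha>(1) by simp
  define J where "J = chords.I (real K)"
  define W where "W = (\<Sum>k<K. w k * chords.I (real k))"
  define \<Delta> where "\<Delta> = (2 * r) ^ (q + 2) - (2 * r * cos \<alpha>) ^ (q + 2)"
  define s where "s = sin \<alpha>"
  define Q where "Q = real q"
  define c2 where "c2 = cos (2 * \<alpha>)"
  have s: "s > 0" using \<alpha>(3) by (simp add: s_def)
  have Q: "Q > 0" using q1 by (simp add: Q_def)
  have c2: "c2 = 1 - 2 * s\<^sup>2" by (simp add: c2_def s_def cos_double_sin)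
  have S: "(\<Sum>k<K. R k) + (H2 n r (int q - 2) K (ell n r (K + 1)) - H2 n r (int q - 2) K (ell n r K))
    = - \<Delta> / (Q * (Q + 2)) + 2 * r\<^sup>2 * (1 / Q - c2 / (Q + 2)) * J - (2 * r * s)\<^sup>2 / (Q * (Q + 2)) * W"
    using sum_R[OF lt] even_end[OF n] n by (simp add: J_def W_def \<Delta>_def s_def Q_def c2_def)
  \<comment> \<open>Modulo n = 2 K + 2, the edge K + 1 is the edge -1 - K, the mirror image of edge
    K.\<close>
  have IM: "chords.I (real (K + 1)) = J"
  proof -
    have "real (K + 1) = (- 1 - real K) + real n" using n by simp
    then show ?thesis by (simp only: I_period chords.I_reflect J_def)
  qed
  have opp: "chords.C (real (K + 1)) = 2 * J - 2 * \<Delta> / ((Q + 2) * (2 * r * s)\<^sup>2)"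
  proof -
    have "2 * (real (K + 1) * \<alpha>) = pi" unfolding KM by simp
    then have "2 * real (K + 1) * \<alpha> = pi" by (simp only: mult.assoc)
    from chords.C_opposite[OF this less_imp_le[OF \<alpha>(4)]] show ?thesis
      unfolding IM by (simp only: \<Delta>_def Q_def s_def of_nat_add of_nat_numeral)
  qed
  have ev: "even n" using n by simp
  have ms: "moment_sum = (chords.C 0 + 2 * (\<Sum>d=1..K. cos (2 * \<alpha> * real d) * chords.C (real d))) - chords.C (real (K + 1))"
  proof -
    have "cos (2 * \<alpha> * real (K + 1)) = cos (2 * (real (K + 1) * \<alpha>))" by (simp only: mult_ac)
    then have "cos (2 * \<alpha> * real (K + 1)) = -1" unfolding KM by simp
    then show ?thesis
      using sum_fold[of "\<lambda>d. cos (2 * \<alpha> * real d) * chords.C (real d)" K, OF moment_sum_reflect disjI2[OF n]] ev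
      by (simp only: moment_sum_def if_True) simp
  qed
  have cK: "cos (2 * \<alpha> * real K) = - c2"
  proof -
    have "2 * \<alpha> * real K = pi - 2 * \<alpha>" using Ka by (simp add: algebra_simps)
    then show ?thesis by (simp only: c2_def cos_diff) simp
  qed
  have uK: "chords.u_star (real K) = 1 / (2 * s * s)"
  proof -
    have "(real K + 1) * \<alpha> = pi / 2" using KM by (simp add: add.commute)
    then show ?thesis unfolding chords.u_star_def Ka by (simp only: s_def) (simp add: cos_diff)
  qed
  have "(Q + 2) * moment_sum = 2 * W - 4 * c2 * (1 / (2 * s * s)) * J - (Q + 2) * (2 * J - 2 * \<Delta> / ((Q + 2) * (2 * r * s)\<^sup>2))"
    unfolding ms right_diff_distrib opp using sum_cos_C[OF lt] unfolding cK uK by (simp add: W_def J_def Q_def)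
  then have msum: "moment_sum = (2 * W - 4 * c2 * (1 / (2 * s * s)) * J - (Q + 2) * (2 * J - 2 * \<Delta> / ((Q + 2) * (2 * r * s)\<^sup>2))) / (Q + 2)"
    using Q by (simp add: field_simps)
  show ?thesis
    unfolding S msum s_def[symmetric] Q_def[symmetric] c2 using s r_pos Q
    by (simp add: divide_simps) (simp add: power2_eq_square algebra_simps)
qed

section \<open>Odd n: the side opposite to a vertex\<close>

lemma half_angle: "sin \<alpha> = 2 * sin (\<alpha> / 2) * cos (\<alpha> / 2)" "cos \<alpha> = 1 - 2 * (sin (\<alpha> / 2))\<^sup>2"
    "sin (\<alpha> / 2) > 0" "cos (\<alpha> / 2) > 0"
proof -
  show "sin \<alpha> = 2 * sin (\<alpha> / 2) * cos (\<alpha> / 2)" "cos \<alpha> = 1 - 2 * (sin (\<alpha> / 2))\<^sup>2"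
    using sin_double[of "\<alpha> / 2"] cos_double_sin[of "\<alpha> / 2"] by simp_all
  show "sin (\<alpha> / 2) > 0" "cos (\<alpha> / 2) > 0"
    using \<alpha>(1,2) pi_gt_zero by (intro sin_gt_zero cos_gt_zero_pi; linarith)+
qed

text \<open>The part of \<open>H3\<close> that comes from the vertex opposite to an edge; it vanishes at \<open>lam\<close>.\<close>

definition D :: "nat \<Rightarrow> real \<Rightarrow> real" where
  "D k x = 2 * cot (2 * real (k + 1) * \<alpha>) * sigma_fn (int q - 2 + 3) (lam n r) x
     - pi * cot (2 * real (k + 1) * \<alpha>) * (x powi (int q - 2 + 4) / of_int (int q - 2 + 4))
     - 2 * cos \<alpha> * (2 * r * cos (\<alpha> / 2) * (1 / cos (real (k + 1) * \<alpha>))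
          - lam n r * (1 / sin (2 * real (k + 1) * \<alpha>))) * tau_fn (int q - 2 + 1) (lam n r) x"

text \<open>For n > 3, \<open>ss n k\<close> is chosen so that, after splitting off the term with
  pi, the coefficient of the pure power is the one of \<open>H1\<close>.\<close>

lemma H3_eq_H1: "n \<noteq> 3 \<Longrightarrow> H3 n r (int q - 2) k x = H1 n r (int q - 2) k x + D k x"
  unfolding H3_def H1_def D_def ss_def pp_def by (simp add: algebra_simps)

text \<open>For the triangle \<open>pp\<close> is 0, and so is the height \<open>hh n r 0\<close>,
  for which \<open>tau_fn\<close> is a pure power; the value 1 / 2 of \<open>ss\<close> supplies the
  constant in \<open>H0\<close>.\<close>

lemma H3_eq_H0:
  assumes "n = 3"
  shows "H3 n r (int q - 2) 0 x = H0 n r (int q - 2) x + D 0 x"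
proof -
  have tc: "tan \<alpha> - cot \<alpha> = - 2 * cot (2 * \<alpha>)"
    using \<alpha>(3,4) by (simp add: tan_def cot_def cos_double sin_double divide_simps power2_eq_square)
  have h: "hh n r 0 = 0" by (simp add: hh_def)
  have tau: "tau_fn (int q - 2 + 1) 0 x = x powi (int q - 2 + 3) / (real q + 1)"
    by (simp add: tau_fn_def)
  have qt: "2 * r * qq n 0 * cos \<alpha> = - ell n r 1"
    using \<alpha>(4) by (simp add: qq_def ell_def tan_def)
  have p: "pp n 0 = 0" "ss n 0 = 1 / 2" using assms by (simp_all add: pp_def ss_def)
  show ?thesis
    unfolding H3_def H0_def D_def tc h tau qt p powi_shift
    using Q by (simp add: divide_simps) (simp add: algebra_simps)
qed

lemma lam_pos: "lam n r > 0"
  using half_angle(4) r_pos by (simp add: lam_def)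

text \<open>At x = \<open>lam\<close> the arcsine is pi / 2, so the \<open>sigma_fn\<close> term
  cancels the term with pi, while \<open>psi\<close> and the square root vanish.\<close>

lemma D_lam: "D k (lam n r) = 0"
proof -
  have "psi (int (q + 1)) (lam n r) (lam n r) = 0" by (rule psi_self[OF lam_pos])
  then show ?thesis
    unfolding D_def sigma_fn_eq[OF q1 lam_pos order.refl] tau_fn_eq[OF q1 lam_pos order.refl] powi_shift
    using lam_pos by (simp add: add.commute) (simp add: field_simps)
qed

text \<open>\<open>lam\<close> is the distance of a vertex from the line of its opposite edge K + 1,
  and the foot is the midpoint of that edge. The \<open>psi\<close> value in \<open>D\<close> is
  therefore half of the edge integral, and the pure powers cancel against
  \<open>T (K + 1)\<close>.\<close>

lemma odd_end:
  assumes n: "n = 2 * K + 3"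
  shows "T (K + 1) + D K (ell n r (K + 1))
    = (2 * r * sin \<alpha>)\<^sup>2 * cos \<alpha> / (2 * (sin (\<alpha> / 2))\<^sup>2 * (real q * (real q + 2))) * chords.I (real (K + 1))"
proof -
  have Ma: "real (K + 1) * \<alpha> = pi / 2 - \<alpha> / 2" using \<alpha>(5) n by (simp add: field_simps)
  have M1a: "(real (K + 1) + 1) * \<alpha> = pi / 2 + \<alpha> / 2" using Ma by (simp add: algebra_simps)
  have "2 * (real (K + 1) * \<alpha>) = pi - \<alpha>" unfolding Ma by simp
  then have M2a: "2 * real (K + 1) * \<alpha> = pi - \<alpha>" by (simp only: mult.assoc)
  define s where "s = sin (\<alpha> / 2)"
  define c where "c = cos (\<alpha> / 2)"
  have s: "s > 0" and c: "c > 0" using half_angle(3,4) by (simp_all add: s_def c_def)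
  have sc: "c\<^sup>2 = 1 - s\<^sup>2" by (simp add: s_def c_def cos_squared_eq)
  have sa: "sin \<alpha> = 2 * s * c" and ca: "cos \<alpha> = 1 - 2 * s\<^sup>2" using half_angle(1,2) by (simp_all add: s_def c_def)
  have snM: "sn (K + 1) = c" and csM: "cs (K + 1) = s" unfolding Ma by (simp_all add: s_def c_def sin_diff cos_diff)
  have l: "ell n r (K + 1) = 2 * r * c" unfolding ell_eq snM ..
  have lam: "lam n r = 2 * r * c\<^sup>2" by (simp add: lam_def c_def)
  have s2M: "sin (2 * real (K + 1) * \<alpha>) = 2 * s * c" unfolding M2a sa[symmetric] by simp
  have cotM: "cot (2 * real (K + 1) * \<alpha>) = - (1 - 2 * s\<^sup>2) / (2 * s * c)"
    unfolding cot_def s2M unfolding M2a ca[symmetric] by simp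
  have c1: "c \<le> 1" by (simp add: c_def)
  have le: "lam n r \<le> 2 * r * c"
    unfolding lam using c c1 r_pos by (simp add: power2_eq_square mult_le_cancel_left1)
  have y: "sqrt ((2 * r * c)\<^sup>2 - (2 * r * c\<^sup>2)\<^sup>2) = 2 * r * c * s"
  proof -
    have "(2 * r * c)\<^sup>2 - (2 * r * c\<^sup>2)\<^sup>2 = (2 * r * c)\<^sup>2 * (1 - c\<^sup>2)"
      by (simp add: power_mult_distrib algebra_simps power2_eq_square)
    also have "\<dots> = (2 * r * c * s)\<^sup>2" unfolding sc by (simp add: power_mult_distrib)
    finally have "(2 * r * c)\<^sup>2 - (2 * r * c\<^sup>2)\<^sup>2 = (2 * r * c * s)\<^sup>2" .
    moreover have "2 * r * c * s > 0" using r_pos c s by simp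
    ultimately show ?thesis by (simp only: real_sqrt_abs)
  qed
  have as: "arcsin (2 * r * c\<^sup>2 / (2 * r * c)) = pi / 2 - \<alpha> / 2"
  proof -
    have "2 * r * c\<^sup>2 / (2 * r * c) = sin (pi / 2 - \<alpha> / 2)"
      using r_pos c by (simp add: sin_diff c_def[symmetric] power2_eq_square)
    then show ?thesis using \<alpha>(1,2) pi_gt_zero by (simp only:) (intro arcsin_sin; linarith)
  qed
  define Q where "Q = real q"
  have Q: "Q > 0" using q1 by (simp add: Q_def)
  define p where "p = psi (int (q + 1)) (2 * r * c\<^sup>2) (2 * r * c)"
  define J where "J = chords.I (real (K + 1))"
  have lam0: "2 * r * c\<^sup>2 > 0" using lam_pos lam by simp
  have pJ: "p = r * (2 * s * c) * J"
  proof -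
    \<comment> \<open>The edge starts half a side length before the foot of the
      perpendicular.\<close>
    have bb: "2 * r * sin (real (K + 1) * \<alpha>) * cos ((real (K + 1) + 1) * \<alpha>) = - (r * (2 * s * c))"
      unfolding snM M1a by (simp add: cos_add s_def)
    have hh: "2 * r * sin (real (K + 1) * \<alpha>) * sin ((real (K + 1) + 1) * \<alpha>) = 2 * r * c\<^sup>2"
      unfolding snM M1a by (simp add: sin_add c_def power2_eq_square)
    have "2 * r * sin \<alpha> * J = Phi (2 * r * c\<^sup>2) (Suc q) (2 * r * sin \<alpha> + - (r * (2 * s * c))) - Phi (2 * r * c\<^sup>2) (Suc q) (- (r * (2 * s * c)))"
      unfolding J_def chords.I_def chords.norm_Z_edge bb hh by (rule integral_Phi[OF lam0])
    also have "2 * r * sin \<alpha> + - (r * (2 * s * c)) = 2 * r * c * s" unfolding sa by simp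
    also have "r * (2 * s * c) = 2 * r * c * s" by simp
    \<comment> \<open>The end points are symmetric about the foot, so oddness of \<open>Phi\<close>
      doubles the value.\<close>
    also have "Phi (2 * r * c\<^sup>2) (Suc q) (2 * r * c * s) - Phi (2 * r * c\<^sup>2) (Suc q) (- (2 * r * c * s)) = 2 * p"
      using psi_eq_Phi[OF lam0, of "2 * r * c" "Suc q"] le unfolding Phi_minus[OF lam0] lam y p_def by simp
    finally show ?thesis unfolding sa by (simp add: mult_ac)
  qed
  have D: "D K (2 * r * c) = 2 * (- (1 - 2 * s\<^sup>2) / (2 * s * c)) * (((2 * r * c) ^ (q + 2) * (pi / 2 - \<alpha> / 2) + 2 * r * c\<^sup>2 * p) / (Q + 2))
     - pi * (- (1 - 2 * s\<^sup>2) / (2 * s * c)) * ((2 * r * c) ^ (q + 2) / (Q + 2))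
     - 2 * (1 - 2 * s\<^sup>2) * (2 * r * c * (1 / s) - 2 * r * c\<^sup>2 * (1 / (2 * s * c))) * (((2 * r * c) ^ q * (2 * r * c * s) - p) / Q)"
    unfolding D_def sigma_fn_eq[OF q1 lam_pos le] tau_fn_eq[OF q1 lam_pos le] powi_shift s2M cotM csM ca
    unfolding lam as y p_def[symmetric] Q_def[symmetric] c_def[symmetric]
    by (simp add: Q_def add.commute)
  have T: "T (K + 1) = \<alpha> * (- (1 - 2 * s\<^sup>2) / (2 * s * c)) * (2 * r * c) ^ (q + 2) / (Q + 2)
      + r * (2 * s * c) * (1 - 2 * s\<^sup>2) * (2 * r * c) ^ (q + 1) / (Q * s)"
    unfolding T_def cotM l csM ca sa Q_def ..
  define X where "X = (2 * r * c) ^ q"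
  have pw: "(2 * r * c) ^ (q + 2) = 4 * r\<^sup>2 * c\<^sup>2 * X" "(2 * r * c) ^ (q + 1) = 2 * r * c * X"
    by (simp_all add: X_def power_add power2_eq_square)
  show ?thesis
    unfolding l T D pw J_def[symmetric] sa ca pJ s_def[symmetric] Q_def[symmetric] X_def[symmetric]
    using s c r_pos Q by (simp add: divide_simps) (simp add: power2_eq_square algebra_simps)
qed

text \<open>All K + 1 pieces enter with their \<open>H0\<close> or \<open>H1\<close> value; the
  loose end of \<open>sum_cos_C\<close> at \<open>I (K + 1)\<close> is then what
  \<open>odd_end\<close> provides.\<close>

lemma odd_case:
  assumes n: "n = 2 * K + 3"
  shows "real q * 2 * ((\<Sum>k<K + 1. R k) + D K (ell n r (K + 1))) = - (2 * r * sin \<alpha>)\<^sup>2 * moment_sum"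
proof -
  have Ma: "real (K + 1) * \<alpha> = pi / 2 - \<alpha> / 2" using \<alpha>(5) n by (simp add: field_simps)
  then have lt: "real (K + 1) * \<alpha> < pi / 2" using \<alpha>(1) by simp
  define J where "J = chords.I (real (K + 1))"
  define W where "W = (\<Sum>k<K + 1. w k * chords.I (real k))"
  define s where "s = sin (\<alpha> / 2)"
  define Q where "Q = real q"
  have s: "s > 0" using half_angle(3) by (simp add: s_def)
  have Q: "Q > 0" using q1 by (simp add: Q_def)
  have S: "(\<Sum>k<K + 1. R k) + D K (ell n r (K + 1))
    = (2 * r * sin \<alpha>)\<^sup>2 * cos \<alpha> / (2 * s\<^sup>2 * (Q * (Q + 2))) * J - (2 * r * sin \<alpha>)\<^sup>2 / (Q * (Q + 2)) * W"
  proof -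
    have "n \<noteq> 3 \<or> K + 1 \<le> 1" using n by auto
    from sum_R[OF lt this] odd_end[OF n] show ?thesis
      unfolding W_def[symmetric] J_def[symmetric] s_def[symmetric] Q_def[symmetric] by linarith
  qed
  have odd: "\<not> even n" and M: "n = 2 * (K + 1) + 1 \<or> n = 2 * (K + 1) + 2" using n by simp_all
  have "moment_sum = chords.C 0 + 2 * (\<Sum>d=1..K + 1. cos (2 * \<alpha> * real d) * chords.C (real d))"
    using sum_fold[of "\<lambda>d. cos (2 * \<alpha> * real d) * chords.C (real d)" "K + 1", OF moment_sum_reflect M]
    unfolding moment_sum_def if_not_P[OF odd] by simp
  then have "(Q + 2) * moment_sum = 2 * W + 4 * cos (2 * \<alpha> * real (K + 1)) * chords.u_star (real (K + 1)) * J"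
    using sum_cos_C[OF lt] by (simp only: W_def J_def Q_def)
  moreover have "cos (2 * \<alpha> * real (K + 1)) = - cos \<alpha>"
  proof -
    have "2 * \<alpha> * real (K + 1) = pi - \<alpha>" using Ma by (simp add: algebra_simps)
    then show ?thesis by (simp only: cos_diff) simp
  qed
  moreover have "chords.u_star (real (K + 1)) = 1 / (4 * s\<^sup>2)"
  proof -
    have "(real (K + 1) + 1) * \<alpha> = pi / 2 + \<alpha> / 2" using Ma by (simp add: algebra_simps)
    then show ?thesis
      unfolding chords.u_star_def Ma using half_angle by (simp add: sin_add cos_diff s_def power2_eq_square)
  qed
  ultimately have "(Q + 2) * moment_sum = 2 * W + 4 * (- cos \<alpha>) * (1 / (4 * s\<^sup>2)) * J"
    by (simp only:)
  then have "(Q + 2) * moment_sum = 2 * W - cos \<alpha> / s\<^sup>2 * J" by simp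
  then have ms: "moment_sum = (2 * W - cos \<alpha> / s\<^sup>2 * J) / (Q + 2)"
    using Q by (simp add: eq_divide_eq mult.commute)
  show ?thesis
    unfolding S ms Q_def[symmetric] using s Q by (simp add: divide_simps) (simp add: algebra_simps)
qed

section \<open>Assembling the pieces\<close>

lemma ell_less_lam:
  assumes "real (k + 1) * \<alpha> \<le> pi / 2 - \<alpha>"
  shows "ell n r (k + 1) < lam n r"
proof -
  have "sin (real (k + 1) * \<alpha>) \<le> sin (pi / 2 - \<alpha>)"
  proof (rule sin_monotone_2pi_le)
    have "0 \<le> real (k + 1) * \<alpha>" using \<alpha>(1) by simp
    then show "- (pi / 2) \<le> real (k + 1) * \<alpha>" using pi_gt_zero by linarith
  qed (use assms \<alpha>(1) in simp_all)
  then have "sin (real (k + 1) * \<alpha>) \<le> cos \<alpha>" by (simp add: sin_diff)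
  moreover have "2 * (cos (\<alpha> / 2))\<^sup>2 = 1 + cos \<alpha>"
    using cos_double_cos[of "\<alpha> / 2"] by simp
  moreover have "cos \<alpha> < 1" using half_angle(2,3) by simp
  ultimately have "2 * sin (real (k + 1) * \<alpha>) < 2 * (cos (\<alpha> / 2))\<^sup>2" by linarith
  then have "r * (2 * sin (real (k + 1) * \<alpha>)) < r * (2 * (cos (\<alpha> / 2))\<^sup>2)" using r_pos by simp
  then show ?thesis by (simp add: ell_def lam_def mult_ac)
qed

text \<open>Below the last index (k + 1) \<alpha> \<le> pi / 2 - \<alpha>, so
  \<open>ell n r (k + 1)\<close> is at most 2 r cos \<alpha> and hence less than r + r cos \<alpha>,
  which is \<open>lam\<close>.\<close>

lemma JJ_lower:
  assumes "k < Kmax n"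
  shows "JJ n r (int q - 2) k (ell n r (k + 1)) = R k"
proof -
  have "2 * (k + 1) + 2 \<le> n" using assms unfolding Kmax_def by arith
  then have "real (2 * (k + 1) + 2) \<le> real n" by (simp only: of_nat_le_iff)
  then have "2 * (real k + 1) + 2 \<le> real n" by simp
  then have "(2 * (real k + 1) + 2) * \<alpha> \<le> real n * \<alpha>" using \<alpha>(1) by (intro mult_right_mono) auto
  then have "real (k + 1) * \<alpha> \<le> pi / 2 - \<alpha>" unfolding \<alpha>(5) by (simp add: algebra_simps)
  then have "ell n r (k + 1) < lam n r" by (rule ell_less_lam)
  then show ?thesis using assms by (cases "k = 0") (auto simp: JJ_def R_def)
qed

lemma sum_JJ: "real q * 2 * (\<Sum>k=0..Kmax n. JJ n r (int q - 2) k (ell n r (k + 1))) = - (2 * r * sin \<alpha>)\<^sup>2 * moment_sum"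
proof -
  define K where "K = Kmax n"
  have split: "(\<Sum>k=0..Kmax n. JJ n r (int q - 2) k (ell n r (k + 1)))
    = (\<Sum>k<K. R k) + JJ n r (int q - 2) K (ell n r (K + 1))"
  proof -
    have "(\<Sum>k<K. JJ n r (int q - 2) k (ell n r (k + 1))) = (\<Sum>k<K. R k)"
      by (intro sum.cong refl JJ_lower) (simp add: K_def)
    then show ?thesis
      unfolding K_def[symmetric] atLeast0AtMost lessThan_Suc_atMost[symmetric] sum.lessThan_Suc by simp
  qed
  show ?thesis
  proof (cases "even n")
    case True
    then have n: "n = 2 * K + 2" using n3 by (auto simp: K_def Kmax_def elim!: evenE)
    \<comment> \<open>With truncated subtraction \<open>K \<le> K - 1\<close> would hold for K = 0,
      which n \<ge> 4 excludes; otherwise the case distinction of \<open>JJ\<close> would not reach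
      its \<open>H2\<close> branch.\<close>
    then have "K \<noteq> 0" "\<not> K \<le> K - 1" using n3 by auto
    then have "JJ n r (int q - 2) K (ell n r (K + 1)) = H2 n r (int q - 2) K (ell n r (K + 1)) - H2 n r (int q - 2) K (ell n r K)"
      using True by (simp add: JJ_def K_def[symmetric])
    then show ?thesis unfolding split using even_case[OF n] by simp
  next
    case False
    then have n: "n = 2 * K + 3" using n3 by (auto simp: K_def Kmax_def elim!: oddE)
    have Ma: "real (K + 1) * \<alpha> = pi / 2 - \<alpha> / 2" using \<alpha>(5) n by (simp add: field_simps)
    have "cos (\<alpha> / 2) * cos (\<alpha> / 2) \<le> 1 * cos (\<alpha> / 2)"
      using half_angle(4) by (intro mult_right_mono) auto
    then have "lam n r \<le> ell n r (K + 1)"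
      unfolding ell_eq Ma using r_pos by (simp add: lam_def sin_diff power2_eq_square)
    then have le: "\<not> ell n r (K + 1) < lam n r" by simp
    \<comment> \<open>\<open>H3\<close> exceeds \<open>H0\<close> or \<open>H1\<close> by
      \<open>D\<close>, and \<open>D\<close> vanishes at \<open>lam\<close>. So the values at
      \<open>lam\<close> cancel, and the switch at \<open>lam\<close> only adds \<open>D\<close> at
      the end point.\<close>
    have "JJ n r (int q - 2) K (ell n r (K + 1)) = R K + D K (ell n r (K + 1))"
    proof (cases "K = 0")
      case True
      then have n': "n = 3" using n by simp
      have "JJ n r (int q - 2) K (ell n r (K + 1))
        = H3 n r (int q - 2) 0 (ell n r (K + 1)) - H3 n r (int q - 2) 0 (lam n r) + H0 n r (int q - 2) (lam n r)"
        unfolding JJ_def using le n' True by simp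
      then show ?thesis unfolding H3_eq_H0[OF n'] using True D_lam[of 0] by (simp add: R_def)
    next
      case K: False
      then have n': "n \<noteq> 3" "n > 3" using n by simp_all
      have "JJ n r (int q - 2) K (ell n r (K + 1))
        = H3 n r (int q - 2) K (ell n r (K + 1)) - H3 n r (int q - 2) K (lam n r)
          + H1 n r (int q - 2) K (lam n r) - H1 n r (int q - 2) K (ell n r K)"
        unfolding JJ_def using le n' K False by simp
      then show ?thesis unfolding H3_eq_H1[OF n'(1)] using K D_lam[of K] by (simp add: R_def)
    qed
    then show ?thesis unfolding split using odd_case[OF n] by (simp add: algebra_simps)
  qed
qed

end

theorem theorem3:
  fixes n :: nat and r :: real and m :: int and c :: complex and \<theta> :: real
    and M :: "'a measure" and X Y :: "'a \<Rightarrow> complex"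
  assumes "n \<ge> 3" and "r > 0" and "m \<ge> -1"
    and "prob_space M"
    and "prob_space.indep_var M borel X borel Y"
    and "distr M borel X = uniform_measure lborel (regular_polygon c \<theta> n r)"
    and "distr M borel Y = uniform_measure lborel (regular_polygon c \<theta> n r)"
  shows "integrable M (\<lambda>\<omega>. dist (X \<omega>) (Y \<omega>) powi m) \<and>
    prob_space.expectation M (\<lambda>\<omega>. dist (X \<omega>) (Y \<omega>) powi m) =
      2 * perim n r / (of_int (m + 2) * (area n r)\<^sup>2 * ell n r 1)
        * (\<Sum>k=0..Kmax n. JJ n r m k (ell n r (k + 1)))"
proof -
  define q where "q = nat (m + 2)"
  have m: "m = int q - 2" and q1: "q \<ge> 1" using assms(3) by (simp_all add: q_def)
  interpret regular_ngon c \<theta> n r q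
    by standard (use assms q1 in auto)
  define S where "S = (\<Sum>k=0..Kmax n. JJ n r (int q - 2) k (ell n r (k + 1)))"
  have "- (real n * (2 * r * sin (alpha n))\<^sup>2 * moment_sum) / (real q)\<^sup>2 / (area n r)\<^sup>2
    = real n * (real q * 2 * S) / (real q)\<^sup>2 / (area n r)\<^sup>2"
    unfolding S_def sum_JJ by simp
  \<comment> \<open>The perimeter is n times \<open>ell n r 1\<close>, so the prefactor of the
    theorem is 2 n / (q \<open>area\<close>^2).\<close>
  also have "\<dots> = 2 * perim n r / (of_int (m + 2) * (area n r)\<^sup>2 * ell n r 1) * S"
    using assms(2) alpha_bounds(3)[OF assms(1)] q1 unfolding perim_def m ell_1
    by (simp add: field_simps power2_eq_square)
  finally have "- (real n * (2 * r * sin (alpha n))\<^sup>2 * moment_sum) / (real q)\<^sup>2 / (area n r)\<^sup>2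
    = 2 * perim n r / (of_int (m + 2) * (area n r)\<^sup>2 * ell n r 1) * S" .
  then show ?thesis
    using distance_moment[OF assms(4-7)] unfolding m S_def moment_sum_def by simp
qed

end
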